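(* Let $K$ be an algebraically closed field of characteristic $2$, let $a\in K\setminus\{0,1\}$, and let $G(F_{4,a})$ be the simple contragredient Lie $2$-algebra of dimension $34$ over $K$ with Cartan matrix $$F_{4,a}=\begin{pmatrix}0&1&0&0\\ a&0&1&0\\ 0&1&0&1\\ 0&0&1&0\end{pmatrix}.$$ Then $G(F_{4,a})$ has toral rank $4$. Furthermore, the torus $T(\mathfrak h)$ is $4$-dimensional, and the Cartan decomposition of $G(F_{4,a})$ with respect to $T(\mathfrak h)$ is $$G(F_{4,a})=T(\mathfrak h)\oplus\Big(\bigoplus_{\xi\in G\setminus\{0\}}\mathfrak g_\xi\Big),$$ where $G=\langle\alpha,\beta,\gamma,\lambda\rangle$ is an elementary abelian group of order $16$, and $\dim_K\mathfrak g_\xi=2$ for all $\xi\in G\setminus\{0\}$.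
   Context: Lie $2$-algebra: a Lie algebra $\mathfrak g$ over $K$ with a map $[2]:\mathfrak g\to\mathfrak g$, $x\mapsto x^{[2]}$, such that $(x+y)^{[2]}=x^{[2]}+y^{[2]}+[x,y]$, $(\mu x)^{[2]}=\mu^2x^{[2]}$ and $\mathrm{ad}(x^{[2]})=(\mathrm{ad}\,x)^2$ for all $x,y\in\mathfrak g$, $\mu\in K$. If the center of $\mathfrak g$ is zero, such a map is unique if it exists. A torus is a subalgebra on which $[2]$ is invertible; an element $t$ is toral if $t^{[2]}=t$. The toral rank is $MT(\mathfrak g)=\max\{\dim_K\mathfrak t:\mathfrak t\text{ a torus in }\mathfrak g\}$. Contragredient Lie algebra: for an $n\times n$ matrix $A=(a_{ij})$ over $K$, $\widetilde G(A)$ is the Lie algebra over $K$ with generators $e_i,f_i,h_i$ ($1\le i\le n$) and relations $[e_i,f_j]=\delta_{ij}h_j$, $[h_i,h_j]=0$, $[h_i,e_j]=a_{ij}e_j$, $[h_i,f_j]=-a_{ij}f_j$. It is $\mathbb Z$-graded, $\widetilde G(A)=\bigoplus_{i\in\mathbb Z}\widetilde G_i$, by $\deg e_i=1$, $\deg f_i=-1$, $\deg h_i=0$. Let $J(A)$ be the maximal homogeneous ideal with $J(A)\cap(\widetilde G_{-1}\oplus\widetilde G_0\oplus\widetilde G_1)=0$. Then $G(A)=\widetilde G(A)/J(A)$ is the contragredient Lie algebra with Cartan matrix $A$. For $a\in K\setminus\{0,1\}$ it is known (Kac and Veĭsfeĭler) that $G(F_{4,a})$ is a simple Lie $2$-algebra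 of dimension $34$. Notation: $\bar h_i$ is the image of $h_i$ in $G(F_{4,a})$; $\mathfrak h=\mathrm{span}_K\{\bar h_1,\bar h_2,\bar h_3,\bar h_4\}$, a Cartan subalgebra; $T(\mathfrak h)$ is the torus generated by the toral elements lying in $\mathfrak h$. It has the basis of toral elements $\bar h_1,\ \tfrac1a(\bar h_2+\bar h_4),\ \bar h_3,\ \bar h_4$, and $\alpha,\beta,\gamma,\lambda\in T(\mathfrak h)^*$ denote the basis dual to this one, in this order. $G$ is the additive subgroup of $T(\mathfrak h)^*$ generated by $\alpha,\beta,\gamma,\lambda$. For $\xi\in T(\mathfrak h)^*$, $\mathfrak g_\xi=\{x\in G(F_{4,a}) : [t,x]=\xi(t)x\ \text{for all } t\in T(\mathfrak h)\}$. *)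

theory Defs
  imports
    "HOL-Analysis.Cartesian_Space"
    "HOL-Library.Poly_Mapping"
    "HOL-Algebra.QuotRing"
    "HOL-Algebra.Generated_Groups"
    "HOL-Computational_Algebra.Primes"
    "Jordan_Normal_Form.VS_Connect"
begin

hide_const (open) Multiset.mult Polynomial.smult
no_notation Matrix.vec_index (infixl "$" 100)

section \<open>Lie algebras as records\<close>

text \<open>
  An algebra over the field given by the type \<^typ>\<open>'k\<close> is a \<^typ>\<open>('k, 'v) module\<close> record over
  \<^term>\<open>class_ring\<close>. The field \<^term>\<open>mult\<close> of the record is the Lie bracket, so
  \<open>x \<otimes>\<^bsub>L\<^esub> y\<close> is \<open>[x, y]\<close>; the field \<^term>\<open>one\<close> is never used.
\<close>

abbreviation vspan :: "('k::field, 'v) module \<Rightarrow> 'v set \<Rightarrow> 'v set"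
  where "vspan L \<equiv> LinearCombinations.module.span class_ring L"

abbreviation vsubspace :: "('k::field, 'v) module \<Rightarrow> 'v set \<Rightarrow> bool"
  where "vsubspace L W \<equiv> VectorSpace.subspace class_ring W L"

abbreviation vdim :: "('k::field, 'v) module \<Rightarrow> 'v set \<Rightarrow> nat"
  where "vdim L W \<equiv> VectorSpace.vectorspace.dim class_ring (L\<lparr>carrier := W\<rparr>)"

locale lie_algebra = vectorspace class_ring L
  for L :: "('k::field, 'v) module" (structure) +
  assumes bracket_closed: "\<lbrakk>x \<in> carrier L; y \<in> carrier L\<rbrakk> \<Longrightarrow> x \<otimes> y \<in> carrier L"
    and bracket_add_left: "\<lbrakk>x \<in> carrier L; y \<in> carrier L; z \<in> carrier L\<rbrakk>
          \<Longrightarrow> (x \<oplus> y) \<otimes> z = x \<otimes> z \<oplus> y \<otimes> z"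
    and bracket_add_right: "\<lbrakk>x \<in> carrier L; y \<in> carrier L; z \<in> carrier L\<rbrakk>
          \<Longrightarrow> x \<otimes> (y \<oplus> z) = x \<otimes> y \<oplus> x \<otimes> z"
    and bracket_smult_left: "\<lbrakk>x \<in> carrier L; y \<in> carrier L\<rbrakk>
          \<Longrightarrow> (c \<odot> x) \<otimes> y = c \<odot> (x \<otimes> y)"
    and bracket_smult_right: "\<lbrakk>x \<in> carrier L; y \<in> carrier L\<rbrakk>
          \<Longrightarrow> x \<otimes> (c \<odot> y) = c \<odot> (x \<otimes> y)"
    and bracket_alternating: "x \<in> carrier L \<Longrightarrow> x \<otimes> x = \<zero>"
    and jacobi: "\<lbrakk>x \<in> carrier L; y \<in> carrier L; z \<in> carrier L\<rbrakk>
          \<Longrightarrow> x \<otimes> (y \<otimes> z) \<oplus> y \<otimes> (z \<otimes> x) \<oplus> z \<otimes> (x \<otimes> y) = \<zero>"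

text \<open>Closure on both sides, as ideals are also formed in algebras that are not yet known to be
  anticommutative.\<close>

definition lie_ideal :: "('k::field, 'v) module \<Rightarrow> 'v set \<Rightarrow> bool"
  where "lie_ideal L I \<longleftrightarrow> vsubspace L I \<and>
    (\<forall>x\<in>carrier L. \<forall>y\<in>I. x \<otimes>\<^bsub>L\<^esub> y \<in> I \<and> y \<otimes>\<^bsub>L\<^esub> x \<in> I)"

definition ideal_generated :: "('k::field, 'v) module \<Rightarrow> 'v set \<Rightarrow> 'v set"
  where "ideal_generated L S = \<Inter>{I. lie_ideal L I \<and> S \<subseteq> I}"

definition lie_subalgebra :: "('k::field, 'v) module \<Rightarrow> 'v set \<Rightarrow> bool"
  where "lie_subalgebra L M \<longleftrightarrow> vsubspace L M \<and> (\<forall>x\<in>M. \<forall>y\<in>M. x \<otimes>\<^bsub>L\<^esub> y \<in> M)"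

definition lie_simple :: "('k::field, 'v) module \<Rightarrow> bool"
  where "lie_simple L \<longleftrightarrow> lie_algebra L \<and>
    (\<exists>x\<in>carrier L. \<exists>y\<in>carrier L. x \<otimes>\<^bsub>L\<^esub> y \<noteq> \<zero>\<^bsub>L\<^esub>) \<and>
    (\<forall>I. lie_ideal L I \<longrightarrow> I = {\<zero>\<^bsub>L\<^esub>} \<or> I = carrier L)"

definition lie_quot :: "('k::field, 'v) module \<Rightarrow> 'v set \<Rightarrow> ('k, 'v set) module"
  where "lie_quot L I =
    \<lparr>carrier = a_rcosets\<^bsub>L\<^esub> I, mult = rcoset_mult L I, one = I, zero = I, add = set_add L,
     smult = (\<lambda>c X. \<Union>x\<in>X. I +>\<^bsub>L\<^esub> (c \<odot>\<^bsub>L\<^esub> x))\<rparr>"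

definition internal_direct_sum ::
    "('k::field, 'v) module \<Rightarrow> 'i set \<Rightarrow> ('i \<Rightarrow> 'v set) \<Rightarrow> bool"
  where "internal_direct_sum L I W \<longleftrightarrow> finite I \<and> (\<forall>i\<in>I. vsubspace L (W i)) \<and>
    (\<forall>x\<in>carrier L. \<exists>!c. c \<in> (\<Pi>\<^sub>E i\<in>I. W i) \<and> x = (\<Oplus>\<^bsub>L\<^esub>i\<in>I. c i))"


section \<open>Contragredient Lie algebras\<close>

datatype 'n cgen = E 'n | F 'n | H 'n

datatype 'x magma = Gen 'x | Br "'x magma" "'x magma"

text \<open>The free nonassociative algebra on \<open>'x\<close>: finitely supported linear combinations of
  bracketed words.\<close>

definition free_alg :: "('k::field, 'x magma \<Rightarrow>\<^sub>0 'k) module"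
  where "free_alg =
    \<lparr>carrier = UNIV,
     mult = (\<lambda>p q. \<Sum>u\<in>Poly_Mapping.keys p. \<Sum>v\<in>Poly_Mapping.keys q.
        Poly_Mapping.single (Br u v) (Poly_Mapping.lookup p u * Poly_Mapping.lookup q v)),
     one = 0, zero = 0, add = (+),
     smult = (\<lambda>c. Poly_Mapping.map ((*) c))\<rparr>"

abbreviation free_gen :: "'x \<Rightarrow> 'x magma \<Rightarrow>\<^sub>0 'k::field"
  where "free_gen g \<equiv> Poly_Mapping.single (Gen g) 1"

definition lie_identities :: "('x magma \<Rightarrow>\<^sub>0 'k::field) set"
  where "lie_identities =
    {p \<otimes>\<^bsub>free_alg\<^esub> p | p. True} \<union>
    {p \<otimes>\<^bsub>free_alg\<^esub> (q \<otimes>\<^bsub>free_alg\<^esub> r) + q \<otimes>\<^bsub>free_alg\<^esub> (r \<otimes>\<^bsub>free_alg\<^esub> p)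
      + r \<otimes>\<^bsub>free_alg\<^esub> (p \<otimes>\<^bsub>free_alg\<^esub> q) | p q r. True}"

definition cartan_relations :: "'k::field ^ 'n ^ 'n \<Rightarrow> ('n::finite cgen magma \<Rightarrow>\<^sub>0 'k) set"
  where "cartan_relations A =
    {free_gen (E i) \<otimes>\<^bsub>free_alg\<^esub> free_gen (F j) - (if i = j then free_gen (H j) else 0) | i j. True} \<union>
    {free_gen (H i) \<otimes>\<^bsub>free_alg\<^esub> free_gen (H j) | i j. True} \<union>
    {free_gen (H i) \<otimes>\<^bsub>free_alg\<^esub> free_gen (E j) - (A $ i $ j) \<odot>\<^bsub>free_alg\<^esub> free_gen (E j) | i j. True} \<union>
    {free_gen (H i) \<otimes>\<^bsub>free_alg\<^esub> free_gen (F j) + (A $ i $ j) \<odot>\<^bsub>free_alg\<^esub> free_gen (F j) | i j. True}"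

definition tilde_kernel :: "'k::field ^ 'n ^ 'n \<Rightarrow> ('n::finite cgen magma \<Rightarrow>\<^sub>0 'k) set"
  where "tilde_kernel A = ideal_generated free_alg (lie_identities \<union> cartan_relations A)"

definition tildeG :: "'k::field ^ 'n ^ 'n \<Rightarrow> ('k, ('n::finite cgen magma \<Rightarrow>\<^sub>0 'k) set) module"
  where "tildeG A = lie_quot free_alg (tilde_kernel A)"

fun magma_deg :: "'n cgen magma \<Rightarrow> int"
  where
    "magma_deg (Gen (E i)) = 1"
  | "magma_deg (Gen (F i)) = -1"
  | "magma_deg (Gen (H i)) = 0"
  | "magma_deg (Br u v) = magma_deg u + magma_deg v"

definition tilde_component ::
    "'k::field ^ 'n ^ 'n \<Rightarrow> int \<Rightarrow> ('n::finite cgen magma \<Rightarrow>\<^sub>0 'k) set set"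
  where "tilde_component A d =
    {tilde_kernel A +>\<^bsub>free_alg\<^esub> p | p. \<forall>u\<in>Poly_Mapping.keys p. magma_deg u = d}"

definition homogeneous_ideal ::
    "'k::field ^ 'n ^ 'n \<Rightarrow> ('n::finite cgen magma \<Rightarrow>\<^sub>0 'k) set set \<Rightarrow> bool"
  where "homogeneous_ideal A I \<longleftrightarrow> lie_ideal (tildeG A) I \<and>
    I \<subseteq> vspan (tildeG A) (\<Union>d. I \<inter> tilde_component A d)"

text \<open>The maximal homogeneous ideal is the greatest one with respect to inclusion.\<close>

definition contragredient_ideal ::
    "'k::field ^ 'n ^ 'n \<Rightarrow> ('n::finite cgen magma \<Rightarrow>\<^sub>0 'k) set set"
  where "contragredient_ideal A = (GREATEST J. homogeneous_ideal A J \<and>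
    J \<inter> (tilde_component A (-1) <+>\<^bsub>tildeG A\<^esub> tilde_component A 0 <+>\<^bsub>tildeG A\<^esub> tilde_component A 1)
      = {\<zero>\<^bsub>tildeG A\<^esub>})"

definition contragredient ::
    "'k::field ^ 'n ^ 'n \<Rightarrow> ('k, ('n::finite cgen magma \<Rightarrow>\<^sub>0 'k) set set) module"
  where "contragredient A = lie_quot (tildeG A) (contragredient_ideal A)"

definition contragredient_gen ::
    "'k::field ^ 'n ^ 'n \<Rightarrow> 'n::finite cgen \<Rightarrow> ('n cgen magma \<Rightarrow>\<^sub>0 'k) set set"
  where "contragredient_gen A g =
    contragredient_ideal A +>\<^bsub>tildeG A\<^esub> (tilde_kernel A +>\<^bsub>free_alg\<^esub> free_gen g)"

definition cartan_F4 :: "'k::field \<Rightarrow> 'k ^ 4 ^ 4"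
  where "cartan_F4 a = vector
    [vector [0, 1, 0, 0],
     vector [a, 0, 1, 0],
     vector [0, 1, 0, 1],
     vector [0, 0, 1, 0]]"

lemma cartan_F4_row:
  "cartan_F4 a $ 1 = vector [0, 1, 0, 0]" "cartan_F4 a $ 2 = vector [a, 0, 1, 0]"
  "cartan_F4 a $ 3 = vector [0, 1, 0, 1]" "cartan_F4 a $ 4 = vector [0, 0, 1, 0]"
  by (simp_all add: cartan_F4_def vector_def)

lemma vector4_nth:
  fixes w x y z :: "'a::zero"
  defines "v \<equiv> vector [w, x, y, z] :: 'a ^ 4"
  shows "v $ 1 = w" "v $ 2 = x" "v $ 3 = y" "v $ 4 = z"
  by (simp_all add: v_def vector_def)


section \<open>Lie 2-algebras and tori\<close>

locale lie_2_algebra = lie_algebra L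
  for L :: "('k::field, 'v) module" (structure) and sq :: "'v \<Rightarrow> 'v" +
  assumes sq_closed: "x \<in> carrier L \<Longrightarrow> sq x \<in> carrier L"
    and sq_add: "\<lbrakk>x \<in> carrier L; y \<in> carrier L\<rbrakk> \<Longrightarrow> sq (x \<oplus> y) = sq x \<oplus> sq y \<oplus> x \<otimes> y"
    and sq_smult: "x \<in> carrier L \<Longrightarrow> sq (c \<odot> x) = c\<^sup>2 \<odot> sq x"
    and ad_sq: "\<lbrakk>x \<in> carrier L; y \<in> carrier L\<rbrakk> \<Longrightarrow> sq x \<otimes> y = x \<otimes> (x \<otimes> y)"

definition torus :: "('k::field, 'v) module \<Rightarrow> ('v \<Rightarrow> 'v) \<Rightarrow> 'v set \<Rightarrow> bool"
  where "torus L sq T \<longleftrightarrow> lie_subalgebra L T \<and> bij_betw sq T T"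

definition toral :: "('k::field, 'v) module \<Rightarrow> ('v \<Rightarrow> 'v) \<Rightarrow> 'v \<Rightarrow> bool"
  where "toral L sq t \<longleftrightarrow> t \<in> carrier L \<and> sq t = t"

definition toral_rank :: "('k::field, 'v) module \<Rightarrow> ('v \<Rightarrow> 'v) \<Rightarrow> nat"
  where "toral_rank L sq = Max {vdim L T | T. torus L sq T}"

definition torus_generated :: "('k::field, 'v) module \<Rightarrow> ('v \<Rightarrow> 'v) \<Rightarrow> 'v set \<Rightarrow> 'v set"
  where "torus_generated L sq S = \<Inter>{T. torus L sq T \<and> S \<subseteq> T}"

definition toral_part :: "('k::field, 'v) module \<Rightarrow> ('v \<Rightarrow> 'v) \<Rightarrow> 'v set \<Rightarrow> 'v set"
  where "toral_part L sq \<hh> = torus_generated L sq {t \<in> \<hh>. toral L sq t}"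

text \<open>The dual space of a subspace, as a subspace of the function space \<^term>\<open>ring.func_space\<close>:
  functionals are extensional, that is \<^term>\<open>undefined\<close> outside \<open>T\<close>.\<close>

definition dual_space :: "('k::field, 'v) module \<Rightarrow> 'v set \<Rightarrow> ('k, 'v \<Rightarrow> 'k) module"
  where "dual_space L T = (ring.func_space class_ring T)
    \<lparr>carrier := {\<xi> \<in> T \<rightarrow>\<^sub>E UNIV.
       (\<forall>x\<in>T. \<forall>y\<in>T. \<xi> (x \<oplus>\<^bsub>L\<^esub> y) = \<xi> x + \<xi> y) \<and>
       (\<forall>c. \<forall>x\<in>T. \<xi> (c \<odot>\<^bsub>L\<^esub> x) = c * \<xi> x)}\<rparr>"

text \<open>The \<open>i\<close>-th vector of the dual basis. It is determined only if the list is a basis of \<open>T\<close>.\<close>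

definition dual_vec :: "('k::field, 'v) module \<Rightarrow> 'v set \<Rightarrow> 'v list \<Rightarrow> nat \<Rightarrow> 'v \<Rightarrow> 'k"
  where "dual_vec L T bs i = (THE \<xi>. \<xi> \<in> carrier (dual_space L T) \<and>
    (\<forall>j<length bs. \<xi> (bs ! j) = (if j = i then 1 else 0)))"

definition root_space :: "('k::field, 'v) module \<Rightarrow> 'v set \<Rightarrow> ('v \<Rightarrow> 'k) \<Rightarrow> 'v set"
  where "root_space L T \<xi> = {x \<in> carrier L. \<forall>t\<in>T. t \<otimes>\<^bsub>L\<^esub> x = \<xi> t \<odot>\<^bsub>L\<^esub> x}"

definition elementary_abelian :: "nat \<Rightarrow> ('g, 'm) monoid_scheme \<Rightarrow> bool"
  where "elementary_abelian p G \<longleftrightarrow> prime p \<and> comm_group G \<and>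
    (\<forall>x\<in>carrier G. x [^]\<^bsub>G\<^esub> p = \<one>\<^bsub>G\<^esub>)"

end

theory Submission
  imports Defs
begin

text \<open>
The proof rests on an explicit model of \<open>G(F\<^bsub>4,a\<^esub>)\<close>. In characteristic 2 put
\<open>V = W = K\<^sup>3\<close> and take quadruples \<open>(P, Q, X, Y)\<close> of \<open>3 \<times> 3\<close> matrices with \<open>P, Q\<close> of trace
zero: \<open>P\<close> and \<open>Q\<close> range over two copies of \<open>sl\<^sub>3\<close>, \<open>X\<close> over \<open>V \<otimes> W\<close> and \<open>Y\<close> over the dual space.
The nonobvious brackets are \<open>[X, X'] = X \<times> X'\<close> and \<open>[Y, Y'] = (1 + a) Y \<times> Y'\<close>, where
\<open>\<times>\<close> polarises the adjugate matrix, and \<open>[X, Y] = ((X Y)\<^sub>0, a (Y X)\<^sub>0)\<close>, where the index 0 denotes the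
trace-free part. The Jacobi identity (\<open>br_jacobi\<close>) is Freudenthal's identity
for \<open>(X \<times> X') \<times> Y\<close>; it forces the coefficient \<open>1 + a\<close>. The dimension is \<open>8 + 8 + 9 + 9 = 34\<close>.

The model satisfies the relations between the generators of \<open>G(F\<^bsub>4,a\<^esub>)\<close>, so that evaluation
(\<open>eval_free\<close>) induces a homomorphism from the algebra given by these generators and relations. Its
kernel is the maximal ideal that defines \<open>G(F\<^bsub>4,a\<^esub>)\<close> (\<open>contragredient_ideal_eq\<close>) for two
reasons. It meets the local part trivially, because the
triangular decomposition shows that the components of degrees -1, 0, 1 of the algebra given by
generators and relations are spanned by the generators. It is the greatest such homogeneous ideal,
because in the model no nonzero element of degree at least 2 is killed by all \<open>f\<^sub>i\<close>, and dually
(\<open>transitive_pos\<close>, \<open>transitive_neg\<close>). So \<open>G(F\<^bsub>4,a\<^esub>)\<close> embeds into the model, and the dimension 34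
makes the embedding an isomorphism.

In the model the Cartan subalgebra consists of the pairs of diagonal matrices and acts diagonally. As
the center is zero, squaring is determined by the adjoint action, so on diagonal elements it squares
every entry. This gives the torus \<open>T\<close>, its toral basis, and the root spaces: every nonzero
vector of length 4 over the field of two elements is the root of exactly one pair of opposite coordinates.

What remains is that no torus has dimension 5. Every torus is commutative and spanned by toral
elements (\<open>torus_element_span\<close>, \<open>torus_toral_central\<close>), since an injective 2-semilinear map of a
finite-dimensional space over an algebraically closed field has a basis of fixed vectors. If
\<open>t\<close> is toral and nonzero, then \<open>ad t\<close> is idempotent of rank at least 16:

  \<^item> The rank is divisible by 4 (\<open>toral_rank_dvd_4\<close>). The model carries a nondegenerate invariant
    alternating form. For an operator like \<open>ad t\<close> the sum of the diagonal entries over one half of a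
    symplectic basis is half the rank modulo 2, and for inner derivations this half trace vanishes.

  \<^item> The rank exceeds 12. If \<open>X\<close> or \<open>Y\<close> is nonzero, the action of \<open>SL\<^sub>3 \<times> SL\<^sub>3\<close> moves a nonzero
    entry into the corner; an extremal weight argument then gives rank at least 14. Otherwise
    \<open>P\<close> and \<open>Q\<close> are idempotent of trace zero, hence conjugate to 0 or to \<open>diag(0, 1, 1)\<close>, and the
    rank is read off.

Five independent commuting toral elements span 31 nonzero toral elements over the field of two
elements. Averaging ranks as in the Plotkin bound of coding theory (\<open>plotkin\<close>), the sum of their ranks
is \<open>16 (34 - c)\<close>, where \<open>c \<ge> 5\<close> is the dimension of their common centralizer. But it is at least
\<open>16 \<cdot> 31\<close>, a contradiction.
\<close>

section \<open>Three by three matrices\<close>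

datatype 'a mat3 = Mat3 (m11: 'a) (m12: 'a) (m13: 'a) (m21: 'a) (m22: 'a) (m23: 'a) (m31: 'a) (m32: 'a) (m33: 'a)

lemma mat3_eq_iff: "A = B \<longleftrightarrow> m11 A = m11 B \<and> m12 A = m12 B \<and> m13 A = m13 B \<and> m21 A = m21 B \<and> m22 A = m22 B \<and>
    m23 A = m23 B \<and> m31 A = m31 B \<and> m32 A = m32 B \<and> m33 A = m33 B"
  by (cases A; cases B) auto

instantiation mat3 :: (comm_ring_1) ring_1
begin

definition zero_mat3 :: "'a mat3" where "0 = Mat3 0 0 0 0 0 0 0 0 0"
definition one_mat3 :: "'a mat3" where "1 = Mat3 1 0 0 0 1 0 0 0 1"
definition plus_mat3 :: "'a mat3 \<Rightarrow> 'a mat3 \<Rightarrow> 'a mat3" where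
  "A + B = Mat3 (m11 A + m11 B) (m12 A + m12 B) (m13 A + m13 B)
    (m21 A + m21 B) (m22 A + m22 B) (m23 A + m23 B) (m31 A + m31 B) (m32 A + m32 B) (m33 A + m33 B)"
definition minus_mat3 :: "'a mat3 \<Rightarrow> 'a mat3 \<Rightarrow> 'a mat3" where
  "A - B = Mat3 (m11 A - m11 B) (m12 A - m12 B) (m13 A - m13 B)
    (m21 A - m21 B) (m22 A - m22 B) (m23 A - m23 B) (m31 A - m31 B) (m32 A - m32 B) (m33 A - m33 B)"
definition uminus_mat3 :: "'a mat3 \<Rightarrow> 'a mat3" where
  "- A = Mat3 (- m11 A) (- m12 A) (- m13 A) (- m21 A) (- m22 A) (- m23 A) (- m31 A) (- m32 A) (- m33 A)"
definition times_mat3 :: "'a mat3 \<Rightarrow> 'a mat3 \<Rightarrow> 'a mat3" where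
  "A * B = Mat3
    (m11 A * m11 B + m12 A * m21 B + m13 A * m31 B)
    (m11 A * m12 B + m12 A * m22 B + m13 A * m32 B)
    (m11 A * m13 B + m12 A * m23 B + m13 A * m33 B)
    (m21 A * m11 B + m22 A * m21 B + m23 A * m31 B)
    (m21 A * m12 B + m22 A * m22 B + m23 A * m32 B)
    (m21 A * m13 B + m22 A * m23 B + m23 A * m33 B)
    (m31 A * m11 B + m32 A * m21 B + m33 A * m31 B)
    (m31 A * m12 B + m32 A * m22 B + m33 A * m32 B)
    (m31 A * m13 B + m32 A * m23 B + m33 A * m33 B)"

lemmas mat3_ring_defs = zero_mat3_def one_mat3_def plus_mat3_def minus_mat3_def uminus_mat3_def times_mat3_def

instance
  by standard (simp_all add: mat3_ring_defs mat3_eq_iff algebra_simps)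

end

definition mscale :: "'a::comm_ring_1 \<Rightarrow> 'a mat3 \<Rightarrow> 'a mat3" where
  "mscale c A = Mat3 (c * m11 A) (c * m12 A) (c * m13 A) (c * m21 A) (c * m22 A) (c * m23 A) (c * m31 A) (c * m32 A) (c * m33 A)"

definition mtrace :: "'a::comm_ring_1 mat3 \<Rightarrow> 'a" where "mtrace A = m11 A + m22 A + m33 A"

text \<open>The trace-free part: the identity matrix has trace \<open>3 = 1\<close> in characteristic 2.\<close>

definition trfree :: "'a::comm_ring_1 mat3 \<Rightarrow> 'a mat3" where "trfree A = A + mscale (mtrace A) 1"

text \<open>The polarisation of the adjugate: \<open>cross A A\<close> is twice the adjugate of \<open>A\<close>.\<close>

definition cross :: "'a::comm_ring_1 mat3 \<Rightarrow> 'a mat3 \<Rightarrow> 'a mat3" where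
  "cross A B = Mat3
    (m22 A * m33 B + m33 A * m22 B - m23 A * m32 B - m32 A * m23 B)
    (m13 A * m32 B + m32 A * m13 B - m12 A * m33 B - m33 A * m12 B)
    (m12 A * m23 B + m23 A * m12 B - m13 A * m22 B - m22 A * m13 B)
    (m23 A * m31 B + m31 A * m23 B - m21 A * m33 B - m33 A * m21 B)
    (m11 A * m33 B + m33 A * m11 B - m13 A * m31 B - m31 A * m13 B)
    (m13 A * m21 B + m21 A * m13 B - m11 A * m23 B - m23 A * m11 B)
    (m21 A * m32 B + m32 A * m21 B - m22 A * m31 B - m31 A * m22 B)
    (m12 A * m31 B + m31 A * m12 B - m11 A * m32 B - m32 A * m11 B)
    (m11 A * m22 B + m22 A * m11 B - m12 A * m21 B - m21 A * m12 B)"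

lemmas mat3_defs = mat3_ring_defs mscale_def mtrace_def trfree_def cross_def

lemma mscale_simps:
  "mscale c (A + B) = mscale c A + mscale c B" "mscale (c + d) A = mscale c A + mscale d A"
  "mscale c (mscale d A) = mscale (c * d) A" "mscale 1 A = A" "mscale 0 A = 0" "mscale c 0 = 0"
  "A * mscale c B = mscale c (A * B)" "mscale c A * B = mscale c (A * B)"
  by (simp_all add: mat3_defs algebra_simps)

lemma mtrace_simps: "mtrace (A + B) = mtrace A + mtrace B" "mtrace (mscale c A) = c * mtrace A" "mtrace (0::'a::comm_ring_1 mat3) = 0"
  by (simp_all add: mat3_defs algebra_simps)

lemma mtrace_commute: "mtrace (A * B) = mtrace (B * A)"
  by (simp add: mat3_defs algebra_simps)

lemma trfree_simps: "trfree (A + B) = trfree A + trfree B" "trfree (mscale c A) = mscale c (trfree A)" "trfree (0::'a::comm_ring_1 mat3) = 0"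
  by (simp_all add: mat3_defs algebra_simps)

lemma cross_simps:
  "cross (A + B) C = cross A C + cross B C" "cross C (A + B) = cross C A + cross C B"
  "cross (mscale c A) B = mscale c (cross A B)" "cross A (mscale c B) = mscale c (cross A B)"
  "cross 0 A = 0" "cross A 0 = 0"
  by (simp_all add: mat3_defs algebra_simps)

lemma cross_commute: "cross A B = cross B A"
  by (simp add: mat3_defs algebra_simps)


section \<open>The model algebra of dimension 34\<close>

text \<open>The basis comes in 17 pairs \<open>(r, True)\<close>, \<open>(r, False)\<close>: two opposite root vectors, or the first two
diagonal entries of a trace-free matrix. The letters \<open>A\<close>, \<open>B\<close>, \<open>X\<close> refer to \<open>P\<close>, \<open>Q\<close> and to the
dual pair \<open>X\<close>, \<open>Y\<close>. The invariant form pairs exactly the two members of a pair.\<close>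

datatype root_pair = HP | HQ | A12 | A13 | A23 | B12 | B13 | B23
  | X11 | X12 | X13 | X21 | X22 | X23 | X31 | X32 | X33

lemma UNIV_root_pair: "(UNIV :: root_pair set) = {HP, HQ, A12, A13, A23, B12, B13, B23,
    X11, X12, X13, X21, X22, X23, X31, X32, X33}"
  by (auto intro: root_pair.exhaust)

instance root_pair :: finite
  by standard (simp add: UNIV_root_pair)

lemma all_root_pair: "(\<forall>r::root_pair. R r) \<longleftrightarrow> R HP \<and> R HQ \<and> R A12 \<and> R A13 \<and> R A23 \<and> R B12 \<and> R B13 \<and> R B23 \<and>
    R X11 \<and> R X12 \<and> R X13 \<and> R X21 \<and> R X22 \<and> R X23 \<and> R X31 \<and> R X32 \<and> R X33"
  using ball_UNIV[of R] by (simp only: UNIV_root_pair ball_simps(5,7) simp_thms)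

lemma sum_root_pair: "(\<Sum>r\<in>UNIV. f r) = f HP + f HQ + f A12 + f A13 + f A23 + f B12 + f B13 + f B23 +
    f X11 + f X12 + f X13 + f X21 + f X22 + f X23 + f X31 + f X32 + f X33" for f :: "root_pair \<Rightarrow> 'a::comm_monoid_add"
  by (simp add: UNIV_root_pair add.assoc)

type_synonym idx = "root_pair \<times> bool"

lemma all_idx: "(\<forall>i::idx. R i) \<longleftrightarrow> (\<forall>r. R (r, True) \<and> R (r, False))"
  by (simp add: all_bool_eq)

definition mP :: "'k::comm_ring_1 ^ idx \<Rightarrow> 'k mat3" where
  "mP v = Mat3 (v $ (HP, True)) (v $ (A12, True)) (v $ (A13, True))
     (v $ (A12, False)) (v $ (HP, False)) (v $ (A23, True))
     (v $ (A13, False)) (v $ (A23, False)) (v $ (HP, True) + v $ (HP, False))"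

definition mQ :: "'k::comm_ring_1 ^ idx \<Rightarrow> 'k mat3" where
  "mQ v = Mat3 (v $ (HQ, True)) (v $ (B12, True)) (v $ (B13, True))
     (v $ (B12, False)) (v $ (HQ, False)) (v $ (B23, True))
     (v $ (B13, False)) (v $ (B23, False)) (v $ (HQ, True) + v $ (HQ, False))"

definition mX :: "'k::comm_ring_1 ^ idx \<Rightarrow> 'k mat3" where
  "mX v = Mat3 (v $ (X11, True)) (v $ (X12, True)) (v $ (X13, True))
     (v $ (X21, True)) (v $ (X22, True)) (v $ (X23, True))
     (v $ (X31, True)) (v $ (X32, True)) (v $ (X33, True))"

text \<open>Transposed with respect to \<open>mX\<close>, so that the coordinate opposite to an entry of \<open>X\<close> is the entry of
\<open>Y\<close> paired with it by \<open>mtrace (X * Y)\<close>.\<close>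

definition mY :: "'k::comm_ring_1 ^ idx \<Rightarrow> 'k mat3" where
  "mY v = Mat3 (v $ (X11, False)) (v $ (X21, False)) (v $ (X31, False))
     (v $ (X12, False)) (v $ (X22, False)) (v $ (X32, False))
     (v $ (X13, False)) (v $ (X23, False)) (v $ (X33, False))"

fun mk_coord :: "'k mat3 \<Rightarrow> 'k mat3 \<Rightarrow> 'k mat3 \<Rightarrow> 'k mat3 \<Rightarrow> idx \<Rightarrow> 'k" where
  "mk_coord P Q X Y (HP, b) = (if b then m11 P else m22 P)"
| "mk_coord P Q X Y (HQ, b) = (if b then m11 Q else m22 Q)"
| "mk_coord P Q X Y (A12, b) = (if b then m12 P else m21 P)"
| "mk_coord P Q X Y (A13, b) = (if b then m13 P else m31 P)"
| "mk_coord P Q X Y (A23, b) = (if b then m23 P else m32 P)"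
| "mk_coord P Q X Y (B12, b) = (if b then m12 Q else m21 Q)"
| "mk_coord P Q X Y (B13, b) = (if b then m13 Q else m31 Q)"
| "mk_coord P Q X Y (B23, b) = (if b then m23 Q else m32 Q)"
| "mk_coord P Q X Y (X11, b) = (if b then m11 X else m11 Y)"
| "mk_coord P Q X Y (X12, b) = (if b then m12 X else m21 Y)"
| "mk_coord P Q X Y (X13, b) = (if b then m13 X else m31 Y)"
| "mk_coord P Q X Y (X21, b) = (if b then m21 X else m12 Y)"
| "mk_coord P Q X Y (X22, b) = (if b then m22 X else m22 Y)"
| "mk_coord P Q X Y (X23, b) = (if b then m23 X else m32 Y)"
| "mk_coord P Q X Y (X31, b) = (if b then m31 X else m13 Y)"
| "mk_coord P Q X Y (X32, b) = (if b then m32 X else m23 Y)"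
| "mk_coord P Q X Y (X33, b) = (if b then m33 X else m33 Y)"

definition mk :: "'k mat3 \<Rightarrow> 'k mat3 \<Rightarrow> 'k mat3 \<Rightarrow> 'k mat3 \<Rightarrow> 'k ^ idx" where
  "mk P Q X Y = (\<chi> i. mk_coord P Q X Y i)"

lemma mk_nth [simp]: "mk P Q X Y $ i = mk_coord P Q X Y i"
  by (simp add: mk_def)

lemma views_eqI:
  assumes "mP u = mP v" "mQ u = mQ v" "mX u = mX v" "mY u = mY v"
  shows "u = v"
proof -
  have "\<forall>r. u $ (r, True) = v $ (r, True) \<and> u $ (r, False) = v $ (r, False)"
    unfolding all_root_pair using assms by (simp add: mP_def mQ_def mX_def mY_def)
  then show ?thesis
    unfolding Finite_Cartesian_Product.vec_eq_iff all_idx .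
qed

lemma views_linear:
  "mP (u + v) = mP u + mP v" "mQ (u + v) = mQ u + mQ v" "mX (u + v) = mX u + mX v" "mY (u + v) = mY u + mY v"
  "mP (c *s u) = mscale c (mP u)" "mQ (c *s u) = mscale c (mQ u)" "mX (c *s u) = mscale c (mX u)" "mY (c *s u) = mscale c (mY u)"
  "mP 0 = 0" "mQ 0 = 0" "mX 0 = 0" "mY 0 = 0"
  by (simp_all add: mP_def mQ_def mX_def mY_def mat3_defs algebra_simps)

definition brP :: "'k::comm_ring_1 ^ idx \<Rightarrow> 'k ^ idx \<Rightarrow> 'k mat3" where
  "brP u v = mP u * mP v + mP v * mP u + trfree (mX u * mY v) + trfree (mX v * mY u)"

definition brQ :: "'k::comm_ring_1 \<Rightarrow> 'k ^ idx \<Rightarrow> 'k ^ idx \<Rightarrow> 'k mat3" where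
  "brQ a u v = mQ u * mQ v + mQ v * mQ u + mscale a (trfree (mY u * mX v) + trfree (mY v * mX u))"

definition brX :: "'k::comm_ring_1 \<Rightarrow> 'k ^ idx \<Rightarrow> 'k ^ idx \<Rightarrow> 'k mat3" where
  "brX a u v = mP u * mX v + mP v * mX u + mX u * mQ v + mX v * mQ u + mscale (1 + a) (cross (mY u) (mY v))"

definition brY :: "'k::comm_ring_1 ^ idx \<Rightarrow> 'k ^ idx \<Rightarrow> 'k mat3" where
  "brY u v = mY u * mP v + mY v * mP u + mQ u * mY v + mQ v * mY u + cross (mX u) (mX v)"

text \<open>The bracket. The matrix \<open>P\<close> acts on \<open>X\<close> from the left and on \<open>Y\<close> from the right, \<open>Q\<close> the other way
round; in characteristic 2 no signs are needed.\<close>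

definition br :: "'k::comm_ring_1 \<Rightarrow> 'k ^ idx \<Rightarrow> 'k ^ idx \<Rightarrow> 'k ^ idx" where
  "br a u v = mk (brP u v) (brQ a u v) (brX a u v) (brY u v)"

lemmas br_defs = brP_def brQ_def brX_def brY_def

locale char_two =
  fixes a :: "'k::field"
  assumes char2: "CHAR('k) = 2"
begin

lemma two_eq_0: "(2::'k) = 0"
  using of_nat_CHAR[where 'a='k] char2 by simp

lemma numeral_char_two [simp]: "numeral (num.Bit0 n) = (0::'k)" "numeral (num.Bit1 n) = (1::'k)"
proof -
  have "(x::'k) + x = 0" for x
    by (simp only: mult_2[symmetric] two_eq_0 mult_zero_left)
  then show "numeral (num.Bit0 n) = (0::'k)" "numeral (num.Bit1 n) = (1::'k)"
    by (simp_all only: numeral.simps add_0_left)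
qed

lemma add_self [simp]: "(x::'k) + x = 0"
  by (simp only: mult_2[symmetric] two_eq_0 mult_zero_left)

lemma add_self_left [simp]: "(x::'k) + (x + y) = y"
  by (simp add: add.assoc[symmetric])

lemma uminus_id [simp]: "- (x::'k) = x"
  by (rule minus_unique) simp

lemma diff_conv_add [simp]: "(x::'k) - y = x + y"
  by (metis diff_conv_add_uminus uminus_id)

lemma mat3_add_self [simp]: "(A::'k mat3) + A = 0" "A + (A + B) = B"
  by (simp_all add: mat3_defs mat3_eq_iff)

lemma mat3_diff [simp]: "(A::'k mat3) - B = A + B" "- A = A"
  by (simp_all add: mat3_defs)

lemma vec_add_self [simp]: "(u::'k^'n) + u = 0" "u + (u + v) = v"
  by (simp_all add: Finite_Cartesian_Product.vec_eq_iff del: mult_2 semiring_norm)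

lemma vec_diff [simp]: "(u::'k^'n) - v = u + v" "- u = u"
  by (simp_all add: Finite_Cartesian_Product.vec_eq_iff)

lemma mtrace_mP [simp]: "mtrace (mP (u::'k^idx)) = 0" and mtrace_mQ [simp]: "mtrace (mQ u) = 0"
  by (simp_all add: mtrace_def mP_def mQ_def ac_simps)

lemma mtrace_one: "mtrace (1 :: 'k mat3) = 1"
  by (simp add: mat3_defs)

lemma mtrace_tl [simp]: "mtrace (trfree (A :: 'k mat3)) = 0"
  by (simp add: trfree_def mtrace_simps mtrace_one)

lemma trace_free_m33: "mtrace (A::'k mat3) = 0 \<Longrightarrow> m33 A = m11 A + m22 A"
  by (metis add.commute add_self_left add_0_right mtrace_def)

text \<open>A trace-free matrix is recovered from its stored entries because its third diagonal entry is the
sum of the other two.\<close>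

lemma views_mk:
  "mtrace P = 0 \<Longrightarrow> mP (mk P Q X Y) = P" "mtrace Q = 0 \<Longrightarrow> mQ (mk P Q X Y) = (Q::'k mat3)"
  "mX (mk P Q X Y) = X" "mY (mk P Q X Y) = Y"
  by (simp_all add: mP_def mQ_def mX_def mY_def mat3_eq_iff trace_free_m33)

lemma mtrace_comm: "mtrace ((A::'k mat3) * B) + mtrace (B * A) = 0"
  by (simp add: mtrace_commute[of A B])

lemma mtrace_brP [simp]: "mtrace (brP u (v::'k^idx)) = 0"
  by (simp add: brP_def mtrace_simps mtrace_comm)

lemma mtrace_brQ [simp]: "mtrace (brQ a u (v::'k^idx)) = 0"
  by (simp add: brQ_def mtrace_simps mtrace_comm)

lemma views_br [simp]: "mP (br a u v) = brP u v" "mQ (br a u v) = brQ a u v"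
  "mX (br a u v) = brX a u v" "mY (br a u v) = brY u v"
  by (simp_all add: br_def views_mk)

lemma br_commute: "br a u v = br a v u"
  by (rule views_eqI) (simp_all add: br_defs cross_commute ac_simps)

lemma cross_self [simp]: "cross A A = (0::'k mat3)"
  by (simp add: cross_def zero_mat3_def)

lemma br_self [simp]: "br a u u = 0"
  by (rule views_eqI) (simp_all add: br_defs views_linear mscale_simps)

lemma br_add_left: "br a (u + v) w = br a u w + br a v w"
  by (rule views_eqI) (simp_all add: br_defs views_linear algebra_simps mscale_simps trfree_simps cross_simps)

lemma br_add_right: "br a w (u + v) = br a w u + br a w v"
  using br_add_left br_commute by metis

lemma br_scale_left: "br a (c *s u) w = c *s br a u w"
  by (rule views_eqI) (simp_all add: br_defs views_linear algebra_simps mscale_simps trfree_simps cross_simps)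

lemma br_scale_right: "br a w (c *s u) = c *s br a w u"
  using br_scale_left br_commute by metis

lemma br_zero [simp]: "br a 0 u = 0" "br a u 0 = 0"
  using br_scale_left[of 0 u u] br_scale_right[of u 0 u] by simp_all

lemma trfree_rotate: "trfree ((P::'k mat3) * (A * B)) = trfree (A * (B * P)) + P * trfree (A * B) + trfree (A * B) * P"
  by (simp add: trfree_def distrib_left distrib_right mscale_simps mult.assoc mtrace_commute[of P] ac_simps)

text \<open>Infinitesimal equivariance of the polarised adjugate; for trace-free \<open>P\<close> the last summand drops out.\<close>

lemma cross_mult_right: "cross ((Y::'k mat3) * P) Z = P * cross Y Z + cross Y (Z * P) + mscale (mtrace P) (cross Y Z)"
  by (simp add: mat3_defs algebra_simps)

lemma cross_mult_left: "cross (P * (X::'k mat3)) Z = cross X Z * P + cross X (P * Z) + mscale (mtrace P) (cross X Z)"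
  by (simp add: mat3_defs algebra_simps)

text \<open>The polarisation of \<open>X adj(X) = det(X) 1\<close>, whose trace-free part is zero.\<close>

lemma cross_cubic_left: "trfree ((X::'k mat3) * cross Y Z) = trfree (Y * cross Z X) + trfree (Z * cross X Y)"
  by (simp add: mat3_defs algebra_simps)

lemma cross_cubic_right: "trfree (cross Y Z * (X::'k mat3)) = trfree (cross Z X * Y) + trfree (cross X Y * Z)"
  by (simp add: mat3_defs algebra_simps)

text \<open>Freudenthal's identity, the polarised form of \<open>adj(X) \<times> Z = X Z X + tr(X Z) X\<close> in characteristic 2.\<close>

lemma cross_cross: "cross (cross X Y) (Z::'k mat3) = X * (Z * Y) + Y * (Z * X) + mscale (mtrace (X * Z)) Y + mscale (mtrace (Y * Z)) X"
  by (simp add: mat3_defs algebra_simps)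

text \<open>Each matrix component of the Jacobi sum splits into cyclic sums of one type: invariance of the
trace-free part, the two cubic identities, equivariance of the polarised adjugate, or Freudenthal's
identity, where the contributions with coefficients \<open>1\<close> and \<open>a\<close> add up to \<open>1 + a\<close>.\<close>

lemma br_jacobi: "br a u (br a v w) + br a v (br a w u) + br a w (br a u v) = 0" (is "?J u v w = 0")
proof (rule views_eqI)
  note expand = views_linear br_defs trfree_simps mscale_simps cross_simps distrib_left distrib_right mult.assoc
  (* moving P or Q from the front to the back of a product costs a commutator *)
  have rotP: "trfree (mP p * (A * B)) = trfree (A * (B * mP p)) + mP p * trfree (A * B) + trfree (A * B) * mP p" for p :: "'k^idx" and A B
    by (rule trfree_rotate)
  have rotQ: "trfree (mQ p * (A * B)) = trfree (A * (B * mQ p)) + mQ p * trfree (A * B) + trfree (A * B) * mQ p" for p :: "'k^idx" and A B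
    by (rule trfree_rotate)
  have cub: "trfree (mX u * cross (mX v) (mX w)) = trfree (mX v * cross (mX u) (mX w)) + trfree (mX w * cross (mX u) (mX v))"
    "trfree (cross (mY v) (mY w) * mY u) = trfree (cross (mY u) (mY w) * mY v) + trfree (cross (mY u) (mY v) * mY w)"
    "trfree (mY u * cross (mY v) (mY w)) = trfree (mY v * cross (mY u) (mY w)) + trfree (mY w * cross (mY u) (mY v))"
    "trfree (cross (mX v) (mX w) * mX u) = trfree (cross (mX u) (mX w) * mX v) + trfree (cross (mX u) (mX v) * mX w)"
    by (simp_all only: cross_cubic_left[of "mX u"] cross_cubic_left[of "mY u"] cross_cubic_right[of _ _ "mX u"]
        cross_cubic_right[of _ _ "mY u"] cross_commute[of "mX w" "mX u"] cross_commute[of "mY w" "mY u"])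
  have comm: "cross (mX w) (mX u) = cross (mX u) (mX w)" "cross (mX w) (mX v) = cross (mX v) (mX w)" "cross (mX v) (mX u) = cross (mX u) (mX v)"
    "cross (mY w) (mY u) = cross (mY u) (mY w)" "cross (mY w) (mY v) = cross (mY v) (mY w)" "cross (mY v) (mY u) = cross (mY u) (mY v)"
    by (rule cross_commute)+
  have equiv1: "cross (mY y * mP p) (mY z) = mP p * cross (mY y) (mY z) + cross (mY y) (mY z * mP p)" for p y z :: "'k^idx"
    by (simp add: cross_mult_right mscale_simps)
  have equiv2: "cross (mQ p * mY y) (mY z) = cross (mY y) (mY z) * mQ p + cross (mY y) (mQ p * mY z)" for p y z :: "'k^idx"
    by (simp add: cross_mult_left mscale_simps)
  have equiv3: "cross (mP p * mX y) (mX z) = cross (mX y) (mX z) * mP p + cross (mX y) (mP p * mX z)" for p y z :: "'k^idx"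
    by (simp add: cross_mult_left mscale_simps)
  have equiv4: "cross (mX y * mQ p) (mX z) = mQ p * cross (mX y) (mX z) + cross (mX y) (mX z * mQ p)" for p y z :: "'k^idx"
    by (simp add: cross_mult_right mscale_simps)
  note equiv = equiv1 equiv2 equiv3 equiv4
  note equivs = equiv[where p=u and y=v and z=w] equiv[where p=v and y=u and z=w]
    equiv[where p=w and y=u and z=v]
  have equivs': "cross (mY z) (mY y * mP p) = mP p * cross (mY y) (mY z) + cross (mY y) (mY z * mP p)"
    "cross (mY z) (mQ p * mY y) = cross (mY y) (mY z) * mQ p + cross (mY y) (mQ p * mY z)"
    "cross (mX z) (mP p * mX y) = cross (mX y) (mX z) * mP p + cross (mX y) (mP p * mX z)"
    "cross (mX z) (mX y * mQ p) = mQ p * cross (mX y) (mX z) + cross (mX y) (mX z * mQ p)" for p y z :: "'k^idx"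
    by (simp_all only: equiv[symmetric] cross_commute)
  note equivs' = equivs'[where p=u and y=v and z=w] equivs'[where p=v and y=u and z=w]
    equivs'[where p=w and y=u and z=v]
  have cross_flip: "cross A (cross B C) = cross (cross B C) A" for A B C :: "'k mat3"
    by (rule cross_commute)
  have trYX: "mtrace (mY p * mX q) = mtrace (mX q * mY p)" for p q :: "'k^idx"
    by (rule mtrace_commute)
  show "mP (?J u v w) = mP 0"
    by (simp add: expand rotP cub comm ac_simps)
  show "mQ (?J u v w) = mQ 0"
    by (simp add: expand rotQ cub comm ac_simps)
  show "mX (?J u v w) = mX 0"
    apply (simp add: expand cross_flip equivs comm)
    apply (simp add: equivs' cross_cross trfree_def expand comm trYX ac_simps)
    done
  show "mY (?J u v w) = mY 0"
    apply (simp add: expand cross_flip  equivs comm)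
    apply (simp add: equivs' cross_cross trfree_def expand comm trYX ac_simps)
    done
qed

end

section \<open>Grading, generators and the invariant form\<close>

text \<open>Let \<open>\<epsilon> = (-1, 0, 1)\<close> and \<open>\<delta> = (2, 3, -5)\<close>. The entry \<open>(i, j)\<close> of \<open>P\<close>, \<open>Q\<close>, \<open>X\<close> has degree
\<open>\<epsilon>\<^sub>i - \<epsilon>\<^sub>j\<close>, \<open>\<delta>\<^sub>j - \<delta>\<^sub>i\<close>, \<open>\<epsilon>\<^sub>i + \<delta>\<^sub>j\<close>; these are the values for which the four simple root vectors
have degree 1.\<close>

fun rdeg :: "root_pair \<Rightarrow> int" where
  "rdeg HP = 0" | "rdeg HQ = 0" | "rdeg A12 = -1" | "rdeg A13 = -2" | "rdeg A23 = -1"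
| "rdeg B12 = 1" | "rdeg B13 = -7" | "rdeg B23 = -8"
| "rdeg X11 = 1" | "rdeg X12 = 2" | "rdeg X13 = -6"
| "rdeg X21 = 2" | "rdeg X22 = 3" | "rdeg X23 = -5"
| "rdeg X31 = 3" | "rdeg X32 = 4" | "rdeg X33 = -4"

fun deg :: "idx \<Rightarrow> int" where "deg (r, b) = (if b then rdeg r else - rdeg r)"

definition graded_part :: "int \<Rightarrow> ('k::comm_ring_1 ^ idx) set" where
  "graded_part d = {u. \<forall>i. u $ i \<noteq> 0 \<longrightarrow> deg i = d}"

text \<open>The four nodes of the diagram, which is a path, are realised in \<open>Q\<close>, \<open>X\<close>, \<open>P\<close>, \<open>P\<close>, in this order.
The elements \<open>h\<^sub>i\<close> are defined as brackets afterwards.\<close>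

fun gen_ef :: "4 cgen \<Rightarrow> 'k::comm_ring_1 ^ idx" where
  "gen_ef (E i) = axis (if i = 1 then (B12, True) else if i = 2 then (X11, True) else if i = 3 then (A12, False) else (A23, False)) 1"
| "gen_ef (F i) = axis (if i = 1 then (B12, False) else if i = 2 then (X11, False) else if i = 3 then (A12, True) else (A23, True)) 1"
| "gen_ef (H i) = 0"

fun gen :: "'k \<Rightarrow> 4 cgen \<Rightarrow> 'k::comm_ring_1 ^ idx" where
  "gen a (E i) = gen_ef (E i)"
| "gen a (F i) = gen_ef (F i)"
| "gen a (H i) = br a (gen_ef (E i)) (gen_ef (F i))"

lemma axis_component: "axis i x $ j = (if j = i then x else 0)"
  by (simp add: axis_def)

lemmas coord_simps = br_def br_defs mP_def mQ_def mX_def mY_def mat3_defs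

context char_two
begin

text \<open>Every structure constant is concentrated in matching degrees: a product of coordinates that enters
coordinate \<open>i\<close> has total degree \<open>deg i\<close>.\<close>

lemma br_graded:
  assumes "u \<in> graded_part c" "v \<in> graded_part d"
  shows "br a u v \<in> graded_part (c + d)"
proof -
  have z: "u $ i * v $ j = 0" if "deg i + deg j \<noteq> c + d" for i j
    using assms that unfolding graded_part_def mem_Collect_eq by (metis mult_eq_0_iff)
  have "br a u v $ i = 0" if "deg i \<noteq> c + d" for i
    using that
    apply (cases i)
    subgoal for r b
      apply (cases r; cases b)
      apply (simp_all add: coord_simps distrib_left distrib_right z mult.commute[of "v $ _" "u $ _"])
      done
    done
  then show ?thesis
    unfolding graded_part_def by blast
qed


lemma trfree_mult_trace: "mtrace (trfree A * B) = mtrace (A * B) + mtrace A * mtrace (B::'k mat3)" "mtrace (B * trfree A) = mtrace (B * A) + mtrace A * mtrace B"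
  by (simp_all add: mat3_defs algebra_simps)

lemma mtrace_rotate: "mtrace (A * (B * C)) = mtrace (B * (C * (A::'k mat3)))" "mtrace (A * (B * C)) = mtrace (C * (A * B))"
  by (metis mult.assoc mtrace_commute)+

lemma mtrace_cross_rotate: "mtrace (A * cross B C) = mtrace (B * cross A (C::'k mat3))" "mtrace (cross B C * A) = mtrace (A * cross B C)"
  by (simp_all add: mat3_defs algebra_simps)

definition wt_form :: "root_pair \<Rightarrow> 'k" where
  "wt_form r = (if r \<in> {HQ, B12, B13, B23} then 1 else a)"

text \<open>In terms of matrices this is \<open>a tr(P P') + tr(Q Q') + a tr(X Y') + a tr(Y X')\<close>, see \<open>inv_form_views\<close>.
The coordinate form shows that it is alternating and nondegenerate.\<close>

definition inv_form :: "'k ^ idx \<Rightarrow> 'k ^ idx \<Rightarrow> 'k" where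
  "inv_form u v = (\<Sum>r\<in>UNIV. wt_form r * (u $ (r, True) * v $ (r, False) + u $ (r, False) * v $ (r, True)))"

lemma inv_form_views: "inv_form u v = a * mtrace (mP u * mP v) + mtrace (mQ u * mQ v) + a * (mtrace (mX u * mY v) + mtrace (mY u * mX v))"
  unfolding inv_form_def sum_root_pair by (simp add: wt_form_def coord_simps algebra_simps)

lemma inv_form_invariant: "inv_form (br a u v) w = inv_form u (br a v w)"
  by (simp add: inv_form_views br_defs distrib_left distrib_right trfree_simps mtrace_simps mscale_simps trfree_mult_trace
     mult.assoc mtrace_rotate mtrace_cross_rotate cross_commute mtrace_commute ac_simps)

text \<open>Only the diagonal entries of \<open>u\<close> contribute, and each of them enters the sum of the eigenvalues of all
roots in one half of the basis an even number of times.\<close>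

lemma half_trace_zero: "(\<Sum>r\<in>UNIV. br a u (axis (r, True) 1) $ (r, True)) = 0"
  unfolding sum_root_pair by (simp add: coord_simps axis_component algebra_simps)

lemma add_eq_0 [simp]: "(x::'k) + y = 0 \<longleftrightarrow> x = y"
  by (metis add_self add_self_left add_0_right)

end

locale wk4 = char_two a for a :: "'k::field" +
  assumes a_nz: "a \<noteq> 0" and a_ne1: "a \<noteq> 1"
begin

lemma idx_zeroI:
  assumes "\<forall>r. u $ (r, True) = 0 \<and> u $ (r, False) = 0" shows "(u::'k^idx) = 0"
  unfolding Finite_Cartesian_Product.vec_eq_iff all_idx using assms by simp

lemma idx_zeroD: "(u::'k^idx) = 0 \<Longrightarrow> \<forall>r. u $ (r, True) = 0 \<and> u $ (r, False) = 0"
  by simp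

text \<open>Every root vector of degree at least 2 is moved by some \<open>f\<^sub>j\<close> to a multiple of a single root vector,
and the coefficient is 1 or \<open>1 + a\<close>.\<close>

lemma transitive_pos:
  assumes "\<And>i. deg i \<le> 1 \<Longrightarrow> u $ i = 0" and "\<And>j. br a (gen_ef (F j)) u = 0"
  shows "u = 0"
proof (rule idx_zeroI)
  have "br a (gen_ef (F 3)) u $ (A23, False) = u $ (A13, False)"
    "br a (gen_ef (F 2)) u $ (X13, False) = u $ (B13, False)"
    "br a (gen_ef (F 1)) u $ (B13, False) = u $ (B23, False)"
    "br a (gen_ef (F 1)) u $ (X11, True) = u $ (X12, True)"
    "br a (gen_ef (F 3)) u $ (X23, False) = u $ (X13, False)"
    "br a (gen_ef (F 2)) u $ (A12, False) = u $ (X21, True)"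
    "br a (gen_ef (F 1)) u $ (X21, True) = u $ (X22, True)"
    "br a (gen_ef (F 2)) u $ (X32, True) = (1 + a) * u $ (X23, False)"
    "br a (gen_ef (F 2)) u $ (A13, False) = u $ (X31, True)"
    "br a (gen_ef (F 1)) u $ (X31, True) = u $ (X32, True)"
    "br a (gen_ef (F 2)) u $ (X22, True) = (1 + a) * u $ (X33, False)"
    by (simp_all add: coord_simps axis_component)
  then show "\<forall>r. u $ (r, True) = 0 \<and> u $ (r, False) = 0"
    unfolding all_root_pair using a_ne1 a_nz by (simp add: assms del: gen_ef.simps)
qed

lemma transitive_neg:
  assumes "\<And>i. deg i \<ge> - 1 \<Longrightarrow> u $ i = 0" and "\<And>j. br a (gen_ef (E j)) u = 0"
  shows "u = 0"
proof (rule idx_zeroI)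
  have "br a (gen_ef (E 3)) u $ (A23, True) = u $ (A13, True)"
    "br a (gen_ef (E 2)) u $ (X13, True) = u $ (B13, True)"
    "br a (gen_ef (E 1)) u $ (B13, True) = u $ (B23, True)"
    "br a (gen_ef (E 1)) u $ (X11, False) = u $ (X12, False)"
    "br a (gen_ef (E 3)) u $ (X23, True) = u $ (X13, True)"
    "br a (gen_ef (E 2)) u $ (A12, True) = u $ (X21, False)"
    "br a (gen_ef (E 1)) u $ (X21, False) = u $ (X22, False)"
    "br a (gen_ef (E 2)) u $ (X32, False) = u $ (X23, True)"
    "br a (gen_ef (E 2)) u $ (A13, True) = u $ (X31, False)"
    "br a (gen_ef (E 1)) u $ (X31, False) = u $ (X32, False)"
    "br a (gen_ef (E 2)) u $ (X22, False) = u $ (X33, True)"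
    by (simp_all add: coord_simps axis_component)
  then show "\<forall>r. u $ (r, True) = 0 \<and> u $ (r, False) = 0"
    unfolding all_root_pair using a_ne1 a_nz by (simp add: assms del: gen_ef.simps)
qed

end

section \<open>Algebras presented by the free nonassociative algebra\<close>

abbreviation "words \<equiv> Poly_Mapping.keys"
abbreviation "coef \<equiv> Poly_Mapping.lookup"

abbreviation free_bracket :: "('x magma \<Rightarrow>\<^sub>0 'k::field) \<Rightarrow> ('x magma \<Rightarrow>\<^sub>0 'k) \<Rightarrow> ('x magma \<Rightarrow>\<^sub>0 'k)" (infixl "\<star>" 70)
  where "free_bracket p q \<equiv> p \<otimes>\<^bsub>free_alg\<^esub> q"

abbreviation sm :: "'k::field \<Rightarrow> ('x magma \<Rightarrow>\<^sub>0 'k) \<Rightarrow> ('x magma \<Rightarrow>\<^sub>0 'k)"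
  where "sm c p \<equiv> c \<odot>\<^bsub>free_alg\<^esub> p"

lemma free_alg_simps [simp]: "carrier free_alg = UNIV" "p \<oplus>\<^bsub>free_alg\<^esub> q = p + q" "\<zero>\<^bsub>free_alg\<^esub> = 0"
  by (simp_all add: free_alg_def)

lemma lookup_sm [simp]: "coef (sm c p) u = c * coef p u"
  by (simp add: free_alg_def Poly_Mapping.map.rep_eq when_def)

lemma sm_add: "sm c (p + q) = sm c p + sm c q"
  and sm_add_left: "sm (c + d) p = sm c p + sm d p"
  and sm_sm: "sm c (sm d p) = sm (c * d) p"
  and sm_one [simp]: "sm 1 p = p"
  and sm_zero [simp]: "sm 0 p = 0" "sm c 0 = 0"
  and sm_minus_one: "sm (- 1) p = - p"
  by (rule poly_mapping_eqI; simp add: lookup_add algebra_simps)+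

lemma sm_single [simp]: "sm c (Poly_Mapping.single u x) = Poly_Mapping.single u (c * x)"
  by (rule poly_mapping_eqI) (simp add: lookup_single when_def)

lemma fm_superset:
  assumes "finite A" "finite B" "words p \<subseteq> A" "words q \<subseteq> B"
  shows "p \<star> q = (\<Sum>u\<in>A. \<Sum>v\<in>B. Poly_Mapping.single (Br u v) (coef p u * coef q v))"
proof -
  have "p \<star> q = (\<Sum>u\<in>words p. \<Sum>v\<in>words q.
      Poly_Mapping.single (Br u v) (coef p u * coef q v))"
    by (simp add: free_alg_def)
  also have "\<dots> = (\<Sum>u\<in>A. \<Sum>v\<in>words q.
      Poly_Mapping.single (Br u v) (coef p u * coef q v))"
    using assms by (intro sum.mono_neutral_left) (auto simp: in_keys_iff)
  also have "\<dots> = (\<Sum>u\<in>A. \<Sum>v\<in>B. Poly_Mapping.single (Br u v) (coef p u * coef q v))"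
    using assms by (intro sum.cong refl sum.mono_neutral_left) (auto simp: in_keys_iff)
  finally show ?thesis .
qed

lemma fm_add_left: "(p + q) \<star> r = p \<star> r + q \<star> r"
proof -
  let ?A = "words p \<union> words q" and ?B = "words r"
  have k: "words (p + q) \<subseteq> ?A"
    by (rule Poly_Mapping.keys_add)
  show ?thesis
    by (simp add: fm_superset[of ?A ?B] k lookup_add distrib_right single_add sum.distrib)
qed

lemma fm_add_right: "r \<star> (p + q) = r \<star> p + r \<star> q"
proof -
  let ?A = "words p \<union> words q" and ?B = "words r"
  have k: "words (p + q) \<subseteq> ?A"
    by (rule Poly_Mapping.keys_add)
  show ?thesis
    by (simp add: fm_superset[of ?B ?A] k lookup_add distrib_left single_add sum.distrib)
qed

lemma fm_zero [simp]: "0 \<star> p = 0" "p \<star> 0 = 0"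
  by (simp_all add: free_alg_def)

lemma fm_minus_left: "(- p) \<star> q = - (p \<star> q)" and fm_minus_right: "q \<star> (- p) = - (q \<star> p)"
  using fm_add_left[of p "- p" q] fm_add_right[of q p "- p"] by (simp_all add: add_eq_0_iff)

lemma fm_diff_left: "(p - q) \<star> r = p \<star> r - q \<star> r" and fm_diff_right: "r \<star> (p - q) = r \<star> p - r \<star> q"
  using fm_add_left[of p "- q" r] fm_add_right[of r p "- q"] by (simp_all add: fm_minus_left fm_minus_right)

lemma keys_sm: "words (sm c p) \<subseteq> words p"
  by (auto simp: in_keys_iff)

lemma sm_sum: "sm c (sum f A) = (\<Sum>x\<in>A. sm c (f x))"
  by (induction A rule: infinite_finite_induct) (simp_all add: sm_add)

lemma fm_sm_left: "sm c p \<star> q = sm c (p \<star> q)" and fm_sm_right: "q \<star> sm c p = sm c (q \<star> p)"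
  unfolding fm_superset[of "words p" "words q", OF finite_keys finite_keys keys_sm subset_refl]
    fm_superset[of "words q" "words p", OF finite_keys finite_keys subset_refl keys_sm]
    fm_superset[of "words p" "words q", OF finite_keys finite_keys subset_refl subset_refl]
    fm_superset[of "words q" "words p", OF finite_keys finite_keys subset_refl subset_refl]
  by (simp_all add: sm_sum ac_simps)

lemma fm_single [simp]: "Poly_Mapping.single u x \<star> Poly_Mapping.single v y = Poly_Mapping.single (Br u v) (x * y)"
  by (subst fm_superset[of "{u}" "{v}"]) (auto split: if_splits)

lemma field_class_ring: "field (class_ring :: 'k::field ring)"
  by (rule class_field.field_axioms)

text \<open>Both quotient constructions, by the relations and by the maximal ideal, yield algebras that are
images of the free algebra. This locale records such an image, so that all computations can be
done with representatives in the free algebra, whose operations are total.\<close>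

locale presentation =
  fixes R :: "('k::field, 'v) module" (structure) and h :: "('x magma \<Rightarrow>\<^sub>0 'k) \<Rightarrow> 'v"
  assumes carrier_eq: "carrier R = range h"
    and h_add: "h p \<oplus> h q = h (p + q)"
    and h_mult: "h p \<otimes> h q = h (p \<star> q)"
    and h_smult: "c \<odot> h p = h (sm c p)"
    and h_zero: "\<zero> = h 0"
begin

lemma is_vectorspace: "vectorspace class_ring R"
proof -
  have ab: "abelian_group R"
  proof (rule abelian_groupI)
    show "\<exists>y\<in>carrier R. y \<oplus> x = \<zero>" if x: "x \<in> carrier R" for x
    proof -
      obtain p where "x = h p"
        using x unfolding carrier_eq by auto
      then have "h (- p) \<oplus> x = \<zero>"
        by (simp add: h_add h_zero)
      then show ?thesis
        unfolding carrier_eq by auto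
    qed
  qed (auto simp: carrier_eq h_add h_zero ac_simps)
  have "module class_ring R"
    by (rule moduleI) (use ab class_cring.cring_axioms in \<open>auto simp: carrier_eq h_add h_smult class_ring_simps sm_add sm_add_left sm_sm\<close>)
  then show ?thesis
    by (simp add: vectorspace_def field_class_ring)
qed

lemma vsubspaceI:
  assumes "0 \<in> N" "\<And>p q. p \<in> N \<Longrightarrow> q \<in> N \<Longrightarrow> p + q \<in> N" "\<And>c p. p \<in> N \<Longrightarrow> sm c p \<in> N"
  shows "vsubspace R (h ` N)"
proof -
  have "submodule class_ring (h ` N) R"
    using is_vectorspace unfolding vectorspace_def
    by (intro submodule.intro) (use assms in \<open>auto simp: carrier_eq h_add h_smult h_zero class_ring_simps\<close>)
  then show ?thesis
    using is_vectorspace by (simp add: subspace_def)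
qed

lemma lie_idealI:
  assumes "0 \<in> N" "\<And>p q. p \<in> N \<Longrightarrow> q \<in> N \<Longrightarrow> p + q \<in> N" "\<And>c p. p \<in> N \<Longrightarrow> sm c p \<in> N"
    "\<And>p q. p \<in> N \<Longrightarrow> p \<star> q \<in> N" "\<And>p q. p \<in> N \<Longrightarrow> q \<star> p \<in> N"
  shows "lie_ideal R (h ` N)"
  unfolding lie_ideal_def using vsubspaceI[of N, OF assms(1-3)] assms(4,5) by (auto simp: carrier_eq h_mult)

context
  fixes I assumes I: "lie_ideal R I"
begin

lemma ideal_sub: "submodule class_ring I R"
  using I by (simp add: lie_ideal_def subspace_def)

lemma ideal_subset: "I \<subseteq> range h"
  using submodule.subset[OF ideal_sub] carrier_eq by simp

lemma ideal_zero: "h 0 \<in> I"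
  using submodule.zero_closed[OF ideal_sub] h_zero by simp

lemma ideal_add: "h p \<in> I \<Longrightarrow> h q \<in> I \<Longrightarrow> h (p + q) \<in> I"
  using submodule.m_closed[OF ideal_sub] h_add by metis

lemma ideal_smult: "h p \<in> I \<Longrightarrow> h (sm c p) \<in> I"
  using submodule.smult_closed[OF ideal_sub, of c "h p"] h_smult by (simp add: class_ring_simps)

lemma ideal_minus: "h p \<in> I \<Longrightarrow> h (- p) \<in> I"
  using ideal_smult[of p "-1"] by (simp add: sm_minus_one)

lemma ideal_diff: "h p \<in> I \<Longrightarrow> h q \<in> I \<Longrightarrow> h (p - q) \<in> I"
  using ideal_add[of p "- q"] ideal_minus by simp

lemma ideal_mult: "h p \<in> I \<Longrightarrow> h (p \<star> q) \<in> I" "h p \<in> I \<Longrightarrow> h (q \<star> p) \<in> I"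
  using I h_mult[symmetric] carrier_eq unfolding lie_ideal_def by auto

lemma coset_eq: "I +> h p = h ` {q. h (q - p) \<in> I}"
proof
  show "I +> h p \<subseteq> h ` {q. h (q - p) \<in> I}"
    using ideal_subset by (auto simp: a_r_coset_def' h_add intro!: imageI)
  show "h ` {q. h (q - p) \<in> I} \<subseteq> I +> h p"
    by (auto simp: a_r_coset_def' intro!: bexI[of _ "h (_ - p)"] simp: h_add)
qed

lemma coset_eq_iff: "I +> h p = I +> h q \<longleftrightarrow> h (p - q) \<in> I"
proof
  assume e: "I +> h p = I +> h q"
  have "h p \<in> I +> h p"
    unfolding coset_eq using ideal_zero by auto
  then have "h p \<in> I +> h q"
    using e by simp
  then obtain r where r: "h p = h r" "h (r - q) \<in> I"
    unfolding coset_eq by auto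
  have "h (p - q) = h (r - q)"
    using h_add[of p "- q"] h_add[of r "- q"] r(1) by simp
  then show "h (p - q) \<in> I"
    using r by simp
next
  assume d: "h (p - q) \<in> I"
  have "h (r - p) \<in> I \<longleftrightarrow> h (r - q) \<in> I" for r
    using ideal_add[OF _ d, of "r - p"] ideal_diff[OF _ d, of "r - q"] by auto
  then show "I +> h p = I +> h q"
    unfolding coset_eq by simp
qed

lemma quot_presentation: "presentation (lie_quot R I) (\<lambda>p. I +> h p)"
proof
  show "carrier (lie_quot R I) = range (\<lambda>p. I +> h p)"
    by (auto simp: lie_quot_def A_RCOSETS_def' carrier_eq)
  show "\<zero>\<^bsub>lie_quot R I\<^esub> = I +> h 0"
    unfolding coset_eq using ideal_subset by (auto simp: lie_quot_def)
  fix p q :: "'x magma \<Rightarrow>\<^sub>0 'k"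
  show "(I +> h p) \<oplus>\<^bsub>lie_quot R I\<^esub> (I +> h q) = I +> h (p + q)"
  proof -
    have "h r \<in> (\<Union>x\<in>I +> h p. \<Union>y\<in>I +> h q. {x \<oplus> y})" if "h (r - (p + q)) \<in> I" for r
    proof -
      have "h (r - p) \<in> I +> h q"
        unfolding coset_eq using that by (auto simp: algebra_simps intro!: imageI)
      moreover have "h p \<in> I +> h p"
        unfolding coset_eq using ideal_zero by auto
      moreover have "h r = h p \<oplus> h (r - p)"
        by (simp add: h_add)
      ultimately show ?thesis
        by blast
    qed
    moreover have "h r \<oplus> h s \<in> I +> h (p + q)" if "h (r - p) \<in> I" "h (s - q) \<in> I" for r s
      unfolding coset_eq h_add using ideal_add[OF that] by (auto simp: algebra_simps intro!: imageI)
    ultimately show ?thesis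
      by (auto simp: lie_quot_def set_add_def' coset_eq)
  qed
  show "(I +> h p) \<otimes>\<^bsub>lie_quot R I\<^esub> (I +> h q) = I +> h (p \<star> q)"
  proof -
    have "I +> (h r \<otimes> h s) = I +> h (p \<star> q)" if "h (r - p) \<in> I" "h (s - q) \<in> I" for r s
    proof -
      have "r \<star> s - p \<star> q = (r - p) \<star> s + p \<star> (s - q)"
        by (simp add: fm_diff_left fm_diff_right)
      then show ?thesis
        unfolding h_mult coset_eq_iff using ideal_add ideal_mult that by metis
    qed
    then have "\<forall>x\<in>I +> h p. \<forall>y\<in>I +> h q. I +> (x \<otimes> y) = I +> h (p \<star> q)"
      by (auto simp: coset_eq[of p] coset_eq[of q])
    moreover have "h p \<in> I +> h p" "h q \<in> I +> h q"
      unfolding coset_eq using ideal_zero by auto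
    ultimately have "(\<Union>x\<in>I +> h p. \<Union>y\<in>I +> h q. I +> (x \<otimes> y)) = I +> h (p \<star> q)"
      by blast
    then show ?thesis
      by (simp add: lie_quot_def rcoset_mult_def)
  qed
  show "c \<odot>\<^bsub>lie_quot R I\<^esub> (I +> h p) = I +> h (sm c p)" for c
  proof -
    have "I +> (c \<odot> h r) = I +> h (sm c p)" if "h (r - p) \<in> I" for r
    proof -
      have "sm c r - sm c p = sm c (r - p)"
        using sm_add[of c r "- p"] sm_sm[of c "- 1" p] sm_sm[of "-1" c p] by (simp add: sm_minus_one)
      then show ?thesis
        unfolding h_smult coset_eq_iff using ideal_smult that by metis
    qed
    then have "\<forall>x\<in>I +> h p. I +> (c \<odot> x) = I +> h (sm c p)"
      by (auto simp: coset_eq[of p])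
    moreover have "h p \<in> I +> h p"
      unfolding coset_eq using ideal_zero by auto
    ultimately have "(\<Union>x\<in>I +> h p. I +> (c \<odot> x)) = I +> h (sm c p)"
      by blast
    then show ?thesis
      by (simp add: lie_quot_def)
  qed
qed

end

end

lemma presentation_free: "presentation free_alg id"
  by standard simp_all

section \<open>Triangular decomposition\<close>

lemma free_ideal_iff:
  "lie_ideal free_alg N \<longleftrightarrow> 0 \<in> N \<and> (\<forall>p\<in>N. \<forall>q\<in>N. p + q \<in> N) \<and> (\<forall>c. \<forall>p\<in>N. sm c p \<in> N) \<and>
    (\<forall>p\<in>N. \<forall>q. p \<star> q \<in> N \<and> q \<star> p \<in> N)" (is "_ \<longleftrightarrow> ?R")
proof
  assume "lie_ideal free_alg N"
  then show ?R
    using presentation.ideal_zero[OF presentation_free] presentation.ideal_add[OF presentation_free]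
      presentation.ideal_smult[OF presentation_free] presentation.ideal_mult[OF presentation_free]
    by (metis id_apply)
next
  assume ?R
  then show "lie_ideal free_alg N"
    using presentation.lie_idealI[OF presentation_free, of N] by simp
qed

lemma ideal_generated_ideal: "lie_ideal free_alg (ideal_generated free_alg S)"
  unfolding ideal_generated_def free_ideal_iff by auto

lemma ideal_generated_subset: "S \<subseteq> ideal_generated R S"
  unfolding ideal_generated_def by auto

lemma ideal_generated_least: "lie_ideal R N \<Longrightarrow> S \<subseteq> N \<Longrightarrow> ideal_generated R S \<subseteq> N"
  unfolding ideal_generated_def by auto

lemma kernel_ideal: "lie_ideal free_alg (tilde_kernel A)"
  unfolding tilde_kernel_def by (rule ideal_generated_ideal)

lemmas kernel_closed = kernel_ideal[unfolded free_ideal_iff]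

lemma kernel_zero: "0 \<in> tilde_kernel A"
  and kernel_add: "p \<in> tilde_kernel A \<Longrightarrow> q \<in> tilde_kernel A \<Longrightarrow> p + q \<in> tilde_kernel A"
  and kernel_smult: "p \<in> tilde_kernel A \<Longrightarrow> sm c p \<in> tilde_kernel A"
  and kernel_mult: "p \<in> tilde_kernel A \<Longrightarrow> p \<star> q \<in> tilde_kernel A" "p \<in> tilde_kernel A \<Longrightarrow> q \<star> p \<in> tilde_kernel A"
  using kernel_closed by blast+

lemma kernel_minus: "p \<in> tilde_kernel A \<Longrightarrow> - p \<in> tilde_kernel A"
  using kernel_smult[of p A "-1"] by (simp add: sm_minus_one)

lemma kernel_diff: "p \<in> tilde_kernel A \<Longrightarrow> q \<in> tilde_kernel A \<Longrightarrow> p - q \<in> tilde_kernel A"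
  using kernel_add[of p A "- q"] kernel_minus[of q] by simp

lemma kernel_gens: "lie_identities \<subseteq> tilde_kernel A" "cartan_relations A \<subseteq> tilde_kernel A"
  using ideal_generated_subset[of "lie_identities \<union> cartan_relations A" free_alg]
  by (auto simp: tilde_kernel_def)

lemma kernel_alternating: "p \<star> p \<in> tilde_kernel A"
  using kernel_gens(1)[of A] unfolding lie_identities_def by blast

lemma kernel_jacobi: "p \<star> (q \<star> r) + q \<star> (r \<star> p) + r \<star> (p \<star> q) \<in> tilde_kernel A"
  using kernel_gens(1)[of A] unfolding lie_identities_def by blast

lemma kernel_antisym: "p \<star> q + q \<star> p \<in> tilde_kernel A"
proof -
  have "p \<star> q + q \<star> p = (p + q) \<star> (p + q) - p \<star> p - q \<star> q"
    by (simp add: fm_add_left fm_add_right)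
  then show ?thesis
    by (simp only: kernel_alternating kernel_diff)
qed

lemma kernel_leibniz: "p \<star> (q \<star> r) - (p \<star> q \<star> r + q \<star> (p \<star> r)) \<in> tilde_kernel A"
proof -
  have "p \<star> (q \<star> r) - (p \<star> q \<star> r + q \<star> (p \<star> r)) =
      (p \<star> (q \<star> r) + q \<star> (r \<star> p) + r \<star> (p \<star> q)) - q \<star> (p \<star> r + r \<star> p) -
      (p \<star> q \<star> r + r \<star> (p \<star> q))"
    by (simp add: fm_add_right)
  then show ?thesis
    by (simp only: kernel_jacobi kernel_antisym kernel_mult kernel_diff)
qed

lemma sm_minus: "sm (- c) p = - sm c p"
  by (rule poly_mapping_eqI) simp

lemma kernel_rel:
  fixes A :: "'a::field ^ 'b ^ 'b::finite"
  shows
  "free_gen (E i) \<star> free_gen (F j) - (if i = j then free_gen (H j) else 0) \<in> tilde_kernel A"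
  "free_gen (H i) \<star> free_gen (H j) \<in> tilde_kernel A"
  "free_gen (H i) \<star> free_gen (E j) - sm (A $ i $ j) (free_gen (E j)) \<in> tilde_kernel A"
  "free_gen (H i) \<star> free_gen (F j) - sm (- (A $ i $ j)) (free_gen (F j)) \<in> tilde_kernel A"
proof -
  have e: "p - sm (- c) q = p + sm c q" for c and p q :: "'b cgen magma \<Rightarrow>\<^sub>0 'a"
    by (simp add: sm_minus)
  show "free_gen (E i) \<star> free_gen (F j) - (if i = j then free_gen (H j) else 0) \<in> tilde_kernel A"
    "free_gen (H i) \<star> free_gen (H j) \<in> tilde_kernel A"
    "free_gen (H i) \<star> free_gen (E j) - sm (A $ i $ j) (free_gen (E j)) \<in> tilde_kernel A"
    "free_gen (H i) \<star> free_gen (F j) - sm (- (A $ i $ j)) (free_gen (F j)) \<in> tilde_kernel A"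
    unfolding e by (rule subsetD[OF kernel_gens(2)], unfold cartan_relations_def, blast)+
qed

text \<open>Degree by degree, the span modulo the relations of right-normed words in the \<open>e\<^sub>i\<close> alone (positive
degrees), in the \<open>f\<^sub>i\<close> alone (negative degrees), and of the \<open>h\<^sub>i\<close> (degree 0). It turns out
to be everything (\<open>tri_single\<close>), which is the triangular decomposition.\<close>

inductive triangular :: "'k::field ^ 'n ^ 'n \<Rightarrow> int \<Rightarrow> ('n::finite cgen magma \<Rightarrow>\<^sub>0 'k) \<Rightarrow> bool" for A where
  tri_kernel: "p \<in> tilde_kernel A \<Longrightarrow> triangular A d p"
| tri_add: "triangular A d p \<Longrightarrow> triangular A d q \<Longrightarrow> triangular A d (p + q)"
| tri_smult: "triangular A d p \<Longrightarrow> triangular A d (sm c p)"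
| tri_E: "triangular A 1 (free_gen (E i))"
| tri_F: "triangular A (-1) (free_gen (F i))"
| tri_H: "triangular A 0 (free_gen (H i))"
| tri_stepE: "d \<ge> 1 \<Longrightarrow> triangular A d p \<Longrightarrow> triangular A (d + 1) (free_gen (E i) \<star> p)"
| tri_stepF: "d \<le> -1 \<Longrightarrow> triangular A d p \<Longrightarrow> triangular A (d - 1) (free_gen (F i) \<star> p)"

lemma tri_cong: "p - q \<in> tilde_kernel A \<Longrightarrow> triangular A d q \<Longrightarrow> triangular A d p"
  using tri_add[OF tri_kernel, of "p - q" A d q] by simp

lemma tri_minus: "triangular A d p \<Longrightarrow> triangular A d (- p)"
  using tri_smult[of A d p "-1"] by (simp add: sm_minus_one)

lemma tri_leibniz:
  assumes "triangular A d (p \<star> q \<star> r)" "triangular A d (q \<star> (p \<star> r))" shows "triangular A d (p \<star> (q \<star> r))"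
  using tri_cong[OF kernel_leibniz tri_add[OF assms]] .

lemma tri_cong_left: "p - q \<in> tilde_kernel A \<Longrightarrow> triangular A d (q \<star> r) \<Longrightarrow> triangular A d (p \<star> r)"
  using tri_cong[of "p \<star> r" "q \<star> r" A d] kernel_mult(1)[of "p - q" A r] by (simp add: fm_diff_left)

lemma tri_swap: "triangular A d (q \<star> p) \<Longrightarrow> triangular A d (p \<star> q)"
  using tri_cong[of "p \<star> q" "- (q \<star> p)" A d] kernel_antisym[of p q A] tri_minus[of A d "q \<star> p"] by simp

lemma tri_H_mult: "triangular A d p \<Longrightarrow> triangular A d (free_gen (H i) \<star> p)"
proof (induction rule: triangular.induct)
  case (tri_E j)
  show ?case by (rule tri_cong[OF kernel_rel(3) tri_smult[OF triangular.tri_E]])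
next
  case (tri_F j)
  show ?case by (rule tri_cong[OF kernel_rel(4) tri_smult[OF triangular.tri_F]])
next
  case (tri_H j)
  show ?case by (rule triangular.tri_kernel[OF kernel_rel(2)])
next
  case (tri_stepE d p j)
  have "triangular A (d + 1) (sm (A $ i $ j) (free_gen (E j) \<star> p))"
    by (rule tri_smult[OF triangular.tri_stepE[OF tri_stepE(1,2)]])
  then have "triangular A (d + 1) (free_gen (H i) \<star> free_gen (E j) \<star> p)"
    by (intro tri_cong_left[OF kernel_rel(3)]) (simp only: fm_sm_left)
  then show ?case
    by (rule tri_leibniz) (rule triangular.tri_stepE[OF tri_stepE(1,3)])
next
  case (tri_stepF d p j)
  have "triangular A (d - 1) (sm (- (A $ i $ j)) (free_gen (F j) \<star> p))"
    by (rule tri_smult[OF triangular.tri_stepF[OF tri_stepF(1,2)]])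
  then have "triangular A (d - 1) (free_gen (H i) \<star> free_gen (F j) \<star> p)"
    by (intro tri_cong_left[OF kernel_rel(4)]) (simp only: fm_sm_left)
  then show ?case
    by (rule tri_leibniz) (rule triangular.tri_stepF[OF tri_stepF(1,3)])
qed (simp_all only: fm_add_right fm_sm_right triangular.tri_kernel[OF kernel_mult(2)] tri_add tri_smult)

lemma tri_0_E: "triangular A d p \<Longrightarrow> d = 0 \<Longrightarrow> triangular A 1 (free_gen (E i) \<star> p)"
proof (induction rule: triangular.induct)
  case (tri_H j)
  show ?case by (rule tri_swap[OF tri_H_mult[OF tri_E]])
qed (simp_all only: fm_add_right fm_sm_right triangular.tri_kernel[OF kernel_mult(2)] tri_add tri_smult)

lemma tri_0_F: "triangular A d p \<Longrightarrow> d = 0 \<Longrightarrow> triangular A (-1) (free_gen (F i) \<star> p)"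
proof (induction rule: triangular.induct)
  case (tri_H j)
  show ?case by (rule tri_swap[OF tri_H_mult[OF tri_F]])
qed (simp_all only: fm_add_right fm_sm_right triangular.tri_kernel[OF kernel_mult(2)] tri_add tri_smult)

lemma tri_EF: "triangular A 0 (free_gen (E i) \<star> free_gen (F j))"
  by (rule tri_cong[OF kernel_rel(1)]) (auto intro: triangular.intros kernel_zero)

lemma tri_EF_mult: "triangular A d p \<Longrightarrow> triangular A d (free_gen (E i) \<star> free_gen (F j) \<star> p)"
  by (rule tri_cong_left[OF kernel_rel(1)]) (auto intro: tri_H_mult tri_kernel kernel_zero)

lemma tri_FE_mult: "triangular A d p \<Longrightarrow> triangular A d (free_gen (F i) \<star> free_gen (E j) \<star> p)"
  using tri_cong_left[of "free_gen (F i) \<star> free_gen (E j)" "- (free_gen (E j) \<star> free_gen (F i))" A d p]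
    kernel_antisym[of "free_gen (F i)" "free_gen (E j)" A] tri_minus[OF tri_EF_mult[of A d p j i]]
  by (simp add: fm_minus_left)

text \<open>On words in the \<open>f\<^sub>j\<close> the derivation property moves \<open>e\<^sub>i\<close> inwards until it meets some \<open>f\<^sub>j\<close>; the
resulting \<open>h\<^sub>j\<close> acts by scalars on every letter.\<close>

lemma tri_E_mult: "triangular A d p \<Longrightarrow> triangular A (d + 1) (free_gen (E i) \<star> p)"
proof (induction rule: triangular.induct)
  case (tri_E j)
  show ?case by (rule triangular.tri_stepE[OF _ triangular.tri_E]) simp
next
  case (tri_F j)
  show ?case using tri_EF by simp
next
  case (tri_H j)
  show ?case using tri_0_E[OF triangular.tri_H] by simp
next
  case (tri_stepE d p j)
  show ?case by (rule triangular.tri_stepE[OF _ triangular.tri_stepE[OF tri_stepE(1,2)]]) (use tri_stepE(1) in simp)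
next
  case (tri_stepF d p j)
  have "triangular A d (free_gen (F j) \<star> (free_gen (E i) \<star> p))"
  proof (cases "d = -1")
    case True
    then show ?thesis using tri_0_F[OF tri_stepF(3)] by simp
  next
    case False
    then show ?thesis using triangular.tri_stepF[OF _ tri_stepF(3), of j] tri_stepF(1) by simp
  qed
  then show ?case
    using tri_leibniz[OF tri_EF_mult[OF tri_stepF(2)]] by simp
qed (simp_all only: fm_add_right fm_sm_right triangular.tri_kernel[OF kernel_mult(2)] tri_add tri_smult)

lemma tri_F_mult: "triangular A d p \<Longrightarrow> triangular A (d - 1) (free_gen (F i) \<star> p)"
proof (induction rule: triangular.induct)
  case (tri_F j)
  show ?case by (rule triangular.tri_stepF[OF _ triangular.tri_F]) simp
next
  case (tri_E j)
  show ?case using tri_swap[OF tri_EF] by simp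
next
  case (tri_H j)
  show ?case using tri_0_F[OF triangular.tri_H] by simp
next
  case (tri_stepF d p j)
  show ?case by (rule triangular.tri_stepF[OF _ triangular.tri_stepF[OF tri_stepF(1,2)]]) (use tri_stepF(1) in simp)
next
  case (tri_stepE d p j)
  have "triangular A d (free_gen (E j) \<star> (free_gen (F i) \<star> p))"
  proof (cases "d = 1")
    case True
    then show ?thesis using tri_0_E[OF tri_stepE(3)] by simp
  next
    case False
    then show ?thesis using triangular.tri_stepE[OF _ tri_stepE(3), of j] tri_stepE(1) by simp
  qed
  then show ?case
    using tri_leibniz[OF tri_FE_mult[OF tri_stepE(2)]] by simp
qed (simp_all only: fm_add_right fm_sm_right triangular.tri_kernel[OF kernel_mult(2)] tri_add tri_smult)

lemma tri_comm_mult: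
  assumes "triangular A e (p \<star> (q \<star> r))" "triangular A e (q \<star> (p \<star> r))"
  shows "triangular A e (p \<star> q \<star> r)"
proof (rule tri_cong)
  show "p \<star> q \<star> r - (p \<star> (q \<star> r) + - (q \<star> (p \<star> r))) \<in> tilde_kernel A"
    using kernel_minus[OF kernel_leibniz[of p q r A]] by (simp add: algebra_simps)
  show "triangular A e (p \<star> (q \<star> r) + - (q \<star> (p \<star> r)))"
    by (intro tri_add tri_minus assms)
qed

text \<open>It suffices to multiply by generators, as right-normed words are iterated commutators.\<close>

lemma tri_mult: "triangular A c p \<Longrightarrow> triangular A d q \<Longrightarrow> triangular A (c + d) (p \<star> q)"
proof (induction arbitrary: d q rule: triangular.induct)
  case (tri_E i)
  show ?case using tri_E_mult[OF tri_E, of i] by (simp add: add.commute)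
next
  case (tri_F i)
  show ?case using tri_F_mult[OF tri_F, of i] by (simp add: add.commute)
next
  case (tri_H i)
  show ?case using tri_H_mult[OF tri_H, of i] by simp
next
  case (tri_stepE c p i)
  have "triangular A (c + d + 1) (free_gen (E i) \<star> (p \<star> q))"
    by (rule tri_E_mult[OF tri_stepE.IH[OF tri_stepE.prems]])
  moreover have "triangular A (c + (d + 1)) (p \<star> (free_gen (E i) \<star> q))"
    by (rule tri_stepE.IH[OF tri_E_mult[OF tri_stepE.prems]])
  ultimately show ?case
    using tri_comm_mult[of A "c + d + 1"] by (simp add: ac_simps)
next
  case (tri_stepF c p i)
  have "triangular A (c + d - 1) (free_gen (F i) \<star> (p \<star> q))"
    by (rule tri_F_mult[OF tri_stepF.IH[OF tri_stepF.prems]])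
  moreover have "triangular A (c + (d - 1)) (p \<star> (free_gen (F i) \<star> q))"
    by (rule tri_stepF.IH[OF tri_F_mult[OF tri_stepF.prems]])
  ultimately show ?case
    using tri_comm_mult[of A "c + d - 1"] by (simp add: algebra_simps)
qed (simp_all only: fm_add_left fm_sm_left triangular.tri_kernel[OF kernel_mult(1)] tri_add tri_smult)

lemma tri_single: "triangular A (magma_deg u) (Poly_Mapping.single u 1)"
proof (induction u)
  case (Gen x)
  then show ?case by (cases x) (auto intro: triangular.intros)
next
  case (Br u v)
  then show ?case using tri_mult[of A "magma_deg u" _ "magma_deg v"] by fastforce
qed

lemma sum_single: "(\<Sum>u\<in>words p. Poly_Mapping.single u (coef p u)) = p"
  by (rule poly_mapping_eqI) (simp add: lookup_sum lookup_single when_def in_keys_iff)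

lemma tri_homogeneous:
  assumes "\<forall>u\<in>words p. magma_deg u = d" shows "triangular A d p"
proof -
  have t: "triangular A d (Poly_Mapping.single u c)" if "magma_deg u = d" for u c
    using tri_smult[OF tri_single, of A u c] that by simp
  have "triangular A d (\<Sum>u\<in>U. Poly_Mapping.single u (coef p u))" if "U \<subseteq> words p" for U
    using that finite_subset[OF that finite_keys]
  proof (induction U rule: infinite_finite_induct)
    case (insert u U)
    then show ?case using tri_add[OF t] assms by auto
  qed (auto intro: tri_kernel kernel_zero)
  from this[OF subset_refl] show ?thesis
    by (simp only: sum_single)
qed

definition lin_gen :: "('n \<Rightarrow> 'n cgen) \<Rightarrow> ('n::finite \<Rightarrow> 'k) \<Rightarrow> ('n cgen magma \<Rightarrow>\<^sub>0 'k::field)" where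
  "lin_gen g c = (\<Sum>i\<in>UNIV. sm (c i) (free_gen (g i)))"

lemma lin_gen_add: "lin_gen g c + lin_gen g d = lin_gen g (\<lambda>i. c i + d i)"
  by (simp add: lin_gen_def sum.distrib single_add)

lemma lin_gen_smult: "sm x (lin_gen g c) = lin_gen g (\<lambda>i. x * c i)"
  by (simp add: lin_gen_def sm_sum)

lemma lin_gen_gen: "lin_gen g (\<lambda>j. if j = i then 1 else 0) = free_gen (g i)"
proof -
  have "lin_gen g (\<lambda>j. if j = i then 1 else 0) = (\<Sum>j\<in>UNIV. if j = i then free_gen (g i) else 0)"
    unfolding lin_gen_def by (intro sum.cong) auto
  then show ?thesis by simp
qed

lemma lin_gen_zero: "lin_gen g (\<lambda>_. 0) = 0"
  by (simp add: lin_gen_def)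

text \<open>In degrees -1, 0, 1 no longer words occur.\<close>

lemma tri_local:
  assumes "triangular A d p" "g = E \<and> d = 1 \<or> g = F \<and> d = -1 \<or> g = H \<and> d = 0"
  shows "\<exists>c. p - lin_gen g c \<in> tilde_kernel A"
  using assms
proof (induction rule: triangular.induct)
  case (tri_kernel p d)
  then show ?case by (intro exI[of _ "\<lambda>_. 0"]) (simp add: lin_gen_zero)
next
  case (tri_add d p q)
  then obtain c c' where "p - lin_gen g c \<in> tilde_kernel A" "q - lin_gen g c' \<in> tilde_kernel A"
    by blast
  from kernel_add[OF this] show ?case
    by (intro exI[of _ "\<lambda>i. c i + c' i"]) (simp add: lin_gen_add[symmetric] algebra_simps)
next
  case (tri_smult d p x)
  then obtain c where "p - lin_gen g c \<in> tilde_kernel A"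
    by blast
  moreover have "sm x p - sm x (lin_gen g c) = sm x (p - lin_gen g c)"
    by (rule poly_mapping_eqI) (simp add: lookup_minus algebra_simps)
  ultimately have "sm x p - sm x (lin_gen g c) \<in> tilde_kernel A"
    using kernel_smult by metis
  then show ?case
    by (intro exI[of _ "\<lambda>i. x * c i"]) (simp only: lin_gen_smult)
next
  case (tri_E i)
  then show ?case by (intro exI[of _ "\<lambda>j. if j = i then 1 else 0"]) (auto simp: lin_gen_gen kernel_zero)
next
  case (tri_F i)
  then show ?case by (intro exI[of _ "\<lambda>j. if j = i then 1 else 0"]) (auto simp: lin_gen_gen kernel_zero)
next
  case (tri_H i)
  then show ?case by (intro exI[of _ "\<lambda>j. if j = i then 1 else 0"]) (auto simp: lin_gen_gen kernel_zero)
qed auto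

section \<open>The kernel of the evaluation homomorphism\<close>

fun eval_word :: "'k::field \<Rightarrow> 4 cgen magma \<Rightarrow> 'k ^ idx" where
  "eval_word a (Gen g) = gen a g"
| "eval_word a (Br u v) = br a (eval_word a u) (eval_word a v)"

definition eval_free :: "'k::field \<Rightarrow> (4 cgen magma \<Rightarrow>\<^sub>0 'k) \<Rightarrow> 'k ^ idx" where
  "eval_free a p = (\<Sum>u\<in>words p. coef p u *s eval_word a u)"

lemma eval_free_superset:
  assumes "finite U" "words p \<subseteq> U"
  shows "eval_free a p = (\<Sum>u\<in>U. coef p u *s eval_word a u)"
  unfolding eval_free_def using assms by (intro sum.mono_neutral_left) (auto simp: in_keys_iff)

lemma eval_free_add: "eval_free a (p + q) = eval_free a p + eval_free a q"
proof -
  let ?U = "words p \<union> words q"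
  have k: "words (p + q) \<subseteq> ?U"
    by (rule Poly_Mapping.keys_add)
  show ?thesis
    by (simp add: eval_free_superset[of ?U] k lookup_add vec.scale_left_distrib sum.distrib)
qed

lemma eval_free_sm: "eval_free a (sm c p) = c *s eval_free a p"
  unfolding eval_free_superset[of "words p" "sm c p", OF finite_keys keys_sm] eval_free_def[of a p]
  by (simp add: vec.scale_sum_right)

lemma eval_free_zero [simp]: "eval_free a 0 = 0"
  by (simp add: eval_free_def)

lemma eval_free_minus: "eval_free a (- p) = - eval_free a p"
  using eval_free_add[of a p "- p"] by (simp add: eq_neg_iff_add_eq_0 add.commute)

lemma eval_free_diff: "eval_free a (p - q) = eval_free a p - eval_free a q"
  using eval_free_add[of a p "- q"] by (simp add: eval_free_minus)

lemma eval_free_single [simp]: "eval_free a (Poly_Mapping.single u c) = c *s eval_word a u"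
  by (subst eval_free_superset[of "{u}"]) auto

lemma eval_free_sum: "eval_free a (sum f S) = (\<Sum>x\<in>S. eval_free a (f x))"
  by (induction S rule: infinite_finite_induct) (simp_all add: eval_free_add)

definition deg_part :: "int \<Rightarrow> ('n cgen magma \<Rightarrow>\<^sub>0 'k::field) \<Rightarrow> ('n cgen magma \<Rightarrow>\<^sub>0 'k)" where
  "deg_part d p = (\<Sum>u\<in>{u \<in> words p. magma_deg u = d}. Poly_Mapping.single u (coef p u))"

lemma lookup_deg_part: "coef (deg_part d p) u = (if magma_deg u = d then coef p u else 0)"
  by (simp add: deg_part_def lookup_sum lookup_single when_def in_keys_iff)

lemma keys_deg_part: "u \<in> words (deg_part d p) \<Longrightarrow> magma_deg u = d"
  by (simp add: in_keys_iff lookup_deg_part split: if_splits)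

lemma sum_deg_part: "(\<Sum>d\<in>magma_deg ` words p. deg_part d p) = p"
proof (rule poly_mapping_eqI)
  fix u
  have "coef p u = 0" if "magma_deg u \<notin> magma_deg ` words p"
    using that by (auto simp: in_keys_iff)
  then show "coef (\<Sum>d\<in>magma_deg ` words p. deg_part d p) u = coef p u"
    by (auto simp: lookup_sum lookup_deg_part)
qed

definition tilde_proj :: "'k::field ^ 'n ^ 'n \<Rightarrow> ('n::finite cgen magma \<Rightarrow>\<^sub>0 'k) \<Rightarrow> ('n cgen magma \<Rightarrow>\<^sub>0 'k) set" where
  "tilde_proj A p = tilde_kernel A +>\<^bsub>free_alg\<^esub> p"

lemma presentation_tilde: "presentation (tildeG A) (tilde_proj A)"
  using presentation.quot_presentation[OF presentation_free kernel_ideal, of A]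
  by (simp add: tildeG_def tilde_proj_def[abs_def])

lemma tilde_proj_eq_iff: "tilde_proj A p = tilde_proj A q \<longleftrightarrow> p - q \<in> tilde_kernel A"
  using presentation.coset_eq_iff[OF presentation_free kernel_ideal, of A p q] by (simp add: tilde_proj_def)

lemma tilde_component_eq: "tilde_component A d = {tilde_proj A p | p. \<forall>u\<in>words p. magma_deg u = d}"
  by (simp add: tilde_component_def tilde_proj_def)

context char_two
begin

lemma br_sum_left: "br a (sum f S) v = (\<Sum>x\<in>S. br a (f x) v)"
  by (induction S rule: infinite_finite_induct) (simp_all add: br_add_left)

lemma br_sum_right: "br a v (sum f S) = (\<Sum>x\<in>S. br a v (f x))"
  by (induction S rule: infinite_finite_induct) (simp_all add: br_add_right)

lemma eval_free_fm: "eval_free a (p \<star> q) = br a (eval_free a p) (eval_free a q)"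
  unfolding fm_superset[of "words p" "words q", OF finite_keys finite_keys subset_refl subset_refl]
    eval_free_def[of a p] br_sum_left br_scale_left
  unfolding eval_free_def[of a q] br_sum_right br_scale_right
  by (simp add: eval_free_sum vec.scale_sum_right)

lemma all_4: "(\<forall>i::4. R i) \<longleftrightarrow> R 1 \<and> R 2 \<and> R 3 \<and> R 4"
  by (metis exhaust_4)

lemma gen_H_coords:
  "gen a (H 1) = axis (HQ, True) 1 + axis (HQ, False) 1"
  "gen a (H 2) = axis (HP, False) 1 + axis (HQ, False) a"
  "gen a (H 3) = axis (HP, True) 1 + axis (HP, False) 1"
  "gen a (H 4) = axis (HP, False) 1"
  by (simp_all add: Finite_Cartesian_Product.vec_eq_iff all_idx all_root_pair coord_simps axis_component del: split_paired_All)

definition cartan :: "'k ^ idx \<Rightarrow> bool" where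
  "cartan t \<longleftrightarrow> (\<forall>r b. r \<noteq> HP \<longrightarrow> r \<noteq> HQ \<longrightarrow> t $ (r, b) = 0)"

fun root_value :: "'k ^ idx \<Rightarrow> root_pair \<Rightarrow> 'k" where
  "root_value t HP = 0"
| "root_value t HQ = 0"
| "root_value t A12 = t $ (HP, True) + t $ (HP, False)"
| "root_value t A13 = t $ (HP, False)"
| "root_value t A23 = t $ (HP, True)"
| "root_value t B12 = t $ (HQ, True) + t $ (HQ, False)"
| "root_value t B13 = t $ (HQ, False)"
| "root_value t B23 = t $ (HQ, True)"
| "root_value t X11 = t $ (HP, True) + t $ (HQ, True)"
| "root_value t X12 = t $ (HP, True) + t $ (HQ, False)"
| "root_value t X13 = t $ (HP, True) + t $ (HQ, True) + t $ (HQ, False)"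
| "root_value t X21 = t $ (HP, False) + t $ (HQ, True)"
| "root_value t X22 = t $ (HP, False) + t $ (HQ, False)"
| "root_value t X23 = t $ (HP, False) + t $ (HQ, True) + t $ (HQ, False)"
| "root_value t X31 = t $ (HP, True) + t $ (HP, False) + t $ (HQ, True)"
| "root_value t X32 = t $ (HP, True) + t $ (HP, False) + t $ (HQ, False)"
| "root_value t X33 = t $ (HP, True) + t $ (HP, False) + t $ (HQ, True) + t $ (HQ, False)"

text \<open>Diagonal elements act diagonally; \<open>root_value\<close> lists their eigenvalues.\<close>

lemma br_cartan:
  assumes "cartan t" shows "br a t y = (\<chi> i. root_value t (fst i) * y $ i)"
proof -
  have z: "r \<noteq> HP \<Longrightarrow> r \<noteq> HQ \<Longrightarrow> t $ (r, b) = 0" for r b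
    using assms by (simp add: cartan_def)
  show ?thesis
    unfolding Finite_Cartesian_Product.vec_eq_iff all_idx all_root_pair
    by (simp add: coord_simps z algebra_simps)
qed

definition root_idx :: "4 \<Rightarrow> idx" where
  "root_idx i = (if i = 1 then (B12, True) else if i = 2 then (X11, True) else if i = 3 then (A12, False) else (A23, False))"

lemma gen_E_F: "gen a (E i) = axis (root_idx i) 1"
   "gen a (F i) = axis (fst (root_idx i), \<not> snd (root_idx i)) 1"
  by (simp_all add: root_idx_def)

lemma gen_relations:
  "br a (gen a (E i)) (gen a (F j)) = (if i = j then gen a (H j) else 0)"
  "br a (gen a (H i)) (gen a (H j)) = 0"
  "br a (gen a (H i)) (gen a (E j)) = (cartan_F4 a $ i $ j) *s gen a (E j)"
  "br a (gen a (H i)) (gen a (F j)) = (cartan_F4 a $ i $ j) *s gen a (F j)"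
proof -
  have "\<forall>i j. br a (gen a (E i)) (gen a (F j)) = (if i = j then gen a (H j) else 0)"
    unfolding all_4
    by (simp add: Finite_Cartesian_Product.vec_eq_iff all_idx all_root_pair coord_simps axis_component del: split_paired_All)
  then show "br a (gen a (E i)) (gen a (F j)) = (if i = j then gen a (H j) else 0)"
    by blast
  have c: "cartan (gen a (H i))" for i
  proof -
    have "\<forall>i. cartan (gen a (H i))"
      unfolding all_4 gen_H_coords by (simp add: cartan_def axis_component)
    then show ?thesis by blast
  qed
  have "\<forall>i j. root_value (gen a (H i)) (fst (root_idx j)) = cartan_F4 a $ i $ j"
    unfolding all_4 gen_H_coords cartan_F4_row vector4_nth by (simp add: axis_component root_idx_def)
  then have w: "root_value (gen a (H i)) (fst (root_idx j)) = cartan_F4 a $ i $ j" for i j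
    by blast
  show "br a (gen a (H i)) (gen a (H j)) = 0"
    using c[of j] unfolding br_cartan[OF c] Finite_Cartesian_Product.vec_eq_iff all_idx all_root_pair
    by (simp add: cartan_def)
  show "br a (gen a (H i)) (gen a (E j)) = (cartan_F4 a $ i $ j) *s gen a (E j)"
    "br a (gen a (H i)) (gen a (F j)) = (cartan_F4 a $ i $ j) *s gen a (F j)"
    unfolding br_cartan[OF c] w[symmetric] gen_E_F Finite_Cartesian_Product.vec_eq_iff
    by (auto simp: axis_component simp del: gen.simps split_paired_All)
qed

lemma eval_free_kernel: "p \<in> tilde_kernel (cartan_F4 a) \<Longrightarrow> eval_free a p = 0"
proof -
  have ideal: "lie_ideal free_alg {p. eval_free a p = 0}"
    unfolding free_ideal_iff by (simp add: eval_free_add eval_free_sm eval_free_fm)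
  have "lie_identities \<subseteq> {p. eval_free a p = 0}"
    by (auto simp: lie_identities_def eval_free_add eval_free_fm br_jacobi)
  moreover have "cartan_relations (cartan_F4 a) \<subseteq> {p. eval_free a p = 0}"
  proof -
    note s = eval_free_add eval_free_diff eval_free_fm eval_free_sm eval_free_single eval_word.simps gen_relations vec.scale_one vec_diff vec_add_self
    have "eval_free a (free_gen (E i) \<star> free_gen (F j) - (if i = j then free_gen (H j) else 0)) = 0"
      "eval_free a (free_gen (H i) \<star> free_gen (H j)) = 0"
      "eval_free a (free_gen (H i) \<star> free_gen (E j) - sm (cartan_F4 a $ i $ j) (free_gen (E j))) = 0"
      "eval_free a (free_gen (H i) \<star> free_gen (F j) + sm (cartan_F4 a $ i $ j) (free_gen (F j))) = 0" for i j
      by (cases "i = j"; simp only: s if_True if_False eval_free_zero)+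
    then show ?thesis
      unfolding cartan_relations_def by blast
  qed
  ultimately show "p \<in> tilde_kernel (cartan_F4 a) \<Longrightarrow> eval_free a p = 0"
    using ideal_generated_least[OF ideal] unfolding tilde_kernel_def by blast
qed

lemma eval_word_graded: "eval_word a u \<in> graded_part (magma_deg u)"
proof (induction u)
  case (Gen g)
  have ef: "gen_ef (E i) \<in> graded_part 1" "gen_ef (F i) \<in> graded_part (-1)" for i
    by (auto simp: graded_part_def axis_component split: if_splits)
  then show ?case
    using br_graded[OF ef(1) ef(2)] by (cases g) (simp_all del: gen_ef.simps)
next
  case (Br u v)
  then show ?case by (simp add: br_graded)
qed

lemma eval_free_graded:
  assumes "\<forall>u\<in>words p. magma_deg u = d" shows "eval_free a p \<in> graded_part d"
proof -
  have "eval_free a p $ i = 0" if "deg i \<noteq> d" for i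
  proof -
    have "eval_word a u $ i = 0" if "u \<in> words p" for u
      using eval_word_graded[of u] assms that \<open>deg i \<noteq> d\<close> unfolding graded_part_def mem_Collect_eq by metis
    then show ?thesis
      unfolding eval_free_def sum_component by (intro sum.neutral) simp
  qed
  then show ?thesis
    unfolding graded_part_def by blast
qed

text \<open>The image is graded, so the kernel contains the homogeneous components of its elements.\<close>

lemma eval_free_deg_part:
  assumes "eval_free a p = 0" shows "eval_free a (deg_part d p) = 0"
proof -
  have *: "eval_free a (deg_part e p) $ i = 0" if "deg i \<noteq> e" for e i
    using eval_free_graded[of "deg_part e p" e] keys_deg_part that unfolding graded_part_def by blast
  have **: "eval_free a (deg_part (deg i) p) $ i = 0" for i
  proof (cases "deg i \<in> magma_deg ` words p")
    case True
    have "eval_free a p = (\<Sum>e\<in>magma_deg ` words p. eval_free a (deg_part e p))"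
      using eval_free_sum[of a "\<lambda>e. deg_part e p" "magma_deg ` words p"] by (simp only: sum_deg_part)
    then have "eval_free a p $ i = (\<Sum>e\<in>magma_deg ` words p. eval_free a (deg_part e p) $ i)"
      by (simp only: sum_component)
    also have "\<dots> = (\<Sum>e\<in>magma_deg ` words p. if e = deg i then eval_free a (deg_part (deg i) p) $ i else 0)"
      by (intro sum.cong refl) (auto simp: *)
    finally show ?thesis
      using True assms by simp
  next
    case False
    then have "{u \<in> words p. magma_deg u = deg i} = {}"
      by (auto simp: image_iff)
    then have "deg_part (deg i) p = 0"
      unfolding deg_part_def by (simp only: sum.empty)
    then show ?thesis
      by simp
  qed
  have "eval_free a (deg_part d p) $ i = 0" for i
    using *[of i d] **[of i] by metis
  then show ?thesis
    unfolding Finite_Cartesian_Product.vec_eq_iff by simp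
qed

end

text \<open>The sum of the components that the ideal in the definition of the contragredient algebra has to avoid.\<close>

abbreviation "local_part A \<equiv> tilde_component A (-1) <+>\<^bsub>tildeG A\<^esub> tilde_component A 0 <+>\<^bsub>tildeG A\<^esub> tilde_component A 1"

definition eval_free_kernel_ideal :: "'k::field \<Rightarrow> (4 cgen magma \<Rightarrow>\<^sub>0 'k) set set" where
  "eval_free_kernel_ideal a = tilde_proj (cartan_F4 a) ` {p. eval_free a p = 0}"

context wk4
begin

abbreviation "A4 \<equiv> cartan_F4 a"

interpretation T: presentation "tildeG A4" "tilde_proj A4"
  by (rule presentation_tilde)

lemma eval_free_cong: "tilde_proj A4 p = tilde_proj A4 q \<Longrightarrow> eval_free a p = eval_free a q"
  using eval_free_kernel[of "p - q"] by (simp add: tilde_proj_eq_iff eval_free_diff del: vec_diff)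

lemma tilde_proj_in_kernel_ideal: "tilde_proj A4 p \<in> eval_free_kernel_ideal a \<longleftrightarrow> eval_free a p = 0"
proof
  assume "tilde_proj A4 p \<in> eval_free_kernel_ideal a"
  then obtain q where "tilde_proj A4 p = tilde_proj A4 q" "eval_free a q = 0"
    unfolding eval_free_kernel_ideal_def by blast
  then show "eval_free a p = 0"
    using eval_free_cong[of p q] by simp
qed (simp add: eval_free_kernel_ideal_def)

lemma tilde_proj_in_component: "\<forall>u\<in>words p. magma_deg u = d \<Longrightarrow> tilde_proj A4 p \<in> tilde_component A4 d"
  unfolding tilde_component_eq by blast

lemma kernel_ideal_is_ideal: "lie_ideal (tildeG A4) (eval_free_kernel_ideal a)"
  unfolding eval_free_kernel_ideal_def by (rule T.lie_idealI) (simp_all add: eval_free_add eval_free_sm eval_free_fm)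

lemma span_submodule:
  assumes "S \<subseteq> carrier (tildeG A4)" shows "submodule class_ring (vspan (tildeG A4) S) (tildeG A4)"
  using module.span_is_submodule[of class_ring "tildeG A4" S] assms T.is_vectorspace
  by (simp add: vectorspace_def)

lemma kernel_ideal_homogeneous: "homogeneous_ideal A4 (eval_free_kernel_ideal a)"
proof -
  let ?S = "\<Union>d. eval_free_kernel_ideal a \<inter> tilde_component A4 d"
  have S: "?S \<subseteq> carrier (tildeG A4)"
    unfolding T.carrier_eq by (auto simp: eval_free_kernel_ideal_def)
  note sub = span_submodule[OF S]
  have own: "x \<in> vspan (tildeG A4) ?S" if "x \<in> ?S" for x
    using module.in_own_span[of class_ring "tildeG A4" ?S] T.is_vectorspace S that by (auto simp: vectorspace_def)
  have "tilde_proj A4 p \<in> vspan (tildeG A4) ?S" if p: "eval_free a p = 0" for p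
  proof -
    have h: "tilde_proj A4 (deg_part d p) \<in> vspan (tildeG A4) ?S" for d
    proof (rule own)
      show "tilde_proj A4 (deg_part d p) \<in> ?S"
        using tilde_proj_in_component[of "deg_part d p" d] keys_deg_part[of _ d p] tilde_proj_in_kernel_ideal eval_free_deg_part[OF p, of d] by fast
    qed
    have "tilde_proj A4 (\<Sum>d\<in>D. deg_part d p) \<in> vspan (tildeG A4) ?S" if "finite D" for D
      using that
    proof (induction D)
      case empty
      show ?case using submodule.zero_closed[OF sub] by (simp add: T.h_zero)
    next
      case (insert d D)
      show ?case using submodule.m_closed[OF sub h[of d] insert.IH] insert.hyps by (simp add: T.h_add)
    qed
    from this[of "magma_deg ` words p"] show ?thesis
      by (simp add: sum_deg_part)
  qed
  then show ?thesis
    unfolding homogeneous_ideal_def using kernel_ideal_is_ideal by (auto simp: eval_free_kernel_ideal_def)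
qed

lemma sum_4: "(\<Sum>i\<in>UNIV. f i) = f 1 + f 2 + f 3 + f (4::4)" for f :: "4 \<Rightarrow> 'b::comm_monoid_add"
  unfolding UNIV_4 by (simp add: add.assoc)

lemma eval_free_local:
  assumes "eval_free a (lin_gen F b + lin_gen H c + lin_gen E d) = 0"
  shows "b = (\<lambda>_. 0)" "c = (\<lambda>_. 0)" "d = (\<lambda>_. 0)"
proof -
  have e: "b 1 *s gen a (F 1) + b 2 *s gen a (F 2) + b 3 *s gen a (F 3) + b 4 *s gen a (F 4) +
    (c 1 *s gen a (H 1) + c 2 *s gen a (H 2) + c 3 *s gen a (H 3) + c 4 *s gen a (H 4)) +
    (d 1 *s gen a (E 1) + d 2 *s gen a (E 2) + d 3 *s gen a (E 3) + d 4 *s gen a (E 4)) = 0"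
    using assms unfolding eval_free_add lin_gen_def sum_4 eval_free_sm eval_free_single eval_word.simps by simp
  note e' = e[unfolded gen_H_coords, THEN idx_zeroD, unfolded all_root_pair]
  have "(\<forall>i. b i = 0) \<and> (\<forall>i. c i = 0) \<and> (\<forall>i. d i = 0)"
    unfolding all_4 using e' a_nz by (auto simp: axis_component)
  then show "b = (\<lambda>_. 0)" "c = (\<lambda>_. 0)" "d = (\<lambda>_. 0)"
    by auto
qed

lemma component_local:
  assumes "x \<in> tilde_component A4 d" "g = E \<and> d = 1 \<or> g = F \<and> d = -1 \<or> g = H \<and> d = 0"
  obtains c where "x = tilde_proj A4 (lin_gen g c)"
proof -
  obtain p where p: "x = tilde_proj A4 p" "\<forall>u\<in>words p. magma_deg u = d"
    using assms(1) unfolding tilde_component_eq by blast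
  from tri_local[OF tri_homogeneous[OF p(2)] assms(2), of A4] show ?thesis
    using that p(1) tilde_proj_eq_iff by metis
qed

lemma kernel_ideal_local: "eval_free_kernel_ideal a \<inter> local_part A4 = {\<zero>\<^bsub>tildeG A4\<^esub>}"
proof
  show "eval_free_kernel_ideal a \<inter> local_part A4 \<subseteq> {\<zero>\<^bsub>tildeG A4\<^esub>}"
  proof
    fix x assume x: "x \<in> eval_free_kernel_ideal a \<inter> local_part A4"
    then obtain y0 y1 y2 where y: "y0 \<in> tilde_component A4 (-1)" "y1 \<in> tilde_component A4 0" "y2 \<in> tilde_component A4 1"
      "x = y0 \<oplus>\<^bsub>tildeG A4\<^esub> y1 \<oplus>\<^bsub>tildeG A4\<^esub> y2"
      unfolding set_add_def' by auto
    obtain b where b: "y0 = tilde_proj A4 (lin_gen F b)"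
      using component_local[OF y(1), of F] by blast
    obtain c where c: "y1 = tilde_proj A4 (lin_gen H c)"
      using component_local[OF y(2), of H] by blast
    obtain d where d: "y2 = tilde_proj A4 (lin_gen E d)"
      using component_local[OF y(3), of E] by blast
    have x': "x = tilde_proj A4 (lin_gen F b + lin_gen H c + lin_gen E d)"
      by (simp add: y(4) b c d T.h_add)
    with x have "eval_free a (lin_gen F b + lin_gen H c + lin_gen E d) = 0"
      using tilde_proj_in_kernel_ideal by blast
    from eval_free_local[OF this] show "x \<in> {\<zero>\<^bsub>tildeG A4\<^esub>}"
      by (simp add: x' lin_gen_zero T.h_zero)
  qed
  have "tilde_proj A4 0 \<in> tilde_component A4 d" for d
    unfolding tilde_component_eq by force
  moreover have "\<zero>\<^bsub>tildeG A4\<^esub> = tilde_proj A4 0 \<oplus>\<^bsub>tildeG A4\<^esub> tilde_proj A4 0 \<oplus>\<^bsub>tildeG A4\<^esub> tilde_proj A4 0"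
    by (simp add: T.h_add T.h_zero)
  ultimately have "\<zero>\<^bsub>tildeG A4\<^esub> \<in> local_part A4"
    unfolding set_add_def' by blast
  then show "{\<zero>\<^bsub>tildeG A4\<^esub>} \<subseteq> eval_free_kernel_ideal a \<inter> local_part A4"
    using tilde_proj_in_kernel_ideal[of 0] by (simp add: T.h_zero)
qed

lemma local_partI:
  "x \<in> tilde_component A4 (-1) \<Longrightarrow> y \<in> tilde_component A4 0 \<Longrightarrow> z \<in> tilde_component A4 1 \<Longrightarrow>
    x \<oplus>\<^bsub>tildeG A4\<^esub> y \<oplus>\<^bsub>tildeG A4\<^esub> z \<in> local_part A4"
  unfolding set_add_def' by blast

lemma keys_bracket_gen:
  assumes "\<forall>u\<in>words p. magma_deg u = d"
  shows "\<forall>u\<in>words (free_gen g \<star> p). magma_deg u = magma_deg (Gen g) + d"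
proof -
  have "free_gen g \<star> p = (\<Sum>v\<in>words p. Poly_Mapping.single (Br (Gen g) v) (coef p v))"
    by (subst fm_superset[of "{Gen g}" "words p"]) auto
  then have "coef (free_gen g \<star> p) u \<noteq> 0 \<Longrightarrow> magma_deg u = magma_deg (Gen g) + d" for u
    using assms by (auto simp: lookup_sum lookup_single when_def elim!: sum.not_neutral_contains_not_neutral split: if_splits)
  then show ?thesis
    by (simp add: in_keys_iff)
qed

text \<open>Elements of the ideal in degrees -1, 0, 1 vanish. In higher degree apply the \<open>f\<^sub>j\<close> and use
induction on the degree: the result is killed by evaluation, so by transitivity the element itself is.\<close>

lemma ideal_zero_part:
  assumes I: "lie_ideal (tildeG A4) I" "I \<inter> local_part A4 = {\<zero>\<^bsub>tildeG A4\<^esub>}"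
    and p: "tilde_proj A4 p \<in> I" "\<forall>u\<in>words p. magma_deg u = d"
  shows "eval_free a p = 0"
proof -
  have loc: "eval_free a p = 0" if p: "tilde_proj A4 p \<in> I" "\<forall>u\<in>words p. magma_deg u = d" "d = -1 \<or> d = 0 \<or> d = 1" for p d
  proof -
    have z: "tilde_proj A4 0 \<in> tilde_component A4 d" for d
      unfolding tilde_component_eq by force
    have "tilde_proj A4 p \<in> tilde_component A4 d"
      by (rule tilde_proj_in_component[OF p(2)])
    with p(3) have "tilde_proj A4 p \<in> local_part A4"
      using local_partI[of "tilde_proj A4 p" "tilde_proj A4 0" "tilde_proj A4 0"] local_partI[of "tilde_proj A4 0" "tilde_proj A4 p" "tilde_proj A4 0"]
        local_partI[of "tilde_proj A4 0" "tilde_proj A4 0" "tilde_proj A4 p"] z by (auto simp: T.h_add)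
    with p(1) have "tilde_proj A4 p \<in> I \<inter> local_part A4"
      by (rule IntI)
    then have "tilde_proj A4 p = tilde_proj A4 0"
      unfolding I(2) T.h_zero by simp
    then show ?thesis
      using eval_free_cong[of p 0] by simp
  qed
  have mult: "tilde_proj A4 (free_gen g \<star> p) \<in> I" if "tilde_proj A4 p \<in> I" for g p
    by (rule T.ideal_mult(2)[OF I(1) that])
  have pos: "eval_free a p = 0" if "tilde_proj A4 p \<in> I" "\<forall>u\<in>words p. magma_deg u = int n" for p n
    using that
  proof (induction n arbitrary: p)
    case 0
    then show ?case using loc[of p 0] by simp
  next
    case (Suc n)
    show ?case
    proof (cases "n = 0")
      case True
      then show ?thesis using loc[of p 1] Suc.prems by simp
    next
      case False
      have "br a (gen_ef (F j)) (eval_free a p) = 0" for j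
      proof -
        have "\<forall>u\<in>words (free_gen (F j) \<star> p). magma_deg u = int n"
          using keys_bracket_gen[OF Suc.prems(2), of "F j"] by simp
        from Suc.IH[OF mult[OF Suc.prems(1)] this] show ?thesis
          by (simp only: eval_free_fm eval_free_single eval_word.simps gen.simps vec.scale_one)
      qed
      moreover have "eval_free a p $ i = 0" if "deg i \<le> 1" for i
      proof -
        have "deg i \<noteq> int (Suc n)"
          using that False by simp
        then show ?thesis
          using eval_free_graded[OF Suc.prems(2)] unfolding graded_part_def mem_Collect_eq by metis
      qed
      ultimately show ?thesis
        by (rule transitive_pos[rotated])
    qed
  qed
  have neg: "eval_free a p = 0" if "tilde_proj A4 p \<in> I" "\<forall>u\<in>words p. magma_deg u = - int n" for p n
    using that
  proof (induction n arbitrary: p)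
    case 0
    then show ?case using loc[of p 0] by simp
  next
    case (Suc n)
    show ?case
    proof (cases "n = 0")
      case True
      then show ?thesis using loc[of p "-1"] Suc.prems by simp
    next
      case False
      have "br a (gen_ef (E j)) (eval_free a p) = 0" for j
      proof -
        have "\<forall>u\<in>words (free_gen (E j) \<star> p). magma_deg u = - int n"
          using keys_bracket_gen[OF Suc.prems(2), of "E j"] by simp
        from Suc.IH[OF mult[OF Suc.prems(1)] this] show ?thesis
          by (simp only: eval_free_fm eval_free_single eval_word.simps gen.simps vec.scale_one)
      qed
      moreover have "eval_free a p $ i = 0" if "- 1 \<le> deg i" for i
      proof -
        have "deg i \<noteq> - int (Suc n)"
          using that False by simp
        then show ?thesis
          using eval_free_graded[OF Suc.prems(2)] unfolding graded_part_def mem_Collect_eq by metis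
      qed
      ultimately show ?thesis
        by (rule transitive_neg[rotated])
    qed
  qed
  show ?thesis
    using pos[OF p(1), of "nat d"] neg[OF p(1), of "nat (- d)"] p(2) by (cases "d \<ge> 0") auto
qed

lemma kernel_ideal_greatest:
  assumes I: "homogeneous_ideal A4 I" "I \<inter> local_part A4 = {\<zero>\<^bsub>tildeG A4\<^esub>}"
  shows "I \<subseteq> eval_free_kernel_ideal a"
proof -
  have li: "lie_ideal (tildeG A4) I" and sp: "I \<subseteq> vspan (tildeG A4) (\<Union>d. I \<inter> tilde_component A4 d)"
    using I(1) by (auto simp: homogeneous_ideal_def)
  have "(\<Union>d. I \<inter> tilde_component A4 d) \<subseteq> eval_free_kernel_ideal a"
    using ideal_zero_part[OF li I(2)] tilde_proj_in_kernel_ideal unfolding tilde_component_eq by blast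
  moreover have "submodule class_ring (eval_free_kernel_ideal a) (tildeG A4)"
    using kernel_ideal_is_ideal by (simp add: lie_ideal_def subspace_def)
  ultimately have "vspan (tildeG A4) (\<Union>d. I \<inter> tilde_component A4 d) \<subseteq> eval_free_kernel_ideal a"
    using module.span_is_subset[of class_ring "tildeG A4"] T.is_vectorspace by (simp add: vectorspace_def)
  with sp show ?thesis by blast
qed

lemma contragredient_ideal_eq: "contragredient_ideal A4 = eval_free_kernel_ideal a"
  unfolding contragredient_ideal_def
  by (rule Greatest_equality) (use kernel_ideal_homogeneous kernel_ideal_local kernel_ideal_greatest in auto)

definition "contra_proj p = contragredient_ideal A4 +>\<^bsub>tildeG A4\<^esub> tilde_proj A4 p"

lemma presentation_contragredient: "presentation (contragredient A4) contra_proj"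
  using T.quot_presentation[OF kernel_ideal_is_ideal]
  by (simp add: contragredient_def contra_proj_def[abs_def] contragredient_ideal_eq)

text \<open>The contragredient algebra embeds into the model.\<close>

lemma contra_proj_eq_iff: "contra_proj p = contra_proj q \<longleftrightarrow> eval_free a p = eval_free a q"
  using T.coset_eq_iff[OF kernel_ideal_is_ideal, of p q] tilde_proj_in_kernel_ideal[of "p - q"]
  by (simp add: contra_proj_def contragredient_ideal_eq eval_free_diff del: vec_diff)

lemma contra_proj_gen: "contragredient_gen A4 g = contra_proj (free_gen g)"
  by (simp add: contragredient_gen_def contra_proj_def tilde_proj_def)

end

section \<open>Fixed vectors of semilinear maps\<close>

abbreviation "lin \<equiv> Vector_Spaces.linear ((*s) :: 'k::field \<Rightarrow> 'k^'n \<Rightarrow> 'k^'n) ((*s) :: 'k \<Rightarrow> 'k^'n \<Rightarrow> 'k^'n)"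

lemma linI:
  assumes "\<And>x y. N (x + y) = N x + N y" "\<And>c x. N (c *s x) = c *s N x" shows "lin N"
  by unfold_locales (use assms in auto)

context char_two
begin

lemma frobenius_add: "((x::'k) + y)\<^sup>2 = x\<^sup>2 + y\<^sup>2"
  by (simp add: power2_eq_square algebra_simps)

text \<open>With \<open>x\<^sub>0 = c\<^sub>0 s\<^sup>2\<close> and \<open>x\<^sub>i\<^sub>+\<^sub>1 = x\<^sub>i\<^sup>2 + c\<^sub>i\<^sub>+\<^sub>1 s\<^sup>2\<close> one has \<open>x\<^sub>i = s\<^sup>2 p\<^sub>i(s)\<close>, where \<open>p\<^sub>i\<close> is this polynomial.\<close>

fun fixpoly :: "(nat \<Rightarrow> 'k) \<Rightarrow> nat \<Rightarrow> 'k poly" where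
  "fixpoly c 0 = [:c 0:]"
| "fixpoly c (Suc i) = pCons (c (Suc i)) (pCons 0 ((fixpoly c i)\<^sup>2))"

lemma fixpoly_eq_0: "fixpoly c m = 0 \<Longrightarrow> i \<le> m \<Longrightarrow> c i = 0"
  by (induction m) (auto simp: le_Suc_eq)

end

text \<open>Let \<open>U\<close> be the span of the fixed vectors and suppose \<open>w\<close> lies outside \<open>U\<close>. The iterates of \<open>w\<close> under \<open>F\<close>
satisfy a shortest linear relation modulo \<open>U\<close>. Comparing coefficients in \<open>F v = v\<close> for a
combination \<open>v\<close> of the iterates leaves one polynomial equation in the last coefficient, which has a
nonzero root. This gives a vector fixed modulo \<open>U\<close> but not in \<open>U\<close>, and the equations
\<open>y\<^sup>2 + y = c\<close> correct it by an element of \<open>U\<close> to a fixed vector.\<close>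

lemma (in char_two) semilinear_fixed_span:
  fixes F :: "'k ^ 'n \<Rightarrow> 'k ^ 'n" and W :: "('k ^ 'n) set"
  assumes closed: "\<And>p :: 'k poly. degree p > 0 \<Longrightarrow> \<exists>x. poly p x = 0"
    and W: "vec.subspace W" and F_closed: "\<And>x. x \<in> W \<Longrightarrow> F x \<in> W"
    and F_add: "\<And>x y. x \<in> W \<Longrightarrow> y \<in> W \<Longrightarrow> F (x + y) = F x + F y"
    and F_scale: "\<And>c x. x \<in> W \<Longrightarrow> F (c *s x) = c\<^sup>2 *s F x"
    and F_inj: "\<And>x. x \<in> W \<Longrightarrow> F x = 0 \<Longrightarrow> x = 0"
  shows "vec.span {x \<in> W. F x = x} = W"
proof (rule ccontr)
  define U where "U = vec.span {x \<in> W. F x = x}"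
  have UW: "U \<subseteq> W"
    unfolding U_def by (rule vec.span_minimal[OF _ W]) auto
  have U: "vec.subspace U"
    unfolding U_def by (rule vec.subspace_span)
  assume "vec.span {x \<in> W. F x = x} \<noteq> W"
  then obtain w0 where w0: "w0 \<in> W" "w0 \<notin> U"
    using UW unfolding U_def by blast
  have root2: "\<exists>t. t\<^sup>2 = (c::'k)" for c
    using closed[of "[:c, 0, 1:]"] by (auto simp: power2_eq_square)
  have root_as: "\<exists>t. t\<^sup>2 + t = (c::'k)" for c
  proof -
    obtain t where "poly [:c, 1, 1:] t = 0"
      using closed[of "[:c, 1, 1:]"] by auto
    then have "t = c + t\<^sup>2"
      by (simp add: power2_eq_square algebra_simps)
    then have "t\<^sup>2 + t = c"
      by (metis add.commute add_self_left)
    then show ?thesis ..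
  qed
  have F_surj: "\<exists>y\<in>U. F y = u" if "u \<in> U" for u
    using that unfolding U_def
  proof (induction rule: vec.span_induct_alt)
    case base
    have "F 0 = 0"
      using F_scale[of 0 0] vec.subspace_0[OF W] by simp
    then show ?case
      using vec.span_zero by blast
  next
    case (step c x y)
    then obtain z where z: "z \<in> U" "F z = y"
      unfolding U_def by blast
    obtain t where t: "t\<^sup>2 = c"
      using root2 by blast
    have "t *s x \<in> U"
      unfolding U_def using step by (intro vec.span_scale vec.span_base)
    then have "F (t *s x + z) = c *s x + y" "t *s x + z \<in> U"
      using step z t UW F_add[of "t *s x" z] F_scale[of x t] vec.subspace_add[OF U] by auto
    then show ?case
      unfolding U_def by blast
  qed
  have F_as: "\<exists>y\<in>U. F y + y = u" if "u \<in> U" for u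
    using that unfolding U_def
  proof (induction rule: vec.span_induct_alt)
    case base
    have "F 0 = 0"
      using F_scale[of 0 0] vec.subspace_0[OF W] by simp
    then show ?case
      using vec.span_zero by (intro bexI[of _ 0]) auto
  next
    case (step c x y)
    then obtain z where z: "z \<in> U" "F z + z = y"
      unfolding U_def by blast
    obtain t where t: "t\<^sup>2 + t = c"
      using root_as by blast
    have tx: "t *s x \<in> U"
      unfolding U_def using step by (intro vec.span_scale vec.span_base)
    then have "F (t *s x + z) = t\<^sup>2 *s x + F z"
      using step z UW F_add[of "t *s x" z] F_scale[of x t] by auto
    then have "F (t *s x + z) + (t *s x + z) = (t\<^sup>2 + t) *s x + (F z + z)"
      by (simp add: vec.scale_left_distrib ac_simps)
    then have "F (t *s x + z) + (t *s x + z) = c *s x + y"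
      by (simp only: t z)
    then show ?case
      using vec.subspace_add[OF U tx z(1)] unfolding U_def by blast
  qed
  define w where "w i = (F ^^ i) w0" for i
  have w_W: "w i \<in> W" for i
    by (induction i) (simp_all add: w_def w0 F_closed)
  have w_Suc: "w (Suc i) = F (w i)" for i
    by (simp add: w_def)
  define P where "P n \<longleftrightarrow> (\<exists>u\<in>U. \<exists>c. w n = u + (\<Sum>i<n. c i *s w i))" for n
  have span_rep: "\<exists>u\<in>U. \<exists>c. x = u + (\<Sum>i<n. c i *s w i)" if "x \<in> vec.span (U \<union> w ` {..<n})" for x n
    using that
  proof (induction n arbitrary: x)
    case 0
    then have "x \<in> U"
      using U by (simp flip: vec.span_eq_iff)
    then show ?case by simp
  next
    case (Suc n)
    then have "x \<in> vec.span (insert (w n) (U \<union> w ` {..<n}))"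
      by (simp add: lessThan_Suc)
    then obtain k where "x - k *s w n \<in> vec.span (U \<union> w ` {..<n})"
      using vec.span_breakdown_eq by blast
    from Suc.IH[OF this] obtain u c where u: "u \<in> U" "x - k *s w n = u + (\<Sum>i<n. c i *s w i)"
      by blast
    have "x = (x - k *s w n) + k *s w n"
      by (simp only: diff_add_cancel)
    also have "\<dots> = u + ((\<Sum>i<n. c i *s w i) + k *s w n)"
      by (simp only: u(2) add.assoc)
    finally have "x = u + ((\<Sum>i<n. c i *s w i) + k *s w n)" .
    then have "x = u + (\<Sum>i<Suc n. (c(n := k)) i *s w i)"
      by simp
    then show ?case using u(1) by (intro bexI[of _ u] exI[of _ "c(n := k)"])
  qed
  have "\<exists>n. P n"
  proof (rule ccontr)
    assume "\<nexists>n. P n"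
    then have out: "w n \<notin> vec.span (U \<union> w ` {..<n})" for n
      using span_rep[of "w n" n] unfolding P_def by blast
    have "n \<le> vec.dim (U \<union> w ` {..<n})" for n
    proof (induction n)
      case (Suc n)
      have "vec.dim (insert (w n) (U \<union> w ` {..<n})) = Suc (vec.dim (U \<union> w ` {..<n}))"
        using out[of n] by (simp add: vec.dim_insert)
      with Suc show ?case by (simp add: lessThan_Suc)
    qed simp
    from this[of "Suc CARD('n)"] show False
      using dim_subset_UNIV_cart_gen[of "U \<union> w ` {..<Suc CARD('n)}"] by simp
  qed
  define n where "n = (LEAST n. P n)"
  have least: "\<not> P k" if "k < n" for k
    using that unfolding n_def by (rule not_less_Least)
  have Pn: "P n"
    unfolding n_def using \<open>\<exists>n. P n\<close> by (rule LeastI_ex)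
  have "n \<noteq> 0"
    using Pn w0 unfolding P_def w_def by (cases n) auto
  then obtain m where m: "n = Suc m"
    using not0_implies_Suc by blast
  obtain u c where u: "u \<in> U" and wn: "w (Suc m) = u + (\<Sum>i<Suc m. c i *s w i)"
    using Pn unfolding P_def m by blast
  have notP: "\<not> P m"
    using least[of m] m by simp
  have indep: "(\<Sum>i<Suc m. b i *s w i) \<notin> U" if "b m \<noteq> 0" for b
  proof
    assume s: "(\<Sum>i<Suc m. b i *s w i) \<in> U"
    define v where "v = (\<Sum>i<Suc m. b i *s w i)"
    have "v = (\<Sum>i<m. b i *s w i) + b m *s w m"
      by (simp add: v_def)
    then have "b m *s w m = v + (\<Sum>i<m. b i *s w i)"
      by (metis add.commute vec_add_self(2))
    then have "inverse (b m) *s (b m *s w m) = inverse (b m) *s (v + (\<Sum>i<m. b i *s w i))"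
      by simp
    then have "w m = inverse (b m) *s v + (\<Sum>i<m. (inverse (b m) * b i) *s w i)"
      using that by (simp add: vec.scale_right_distrib vec.scale_sum_right)
    moreover have "inverse (b m) *s v \<in> U"
      using s vec.subspace_scale[OF U] by (simp add: v_def)
    ultimately have "P m"
      unfolding P_def by (intro bexI[of _ "inverse (b m) *s v"] exI[of _ "\<lambda>i. inverse (b m) * b i"])
    then show False
      using notP by simp
  qed
  have t_nz: "fixpoly c m \<noteq> 0"
  proof
    assume "fixpoly c m = 0"
    then have "c i = 0" if "i < Suc m" for i
      using fixpoly_eq_0[of c m i] that by simp
    then have "w (Suc m) = u"
      using wn by simp
    moreover obtain y where y: "y \<in> U" "F y = u"
      using F_surj[OF u] by blast
    ultimately have "F (w m + y) = 0"
      using F_add[of "w m" y] w_W[of m] UW by (auto simp: w_Suc)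
    then have "w m + y = 0"
      using F_inj[of "w m + y"] vec.subspace_add[OF W] w_W y(1) UW by blast
    then have "w m = y + (\<Sum>i<m. 0 *s w i)"
      by (simp add: add_eq_0_iff)
    then have "P m"
      unfolding P_def using y(1) by (intro bexI[of _ y] exI[of _ "\<lambda>_. 0"])
    then show False
      using notP by simp
  qed
  obtain s where "poly (pCons (-1) (fixpoly c m)) s = 0"
    using closed[of "pCons (-1) (fixpoly c m)"] t_nz by auto
  then have s: "s * poly (fixpoly c m) s = 1"
    by simp
  define x where "x i = s\<^sup>2 * poly (fixpoly c i) s" for i
  have x_0: "x 0 = c 0 * s\<^sup>2" and x_Suc: "x (Suc i) = (x i)\<^sup>2 + c (Suc i) * s\<^sup>2" for i
    by (simp_all add: x_def power2_eq_square algebra_simps)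
  have x_m: "x m = s" and s_nz: "s \<noteq> 0"
    using s by (auto simp: x_def power2_eq_square mult.assoc)
  define v where "v = (\<Sum>i<Suc m. x i *s w i)"
  have sum_W: "(\<Sum>i<k. x i *s w i) \<in> W" for k
    using w_W by (intro vec.subspace_sum[OF W] vec.subspace_scale[OF W])
  have F_sum: "F (\<Sum>i<k. x i *s w i) = (\<Sum>i<k. (x i)\<^sup>2 *s w (Suc i))" for k
  proof (induction k)
    case 0
    show ?case using F_scale[of 0 0] vec.subspace_0[OF W] by simp
  next
    case (Suc k)
    then show ?case
      using F_add[OF sum_W[of k] vec.subspace_scale[OF W w_W[of k], of "x k"]] F_scale[OF w_W[of k], of "x k"]
      by (simp add: w_Suc)
  qed
  have "F v = (\<Sum>i<m. (x i)\<^sup>2 *s w (Suc i)) + s\<^sup>2 *s w (Suc m)"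
    unfolding v_def F_sum by (simp add: x_m)
  also have "s\<^sup>2 *s w (Suc m) = s\<^sup>2 *s u + (\<Sum>i<Suc m. (c i * s\<^sup>2) *s w i)"
    unfolding wn by (simp add: vec.scale_right_distrib vec.scale_sum_right mult.commute)
  also have "(\<Sum>i<Suc m. (c i * s\<^sup>2) *s w i) = x 0 *s w 0 + (\<Sum>i<m. (c (Suc i) * s\<^sup>2) *s w (Suc i))"
    by (simp only: sum.lessThan_Suc_shift x_0)
  finally have "F v = s\<^sup>2 *s u + (x 0 *s w 0 + (\<Sum>i<m. x (Suc i) *s w (Suc i)))"
    by (simp add: x_Suc vec.scale_left_distrib sum.distrib ac_simps)
  also have "x 0 *s w 0 + (\<Sum>i<m. x (Suc i) *s w (Suc i)) = v"
    unfolding v_def by (simp only: sum.lessThan_Suc_shift)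
  finally have Fv: "F v = s\<^sup>2 *s u + v" .
  obtain y where y: "y \<in> U" "F y + y = s\<^sup>2 *s u"
    using F_as[of "s\<^sup>2 *s u"] vec.subspace_scale[OF U u] by blast
  have v: "v \<in> W"
    unfolding v_def by (rule sum_W)
  have "F y = s\<^sup>2 *s u + y"
    using y(2) by (metis add.commute vec_add_self(2))
  then have "F (v + y) = v + y"
    using F_add[OF v, of y] y(1) UW by (auto simp: Fv ac_simps)
  then have "v + y \<in> U"
    unfolding U_def using v y(1) UW vec.subspace_add[OF W] by (intro vec.span_base) auto
  then have "(v + y) + y \<in> U"
    using y(1) vec.subspace_add[OF U] by blast
  then have "v \<in> U"
    by (simp add: add.assoc)
  then show False
    using indep[of x] s_nz x_m unfolding v_def by simp
qed

section \<open>Ranks of idempotents\<close>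

text \<open>The space is the direct sum of image and kernel.\<close>

lemma dim_idempotent:
  fixes N :: "'k::field ^ 'n \<Rightarrow> 'k ^ 'n"
  assumes N: "lin N" and U: "vec.subspace U" and inv: "\<And>u. u \<in> U \<Longrightarrow> N u \<in> U" and idem: "\<And>u. u \<in> U \<Longrightarrow> N (N u) = N u"
  shows "vec.dim U = vec.dim (N ` U) + vec.dim {u \<in> U. N u = 0}"
proof -
  interpret N: Vector_Spaces.linear "(*s)" "(*s)" N by fact
  let ?K = "{u \<in> U. N u = 0}"
  obtain A where A: "A \<subseteq> N ` U" "vec.independent A" "N ` U \<subseteq> vec.span A" "card A = vec.dim (N ` U)"
    using vec.basis_exists by blast
  obtain B where B: "B \<subseteq> ?K" "vec.independent B" "?K \<subseteq> vec.span B" "card B = vec.dim ?K"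
    using vec.basis_exists by blast
  have fin: "finite A" "finite B"
    using A B vec.finiteI_independent by auto
  have NA: "N v = v" if "v \<in> A" for v
    using A(1) idem that by auto
  have NB: "N v = 0" if "v \<in> B" for v
    using B(1) that by auto
  have disj: "A \<inter> B = {}"
    using NA NB A(2) vec.dependent_zero by fastforce
  have "vec.independent (A \<union> B)"
    unfolding vec.independent_explicit
  proof (intro conjI allI impI)
    show "finite (A \<union> B)" using fin by simp
    fix c assume "(\<Sum>v\<in>A \<union> B. c v *s v) = 0"
    then have s: "(\<Sum>v\<in>A. c v *s v) + (\<Sum>v\<in>B. c v *s v) = 0"
      using fin disj by (simp add: sum.union_disjoint)
    have "N ((\<Sum>v\<in>A. c v *s v) + (\<Sum>v\<in>B. c v *s v)) = (\<Sum>v\<in>A. c v *s v)"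
      by (simp add: N.add N.sum N.scale NA NB)
    then have s': "(\<Sum>v\<in>A. c v *s v) = 0"
      by (simp add: s N.zero)
    with s have "(\<Sum>v\<in>B. c v *s v) = 0"
      by simp
    with s' show "\<forall>v\<in>A \<union> B. c v = 0"
      using A(2) B(2) unfolding vec.independent_explicit by blast
  qed
  moreover have "A \<union> B \<subseteq> U"
    using A(1) B(1) inv by auto
  moreover have "U \<subseteq> vec.span (A \<union> B)"
  proof
    fix u assume u: "u \<in> U"
    have "N u \<in> vec.span (A \<union> B)"
      using A(3) u vec.span_mono[of A "A \<union> B"] by auto
    moreover have "u - N u \<in> ?K"
      using u inv idem vec.subspace_diff[OF U] by (simp add: N.diff)
    then have "u - N u \<in> vec.span (A \<union> B)"
      using B(3) vec.span_mono[of B "A \<union> B"] by auto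
    ultimately have "N u + (u - N u) \<in> vec.span (A \<union> B)"
      by (rule vec.span_add)
    then show "u \<in> vec.span (A \<union> B)"
      by simp
  qed
  ultimately have "card (A \<union> B) = vec.dim U"
    by (intro vec.basis_card_eq_dim)
  then show ?thesis
    using card_Un_disjoint[OF fin disj] A(4) B(4) by simp
qed

section \<open>Averaging ranks over toral elements\<close>

text \<open>For vectors over a field of characteristic 2 these are all combinations with coefficients 0 and 1,
that is, the span over the field of two elements.\<close>

fun subset_sums :: "'a::comm_monoid_add list \<Rightarrow> 'a list" where
  "subset_sums [] = [0]"
| "subset_sums (t # ts) = subset_sums ts @ map ((+) t) (subset_sums ts)"

lemma length_subset_sums: "length (subset_sums ts) = 2 ^ length ts"
  by (induction ts) simp_all

lemma sum_list_subset_sums_Cons: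
  "(\<Sum>m\<leftarrow>subset_sums (t # ts). f m) = (\<Sum>m\<leftarrow>subset_sums ts. f m + f (t + m))" for f :: "_ \<Rightarrow> nat"
  by (simp add: sum_list_addf o_def)

lemma subset_sums_span: "m \<in> set (subset_sums ts) \<Longrightarrow> m \<in> vec.span (set ts)"
proof (induction ts arbitrary: m)
  case (Cons t ts)
  have mono: "vec.span (set ts) \<subseteq> vec.span (set (t # ts))"
    by (rule vec.span_mono) auto
  have "t \<in> vec.span (set (t # ts))"
    by (rule vec.span_base) simp
  with Cons mono show ?case
    by (auto intro: vec.span_add)
qed (simp add: vec.span_zero)

context char_two
begin

text \<open>For a 2-map on an algebra with zero center this means that \<open>t\<close> is equal to its square; the
definition only refers to the bracket.\<close>

definition toral_el :: "'k ^ idx \<Rightarrow> bool" where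
  "toral_el t \<longleftrightarrow> (\<forall>y. br a t (br a t y) = br a t y)"

lemma lin_br: "lin (br a t)"
  by (rule linI) (simp_all add: br_add_right br_scale_right)

lemma br_derivation: "br a u (br a v w) = br a (br a u v) w + br a v (br a u w)"
proof -
  have "br a u (br a v w) + (br a v (br a u w) + br a (br a u v) w) = 0"
    using br_jacobi[of u v w] br_commute[of w u] br_commute[of w "br a u v"] by (simp add: add.assoc)
  then show ?thesis
    by (metis add.commute add.right_neutral vec_add_self(2))
qed

lemma br_swap: "br a t m = 0 \<Longrightarrow> br a t (br a m y) = br a m (br a t y)"
  by (simp add: br_derivation[of t m y])

lemma toral_el_add:
  assumes "toral_el t" "toral_el m" "br a t m = 0" shows "toral_el (t + m)"
  using assms br_swap[OF assms(3)] unfolding toral_el_def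
  by (simp add: br_add_left br_add_right ac_simps)

lemma subset_sums_toral:
  assumes "\<forall>t\<in>set ts. toral_el t" "\<forall>t\<in>set ts. \<forall>t'\<in>set ts. br a t t' = 0" "m \<in> set (subset_sums ts)"
  shows "toral_el m"
    and "(\<And>t. t \<in> set ts \<Longrightarrow> br a s t = 0) \<Longrightarrow> br a s m = 0"
    and "(\<And>t u. t \<in> set ts \<Longrightarrow> u \<in> U \<Longrightarrow> br a t u \<in> U) \<Longrightarrow> vec.subspace U \<Longrightarrow> u \<in> U \<Longrightarrow> br a m u \<in> U"
proof -
  have comm: "(\<And>t. t \<in> set ts \<Longrightarrow> br a s t = 0) \<Longrightarrow> m \<in> set (subset_sums ts) \<Longrightarrow> br a s m = 0" for s m ts
    by (induction ts arbitrary: m) (auto simp: br_add_right)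
  show "(\<And>t. t \<in> set ts \<Longrightarrow> br a s t = 0) \<Longrightarrow> br a s m = 0"
    using comm assms(3) by blast
  show "toral_el m"
    using assms
  proof (induction ts arbitrary: m)
    case (Cons t ts)
    have "br a t m' = 0" if "m' \<in> set (subset_sums ts)" for m'
      using comm[OF _ that, of t] Cons.prems by simp
    with Cons show ?case
      by (auto intro: toral_el_add)
  qed (simp add: toral_el_def)
  show "(\<And>t u. t \<in> set ts \<Longrightarrow> u \<in> U \<Longrightarrow> br a t u \<in> U) \<Longrightarrow> vec.subspace U \<Longrightarrow> u \<in> U \<Longrightarrow> br a m u \<in> U"
    using assms(3)
  proof (induction ts arbitrary: m)
    case (Cons t ts)
    have "br a t u \<in> U"
      using Cons.prems by simp
    moreover have "br a m' u \<in> U" if "m' \<in> set (subset_sums ts)" for m'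
      using Cons.IH[OF _ Cons.prems(2,3) that] Cons.prems(1) by simp
    ultimately show ?case
      using Cons.prems(4) vec.subspace_add[OF Cons.prems(2)] by (auto simp: br_add_left)
  qed (simp add: vec.subspace_0)
qed

text \<open>Every joint eigenvector outside the common kernel has eigenvalue 1 for exactly half of the subset
sums. The induction splits \<open>U\<close> into the two eigenspaces of the first element: on the 0-eigenspace
\<open>m\<close> and \<open>t + m\<close> act alike, on the 1-eigenspace the image of one is the kernel of the other.\<close>

lemma plotkin:
  assumes "\<forall>t\<in>set ts. toral_el t" "\<forall>t\<in>set ts. \<forall>t'\<in>set ts. br a t t' = 0"
    and "vec.subspace U" "\<forall>t\<in>set ts. \<forall>u\<in>U. br a t u \<in> U"
  shows "2 * (\<Sum>m\<leftarrow>subset_sums ts. vec.dim (br a m ` U)) + 2 ^ length ts * vec.dim {u \<in> U. \<forall>t\<in>set ts. br a t u = 0} =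
    2 ^ length ts * vec.dim U"
  using assms
proof (induction ts arbitrary: U)
  case Nil
  have "br a 0 ` U = {0}"
    using vec.subspace_0[OF Nil(3)] by auto
  then show ?case
    by simp
next
  case (Cons t ts)
  have tt: "br a t (br a t y) = br a t y" for y
    using Cons.prems(1) by (simp add: toral_el_def)
  note U = Cons.prems(3)
  have inv: "br a t' u \<in> U" if "t' \<in> set (t # ts)" "u \<in> U" for t' u
    using Cons.prems(4) that by blast
  define U0 where "U0 = {u \<in> U. br a t u = 0}"
  define U1 where "U1 = br a t ` U"
  have U0: "vec.subspace U0"
    unfolding U0_def using U by (auto simp: vec.subspace_def br_add_right br_scale_right)
  have U1: "vec.subspace U1"
    unfolding U1_def by (rule vec.linear_subspace_image[OF lin_br U])
  have U1_fix: "br a t u = u" if "u \<in> U1" for u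
    using that tt unfolding U1_def by auto
  have U1_sub: "U1 \<subseteq> U"
    unfolding U1_def using inv by auto
  have dimU: "vec.dim U = vec.dim U1 + vec.dim U0"
    unfolding U0_def U1_def by (rule dim_idempotent[OF lin_br U]) (use tt inv in auto)
  have split: "vec.dim (br a m ` U) = vec.dim (br a m ` U0) + vec.dim (br a m ` U1)" if "br a t m = 0" for m
  proof -
    have sw: "br a t (br a m y) = br a m (br a t y)" for y
      by (rule br_swap[OF that])
    have V: "vec.subspace (br a m ` U)"
      by (rule vec.linear_subspace_image[OF lin_br U])
    have "vec.dim (br a m ` U) = vec.dim (br a t ` br a m ` U) + vec.dim {v \<in> br a m ` U. br a t v = 0}"
      by (rule dim_idempotent[OF lin_br V]) (use tt inv sw in auto)
    moreover have "br a t ` br a m ` U = br a m ` U1"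
      unfolding U1_def by (simp add: image_image sw)
    moreover have "{v \<in> br a m ` U. br a t v = 0} = br a m ` U0"
    proof
      show "br a m ` U0 \<subseteq> {v \<in> br a m ` U. br a t v = 0}"
        unfolding U0_def by (auto simp: sw)
      show "{v \<in> br a m ` U. br a t v = 0} \<subseteq> br a m ` U0"
      proof
        fix v assume "v \<in> {v \<in> br a m ` U. br a t v = 0}"
        then obtain u where u: "u \<in> U" "v = br a m u" "br a m (br a t u) = 0"
          using sw by auto
        (* the projection of u to the kernel of ad t has the same image *)
        have "u + br a t u \<in> U0"
          unfolding U0_def using u(1) inv[of t u] vec.subspace_add[OF U] by (simp add: br_add_right tt)
        moreover have "v = br a m (u + br a t u)"
          using u by (simp add: br_add_right)
        ultimately show "v \<in> br a m ` U0"
          by blast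
      qed
    qed
    ultimately show ?thesis
      by simp
  qed
  have step: "vec.dim (br a m ` U) + vec.dim (br a (t + m) ` U) = 2 * vec.dim (br a m ` U0) + vec.dim U1"
    if m: "m \<in> set (subset_sums ts)" for m
  proof -
    have tm: "br a t m = 0"
      using subset_sums_toral(2)[OF _ _ m, of t] Cons.prems by simp
    have toral_m: "toral_el m"
      using subset_sums_toral(1)[OF _ _ m] Cons.prems by simp
    have "br a t (t + m) = 0"
      using tm by (simp add: br_add_right)
    note s2 = split[OF this]
    have "br a (t + m) ` U0 = br a m ` U0"
      unfolding U0_def by (intro image_cong) (auto simp: br_add_left)
    moreover have "vec.dim U1 = vec.dim (br a m ` U1) + vec.dim {u \<in> U1. br a m u = 0}"
    proof (rule dim_idempotent[OF lin_br U1])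
      fix u assume "u \<in> U1"
      then obtain v where "v \<in> U" "u = br a t v"
        unfolding U1_def by blast
      then show "br a m u \<in> U1"
        using br_swap[OF tm, of v] subset_sums_toral(3)[OF _ _ m, of U v] Cons.prems inv U
        unfolding U1_def by (metis image_eqI list.set_intros(2))
      show "br a m (br a m u) = br a m u"
        using toral_m by (simp add: toral_el_def)
    qed
    moreover have "br a (t + m) ` U1 = {u \<in> U1. br a m u = 0}"
    proof
      show "br a (t + m) ` U1 \<subseteq> {u \<in> U1. br a m u = 0}"
      proof
        fix v assume "v \<in> br a (t + m) ` U1"
        then obtain u where u: "u \<in> U1" "v = u + br a m u"
          by (auto simp: br_add_left U1_fix)
        have "br a m (br a m u) = br a m u"
          using toral_m by (simp add: toral_el_def)
        moreover have "br a t (br a m u) = br a m u"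
          using br_swap[OF tm, of u] U1_fix[OF u(1)] by simp
        moreover have "br a m u \<in> U"
          using subset_sums_toral(3)[OF _ _ m, of U u] Cons.prems inv U u(1) U1_sub by auto
        ultimately show "v \<in> {u \<in> U1. br a m u = 0}"
          using u U1 unfolding U1_def by (auto simp: br_add_right intro!: vec.subspace_add intro: rev_image_eqI)
      qed
      show "{u \<in> U1. br a m u = 0} \<subseteq> br a (t + m) ` U1"
        by (auto simp: br_add_left U1_fix intro: rev_image_eqI)
    qed
    ultimately show ?thesis
      using split[OF tm] s2 by simp
  qed
  have IH: "2 * (\<Sum>m\<leftarrow>subset_sums ts. vec.dim (br a m ` U0)) + 2 ^ length ts * vec.dim {u \<in> U0. \<forall>t\<in>set ts. br a t u = 0} =
    2 ^ length ts * vec.dim U0"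
  proof (rule Cons.IH[OF _ _ U0])
    show "\<forall>t'\<in>set ts. \<forall>u\<in>U0. br a t' u \<in> U0"
    proof (intro ballI)
      fix t' u assume t': "t' \<in> set ts" and u: "u \<in> U0"
      have "br a t t' = 0"
        using Cons.prems(2) t' by simp
      then show "br a t' u \<in> U0"
        using u inv[of t' u] t' br_swap[of t t' u] unfolding U0_def by simp
    qed
  qed (use Cons.prems in auto)
  have "(\<Sum>m\<leftarrow>subset_sums (t # ts). vec.dim (br a m ` U)) =
      (\<Sum>m\<leftarrow>subset_sums ts. 2 * vec.dim (br a m ` U0) + vec.dim U1)"
    unfolding sum_list_subset_sums_Cons by (intro arg_cong[of _ _ sum_list] map_cong refl step)
  also have "\<dots> = 2 * (\<Sum>m\<leftarrow>subset_sums ts. vec.dim (br a m ` U0)) + 2 ^ length ts * vec.dim U1"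
    by (simp add: sum_list_addf sum_list_const_mult sum_list_triv length_subset_sums)
  finally have s: "(\<Sum>m\<leftarrow>subset_sums (t # ts). vec.dim (br a m ` U)) =
    2 * (\<Sum>m\<leftarrow>subset_sums ts. vec.dim (br a m ` U0)) + 2 ^ length ts * vec.dim U1" .
  have "{u \<in> U. \<forall>t\<in>set (t # ts). br a t u = 0} = {u \<in> U0. \<forall>t\<in>set ts. br a t u = 0}"
    unfolding U0_def by auto
  then show ?case
    unfolding s using IH dimU by (simp add: algebra_simps)
qed

lemma subset_sums_rank:
  assumes r: "\<And>t. toral_el t \<Longrightarrow> t \<noteq> 0 \<Longrightarrow> 16 \<le> vec.dim (range (br a t))"
    and "\<forall>t\<in>set ts. toral_el t" "\<forall>t\<in>set ts. \<forall>t'\<in>set ts. br a t t' = 0"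
    and "vec.independent (set ts)" "distinct ts"
  shows "16 * (2 ^ length ts - 1) \<le> (\<Sum>m\<leftarrow>subset_sums ts. vec.dim (range (br a m)))"
  using assms(2-)
proof (induction ts)
  case (Cons t ts)
  have ind: "vec.independent (set ts)" "t \<notin> vec.span (set ts)"
    using Cons.prems(3,4) by (auto simp: vec.independent_insert)
  have big: "16 \<le> vec.dim (range (br a (t + m)))" if m: "m \<in> set (subset_sums ts)" for m
  proof (rule r)
    have "t + m \<in> set (subset_sums (t # ts))"
      using m by simp
    from subset_sums_toral(1)[OF _ _ this] show "toral_el (t + m)"
      using Cons.prems by blast
    show "t + m \<noteq> 0"
    proof
      assume "t + m = 0"
      then have "t = m"
        by (metis add.right_neutral vec_add_self(2) add.commute)
      then show False
        using ind(2) subset_sums_span[OF m] by simp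
    qed
  qed
  have "(\<Sum>m\<leftarrow>subset_sums ts. 16) \<le> (\<Sum>m\<leftarrow>subset_sums ts. vec.dim (range (br a (t + m))))"
    by (rule sum_list_mono) (rule big)
  then have "16 * 2 ^ length ts \<le> (\<Sum>m\<leftarrow>subset_sums ts. vec.dim (range (br a (t + m))))"
    by (simp add: sum_list_triv length_subset_sums)
  moreover have "16 * (2 ^ length ts - 1) \<le> (\<Sum>m\<leftarrow>subset_sums ts. vec.dim (range (br a m)))"
    using Cons ind(1) by simp
  ultimately show ?case
    unfolding sum_list_subset_sums_Cons sum_list_addf by simp
qed simp

section \<open>Ranks of toral elements are divisible by four\<close>

lemma inv_form_sym: "inv_form u v = inv_form v u"
  unfolding inv_form_def by (intro sum.cong) (auto simp: algebra_simps)

lemma inv_form_add: "inv_form (u + v) w = inv_form u w + inv_form v w" "inv_form w (u + v) = inv_form w u + inv_form w v"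
  unfolding inv_form_def by (simp_all add: algebra_simps sum.distrib)

lemma inv_form_scale: "inv_form (c *s u) w = c * inv_form u w" "inv_form w (c *s u) = c * inv_form w u"
  unfolding inv_form_def by (simp_all add: algebra_simps sum_distrib_left)

lemma inv_form_self [simp]: "inv_form u u = 0"
  unfolding inv_form_def by (intro sum.neutral) (simp add: mult.commute)

lemma inv_form_zero [simp]: "inv_form 0 u = 0" "inv_form u 0 = 0"
  unfolding inv_form_def by simp_all

lemma inv_form_axis: "inv_form (axis (r, True) 1) z = wt_form r * z $ (r, False)" "inv_form (axis (r, False) 1) z = wt_form r * z $ (r, True)"
proof -
  have "inv_form (axis (r, True) 1) z = (\<Sum>q\<in>UNIV. if q = r then wt_form r * z $ (r, False) else 0)"
    unfolding inv_form_def by (intro sum.cong) (auto simp: axis_component)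
  then show "inv_form (axis (r, True) 1) z = wt_form r * z $ (r, False)"
    by simp
  have "inv_form (axis (r, False) 1) z = (\<Sum>q\<in>UNIV. if q = r then wt_form r * z $ (r, True) else 0)"
    unfolding inv_form_def by (intro sum.cong) (auto simp: axis_component)
  then show "inv_form (axis (r, False) 1) z = wt_form r * z $ (r, True)"
    by simp
qed

end

context wk4
begin

lemma inv_form_nondegenerate:
  assumes "\<And>z. inv_form y z = 0" shows "y = 0"
proof (rule idx_zeroI, rule allI)
  fix r
  have "wt_form r \<noteq> 0"
    by (simp add: wt_form_def a_nz)
  then show "y $ (r, True) = 0 \<and> y $ (r, False) = 0"
    using assms inv_form_axis[of r y] inv_form_sym[of y] by (metis mult_eq_0_iff)
qed

text \<open>Pick \<open>y, z\<close> in the image of \<open>N\<close> that the form pairs to 1. Subtracting from \<open>N\<close> the projection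
onto their span lowers the rank by 2, and it changes the half trace by the value 1 of the form at
\<open>y, z\<close>, because the form is computed from coordinates in the symplectic basis. The hypothesis
that \<open>N y\<close> is orthogonal to \<open>y\<close> survives the subtraction.\<close>

lemma half_trace_idempotent:
  assumes "lin N" "\<And>y. N (N y) = N y" "\<And>y z. inv_form (N y) z = inv_form y (N z)" "\<And>y. inv_form (N y) y = 0"
  shows "\<exists>m. vec.dim (range N) = 2 * m \<and> (\<Sum>r\<in>UNIV. N (axis (r, True) 1) $ (r, True)) = of_nat m"
  using assms
proof (induction "vec.dim (range N)" arbitrary: N rule: less_induct)
  case less
  interpret N: Vector_Spaces.linear "(*s)" "(*s)" N by (rule less.prems(1))
  note idem = less.prems(2) and sym = less.prems(3) and alt = less.prems(4)
  show ?case
  proof (cases "\<forall>y. N y = 0")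
    case True
    then have "range N = {0}"
      by auto
    with True show ?thesis
      by (intro exI[of _ 0]) simp
  next
    case False
    then obtain y0 where y0: "N y0 \<noteq> 0"
      by blast
    define y where "y = N y0"
    obtain z0 where z0: "inv_form y z0 \<noteq> 0"
      using inv_form_nondegenerate[of y] y0 unfolding y_def[symmetric] by blast
    define z where "z = inverse (inv_form y z0) *s N z0"
    have Ny: "N y = y" and Nz: "N z = z"
      by (simp_all add: y_def z_def idem N.scale)
    have "inv_form y (N z0) = inv_form y z0"
      using sym[of y z0] Ny by simp
    then have yz: "inv_form y z = 1" and zy: "inv_form z y = 1"
      using z0 inv_form_sym[of z y] by (simp_all add: z_def inv_form_scale)
    (* N minus the projection onto the span of y and z *)
    define M where "M w = N w + (inv_form w z *s y + inv_form w y *s z)" for w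
    have lin_M: "lin M"
      by (rule linI) (simp_all add: M_def N.add N.scale inv_form_add inv_form_scale vec.scale_left_distrib vec.scale_right_distrib ac_simps)
    have bM: "inv_form (M w) z = 0" "inv_form (M w) y = 0" for w
      by (simp_all add: M_def inv_form_add inv_form_scale yz zy sym Ny Nz)
    have NM: "N (M w) = M w" for w
      by (simp add: M_def N.add N.scale idem Ny Nz)
    have MM: "M (M w) = M w" for w
      by (subst M_def) (simp add: bM NM)
    have MN: "M (N w) = M w" for w
      by (simp add: M_def idem sym Ny Nz)
    have M_sym: "inv_form (M u) v = inv_form u (M v)" for u v
      using inv_form_sym[of "N v" u] by (simp add: M_def inv_form_add inv_form_scale sym inv_form_sym[of y v] inv_form_sym[of z v] ac_simps)
    have M_alt: "inv_form (M u) u = 0" for u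
      by (simp add: M_def inv_form_add inv_form_scale alt inv_form_sym[of y u] inv_form_sym[of z u] ac_simps)
    have sub: "vec.subspace (range N)"
      using vec.linear_subspace_image[OF less.prems(1) vec.subspace_UNIV] .
    have "vec.dim (range N) = vec.dim (M ` range N) + vec.dim {u \<in> range N. M u = 0}"
      by (rule dim_idempotent[OF lin_M sub]) (metis NM rangeI, rule MM)
    moreover have "M ` range N = range M"
      by (simp add: image_image MN)
    moreover have "vec.dim {u \<in> range N. M u = 0} = 2"
    proof -
      have yz_ne: "y \<noteq> z" "y \<noteq> 0" "z \<noteq> 0"
        using yz by auto
      have "z \<notin> vec.span {y}"
      proof
        assume "z \<in> vec.span {y}"
        then obtain k where "z = k *s y"
          by (auto simp: vec.span_singleton)
        then have "inv_form y z = 0"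
          by (simp add: inv_form_scale)
        with yz show False by simp
      qed
      then have ind: "vec.independent {z, y}"
        using yz_ne by (simp add: vec.independent_insert)
      have "{u \<in> range N. M u = 0} = vec.span {z, y}"
      proof
        show "{u \<in> range N. M u = 0} \<subseteq> vec.span {z, y}"
        proof
          fix u assume "u \<in> {u \<in> range N. M u = 0}"
          then have "N u = u" "M u = 0"
            using idem by auto
          then have "u + (inv_form u z *s y + inv_form u y *s z) = 0"
            by (simp add: M_def)
          then have "u = inv_form u z *s y + inv_form u y *s z"
            by (metis add.right_neutral vec_add_self(2))
          moreover have "inv_form u z *s y + inv_form u y *s z \<in> vec.span {z, y}"
            by (intro vec.span_add vec.span_scale vec.span_base) auto
          ultimately show "u \<in> vec.span {z, y}"
            by simp
        qed
        have "M y = 0" "M z = 0"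
          by (simp_all add: M_def Ny Nz yz zy)
        moreover have "y \<in> range N" "z \<in> range N"
          using Ny Nz by (metis rangeI)+
        moreover have "vec.subspace {u. M u = 0}"
          by (rule vec.linear_subspace_kernel[OF lin_M])
        then have "vec.subspace {u \<in> range N. M u = 0}"
          using vec.subspace_inter[OF sub, of "{u. M u = 0}"] by (simp add: Int_def)
        ultimately show "vec.span {z, y} \<subseteq> {u \<in> range N. M u = 0}"
          by (intro vec.span_minimal) auto
      qed
      then show ?thesis
        using vec.dim_eq_card_independent[OF ind] yz_ne by simp
    qed
    ultimately have dims: "vec.dim (range N) = vec.dim (range M) + 2"
      by simp
    then obtain m where m: "vec.dim (range M) = 2 * m" "(\<Sum>r\<in>UNIV. M (axis (r, True) 1) $ (r, True)) = of_nat m"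
      using less.hyps[OF _ lin_M MM M_sym M_alt] by auto
    have "(\<Sum>r\<in>UNIV. M (axis (r, True) 1) $ (r, True)) =
        (\<Sum>r\<in>UNIV. N (axis (r, True) 1) $ (r, True)) + inv_form y z"
      unfolding M_def inv_form_axis inv_form_def[of y z]
      by (simp only: sum.distrib[symmetric]) (intro sum.cong refl, simp add: algebra_simps)
    then have "of_nat m + 1 = (\<Sum>r\<in>UNIV. N (axis (r, True) 1) $ (r, True)) + 1 + 1"
      unfolding m(2) yz by simp
    then have "(\<Sum>r\<in>UNIV. N (axis (r, True) 1) $ (r, True)) = of_nat m + 1"
      by (simp only: add.assoc add_self add_0_right)
    with dims m(1) show ?thesis
      by (intro exI[of _ "Suc m"]) simp
  qed
qed

lemma toral_rank_dvd_4:
  assumes "toral_el t" shows "4 dvd vec.dim (range (br a t))"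
proof -
  have "\<exists>m. vec.dim (range (br a t)) = 2 * m \<and> (\<Sum>r\<in>UNIV. br a t (axis (r, True) 1) $ (r, True)) = of_nat m"
  proof (rule half_trace_idempotent[OF lin_br])
    show "br a t (br a t y) = br a t y" for y
      using assms by (simp add: toral_el_def)
    show "inv_form (br a t y) z = inv_form y (br a t z)" for y z
      using inv_form_invariant[of y t z] br_commute[of y t] by simp
    show "inv_form (br a t y) y = 0" for y
      by (simp add: inv_form_invariant)
  qed
  then obtain m where m: "vec.dim (range (br a t)) = 2 * m" "of_nat m = (0::'k)"
    using half_trace_zero by metis
  have "2 dvd m"
    using m(2) char2 by (simp add: of_nat_eq_0_iff_char_dvd)
  then show ?thesis
    using m(1) by auto
qed

end

section \<open>Ranks of elements with a nonzero corner entry\<close>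

context wk4
begin

text \<open>A coordinate complement of the centralizer of the corner entry of \<open>X\<close>.\<close>

definition supp_X :: "idx set" where
  "supp_X = {(A12, False), (A13, False), (B12, True), (B13, True), (HP, True), (X22, True), (X23, True), (X32, True), (X33, True), (X11, False), (X12, False), (X13, False), (X21, False), (X31, False)}"

text \<open>The same set with \<open>X\<close> and \<open>Y\<close>, and upper and lower triangles, interchanged.\<close>

definition supp_Y :: "idx set" where
  "supp_Y = {(A12, True), (A13, True), (B12, False), (B13, False), (HP, True), (X22, False), (X23, False), (X32, False), (X33, False), (X11, True), (X12, True), (X13, True), (X21, True), (X31, True)}"

text \<open>The weight of the corner entry of \<open>X\<close> is a vertex of the convex hull of all weights. A linear functional
that is maximal exactly at this vertex orders the coordinates so that the equations \<open>[x, y] = 0\<close>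
become triangular, with the corner entry on the diagonal.\<close>

lemma inj_X:
  assumes lead: "x $ (X11, True) \<noteq> 0" and supp: "\<And>i. i \<notin> supp_X \<Longrightarrow> y $ i = 0" and e: "br a x y = 0"
  shows "y = 0"
proof (rule idx_zeroI)
  note nz = lead a_nz a_ne1
  have solve: "y $ k = 0" if "br a x y $ i = c * y $ k" "c \<noteq> 0" for c k i
    using that e by simp
  have s: "y $ (HP, False) = 0" "y $ (HQ, True) = 0" "y $ (HQ, False) = 0" "y $ (A12, True) = 0"
    "y $ (A13, True) = 0" "y $ (A23, True) = 0" "y $ (A23, False) = 0" "y $ (B12, False) = 0"
    "y $ (B13, False) = 0" "y $ (B23, True) = 0" "y $ (B23, False) = 0" "y $ (X11, True) = 0"
    "y $ (X12, True) = 0" "y $ (X13, True) = 0" "y $ (X21, True) = 0" "y $ (X22, False) = 0"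
    "y $ (X23, False) = 0" "y $ (X31, True) = 0" "y $ (X32, False) = 0" "y $ (X33, False) = 0"
    by (simp_all add: supp supp_X_def)
  (* each equation has a single unknown left, and its coefficient is a nonzero multiple of the corner entry *)
  have "y $ (X31, False) = 0"
    by (rule solve[where c = "x $ (X11, True)" and i = "(A13, True)"]) (simp_all add: coord_simps s nz algebra_simps)
  note s = s this
  have "y $ (X12, False) = 0"
    by (rule solve[where c = "a * x $ (X11, True)" and i = "(B12, False)"]) (simp_all add: coord_simps s nz algebra_simps)
  note s = s this
  have "y $ (X13, False) = 0"
    by (rule solve[where c = "a * x $ (X11, True)" and i = "(B13, False)"]) (simp_all add: coord_simps s nz algebra_simps)
  note s = s this
  have "y $ (HP, True) = 0"
    by (rule solve[where c = "x $ (X11, True)" and i = "(X11, True)"]) (simp_all add: coord_simps s nz algebra_simps)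
  note s = s this
  have "y $ (X23, True) = 0"
    by (rule solve[where c = "x $ (X11, True)" and i = "(X32, False)"]) (simp_all add: coord_simps s nz algebra_simps)
  note s = s this
  have "y $ (X22, True) = 0"
    by (rule solve[where c = "x $ (X11, True)" and i = "(X33, False)"]) (simp_all add: coord_simps s nz algebra_simps)
  note s = s this
  have "y $ (X21, False) = 0"
    by (rule solve[where c = "x $ (X11, True)" and i = "(A12, True)"]) (simp_all add: coord_simps s nz algebra_simps)
  note s = s this
  have "y $ (A12, False) = 0"
    by (rule solve[where c = "x $ (X11, True)" and i = "(X21, True)"]) (simp_all add: coord_simps s nz algebra_simps)
  note s = s this
  have "y $ (X33, True) = 0"
    by (rule solve[where c = "x $ (X11, True)" and i = "(X22, False)"]) (simp_all add: coord_simps s nz algebra_simps)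
  note s = s this
  have "y $ (X32, True) = 0"
    by (rule solve[where c = "x $ (X11, True)" and i = "(X23, False)"]) (simp_all add: coord_simps s nz algebra_simps)
  note s = s this
  have "y $ (A13, False) = 0"
    by (rule solve[where c = "x $ (X11, True)" and i = "(X31, True)"]) (simp_all add: coord_simps s nz algebra_simps)
  note s = s this
  have "y $ (X11, False) = 0"
    by (rule solve[where c = "x $ (X11, True)" and i = "(HP, False)"]) (simp_all add: coord_simps s nz algebra_simps)
  note s = s this
  have "y $ (B12, True) = 0"
    by (rule solve[where c = "x $ (X11, True)" and i = "(X12, True)"]) (simp_all add: coord_simps s nz algebra_simps)
  note s = s this
  have "y $ (B13, True) = 0"
    by (rule solve[where c = "x $ (X11, True)" and i = "(X13, True)"]) (simp_all add: coord_simps s nz algebra_simps)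
  note s = s this
  show "\<forall>r. y $ (r, True) = 0 \<and> y $ (r, False) = 0"
    unfolding all_root_pair by (simp add: s)
qed

lemma inj_Y:
  assumes lead: "x $ (X11, False) \<noteq> 0" and supp: "\<And>i. i \<notin> supp_Y \<Longrightarrow> y $ i = 0" and e: "br a x y = 0"
  shows "y = 0"
proof (rule idx_zeroI)
  note nz = lead a_nz a_ne1
  have solve: "y $ k = 0" if "br a x y $ i = c * y $ k" "c \<noteq> 0" for c k i
    using that e by simp
  have s: "y $ (HP, False) = 0" "y $ (HQ, True) = 0" "y $ (HQ, False) = 0" "y $ (A12, False) = 0"
    "y $ (A13, False) = 0" "y $ (A23, True) = 0" "y $ (A23, False) = 0" "y $ (B12, True) = 0"
    "y $ (B13, True) = 0" "y $ (B23, True) = 0" "y $ (B23, False) = 0" "y $ (X11, False) = 0"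
    "y $ (X12, False) = 0" "y $ (X13, False) = 0" "y $ (X21, False) = 0" "y $ (X22, True) = 0"
    "y $ (X23, True) = 0" "y $ (X31, False) = 0" "y $ (X32, True) = 0" "y $ (X33, True) = 0"
    by (simp_all add: supp supp_Y_def)
  (* each equation has a single unknown left, and its coefficient is a nonzero multiple of the corner entry *)
  have "y $ (X31, True) = 0"
    by (rule solve[where c = "x $ (X11, False)" and i = "(A13, False)"]) (simp_all add: coord_simps s nz algebra_simps)
  note s = s this
  have "y $ (X12, True) = 0"
    by (rule solve[where c = "a * x $ (X11, False)" and i = "(B12, True)"]) (simp_all add: coord_simps s nz algebra_simps)
  note s = s this
  have "y $ (X13, True) = 0"
    by (rule solve[where c = "a * x $ (X11, False)" and i = "(B13, True)"]) (simp_all add: coord_simps s nz algebra_simps)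
  note s = s this
  have "y $ (HP, True) = 0"
    by (rule solve[where c = "x $ (X11, False)" and i = "(X11, False)"]) (simp_all add: coord_simps s nz algebra_simps)
  note s = s this
  have "y $ (X23, False) = 0"
    by (rule solve[where c = "(1 + a) * x $ (X11, False)" and i = "(X32, True)"]) (simp_all add: coord_simps s nz algebra_simps)
  note s = s this
  have "y $ (X22, False) = 0"
    by (rule solve[where c = "(1 + a) * x $ (X11, False)" and i = "(X33, True)"]) (simp_all add: coord_simps s nz algebra_simps)
  note s = s this
  have "y $ (X21, True) = 0"
    by (rule solve[where c = "x $ (X11, False)" and i = "(A12, False)"]) (simp_all add: coord_simps s nz algebra_simps)
  note s = s this
  have "y $ (A12, True) = 0"
    by (rule solve[where c = "x $ (X11, False)" and i = "(X21, False)"]) (simp_all add: coord_simps s nz algebra_simps)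
  note s = s this
  have "y $ (X33, False) = 0"
    by (rule solve[where c = "(1 + a) * x $ (X11, False)" and i = "(X22, True)"]) (simp_all add: coord_simps s nz algebra_simps)
  note s = s this
  have "y $ (X32, False) = 0"
    by (rule solve[where c = "(1 + a) * x $ (X11, False)" and i = "(X23, True)"]) (simp_all add: coord_simps s nz algebra_simps)
  note s = s this
  have "y $ (A13, True) = 0"
    by (rule solve[where c = "x $ (X11, False)" and i = "(X31, False)"]) (simp_all add: coord_simps s nz algebra_simps)
  note s = s this
  have "y $ (X11, True) = 0"
    by (rule solve[where c = "x $ (X11, False)" and i = "(HP, False)"]) (simp_all add: coord_simps s nz algebra_simps)
  note s = s this
  have "y $ (B12, False) = 0"
    by (rule solve[where c = "x $ (X11, False)" and i = "(X12, False)"]) (simp_all add: coord_simps s nz algebra_simps)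
  note s = s this
  have "y $ (B13, False) = 0"
    by (rule solve[where c = "x $ (X11, False)" and i = "(X13, False)"]) (simp_all add: coord_simps s nz algebra_simps)
  note s = s this
  show "\<forall>r. y $ (r, True) = 0 \<and> y $ (r, False) = 0"
    unfolding all_root_pair by (simp add: s)
qed

lemma rank_ge_card:
  assumes "\<And>y. (\<And>i. i \<notin> S \<Longrightarrow> y $ i = 0) \<Longrightarrow> br a x y = 0 \<Longrightarrow> y = 0"
  shows "card S \<le> vec.dim (range (br a x))"
proof -
  let ?U = "{y :: 'k ^ idx. \<forall>i. i \<notin> S \<longrightarrow> y $ i = 0}"
  have sub: "vec.subspace ?U"
    by (auto simp: vec.subspace_def)
  then have span: "vec.span ?U = ?U"
    by (simp only: vec.span_eq_iff)
  interpret N: Vector_Spaces.linear "(*s)" "(*s)" "br a x"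
    by (rule lin_br)
  have "inj_on (br a x) (vec.span ?U)"
    unfolding span N.inj_on_iff_eq_0[OF sub] using assms by blast
  from vec.dim_image_eq[OF lin_br this] have "vec.dim (br a x ` ?U) = card S"
    by (simp only: dim_substandard_cart)
  then show ?thesis
    using vec.dim_subset[of "br a x ` ?U" "range (br a x)"] by auto
qed

lemma rank_X11: "x $ (X11, True) \<noteq> 0 \<Longrightarrow> 14 \<le> vec.dim (range (br a x))"
  using rank_ge_card[of supp_X x] inj_X[of x] by (simp add: supp_X_def)

lemma rank_Y11: "x $ (X11, False) \<noteq> 0 \<Longrightarrow> 14 \<le> vec.dim (range (br a x))"
  using rank_ge_card[of supp_Y x] inj_Y[of x] by (simp add: supp_Y_def)

section \<open>Automorphisms and conjugacy of toral elements\<close>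

text \<open>The adjugate matrix, without signs as the characteristic is 2.\<close>

definition adj :: "'k mat3 \<Rightarrow> 'k mat3" where
  "adj A = Mat3
    (m22 A * m33 A + m23 A * m32 A) (m13 A * m32 A + m12 A * m33 A) (m12 A * m23 A + m13 A * m22 A)
    (m23 A * m31 A + m21 A * m33 A) (m11 A * m33 A + m13 A * m31 A) (m13 A * m21 A + m11 A * m23 A)
    (m21 A * m32 A + m22 A * m31 A) (m12 A * m31 A + m11 A * m32 A) (m11 A * m22 A + m12 A * m21 A)"

lemma cross_mult_adj_left: "cross (C * X) (C * Y) = cross X Y * adj C"
  by (simp add: mat3_defs adj_def algebra_simps)

lemma cross_mult_adj_right: "cross (X * C) (Y * C) = adj C * cross X Y"
  by (simp add: mat3_defs adj_def algebra_simps)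

text \<open>A matrix of determinant 1 and its inverse, which is also its adjugate.\<close>

definition sl_pair :: "'k mat3 \<Rightarrow> 'k mat3 \<Rightarrow> bool" where
  "sl_pair C D \<longleftrightarrow> C * D = 1 \<and> D * C = 1 \<and> adj C = D \<and> adj D = C"

definition act :: "'k mat3 \<Rightarrow> 'k mat3 \<Rightarrow> 'k mat3 \<Rightarrow> 'k mat3 \<Rightarrow> 'k ^ idx \<Rightarrow> 'k ^ idx" where
  "act C D B G x = mk (C * (mP x * D)) (B * (mQ x * G)) (C * (mX x * G)) (B * (mY x * D))"

lemma sl_pair_cancel:
  assumes "sl_pair C D" shows "C * (D * A) = A" "D * (C * A) = A"
  using assms unfolding sl_pair_def by (simp_all add: mult.assoc[symmetric])

lemma mtrace_conj: "sl_pair C D \<Longrightarrow> mtrace (C * (A * D)) = mtrace A"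
  using mtrace_commute[of C "A * D"] by (simp add: mult.assoc sl_pair_def)

lemma views_act:
  assumes "sl_pair C D" "sl_pair B G"
  shows "mP (act C D B G x) = C * (mP x * D)" "mQ (act C D B G x) = B * (mQ x * G)"
    "mX (act C D B G x) = C * (mX x * G)" "mY (act C D B G x) = B * (mY x * D)"
  unfolding act_def by (rule views_mk; simp add: mtrace_conj assms)+

lemma trfree_conj:
  assumes "sl_pair C D" shows "trfree (C * (A * D)) = C * (trfree A * D)"
  using assms mtrace_conj[OF assms, of A] by (simp add: trfree_def distrib_left distrib_right mscale_simps sl_pair_def)

text \<open>The group \<open>SL\<^sub>3 \<times> SL\<^sub>3\<close> acts by automorphisms because the adjugate is antimultiplicative.\<close>

lemma act_br:
  assumes "sl_pair C D" "sl_pair B G"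
  shows "br a (act C D B G x) (act C D B G y) = act C D B G (br a x y)"
proof -
  have 1: "adj C = D" "adj G = B" "adj B = G" "adj D = C"
    using assms by (auto simp: sl_pair_def)
  have tf1: "trfree (C * (A1 * (A2 * D))) = C * (trfree (A1 * A2) * D)" for A1 A2
    using trfree_conj[OF assms(1), of "A1 * A2"] by (simp add: mult.assoc)
  have tf2: "trfree (B * (A1 * (A2 * G))) = B * (trfree (A1 * A2) * G)" for A1 A2
    using trfree_conj[OF assms(2), of "A1 * A2"] by (simp add: mult.assoc)
  show ?thesis
    by (rule views_eqI)
      (simp_all add: views_act[OF assms] br_defs cross_mult_adj_left cross_mult_adj_right 1 tf1 tf2 mult.assoc
        sl_pair_cancel[OF assms(1)] sl_pair_cancel[OF assms(2)] distrib_left distrib_right mscale_simps)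
qed

lemma sl_pair_sym: "sl_pair C D \<Longrightarrow> sl_pair D C"
  by (simp add: sl_pair_def)

lemma act_inverse:
  assumes "sl_pair C D" "sl_pair B G" shows "act D C G B (act C D B G x) = x"
  by (rule views_eqI)
    (simp_all add: views_act assms sl_pair_sym mult.assoc sl_pair_cancel[OF assms(1)] sl_pair_cancel[OF assms(2)]
       assms[unfolded sl_pair_def])

lemma lin_act: 
  assumes "sl_pair C D" "sl_pair B G" shows "lin (act C D B G)"
  by (rule linI; rule views_eqI)
    (simp_all add: views_act[OF assms] views_linear distrib_left distrib_right mscale_simps)

lemma rank_act:
  assumes "sl_pair C D" "sl_pair B G"
  shows "vec.dim (range (br a (act C D B G x))) = vec.dim (range (br a x))"
proof -
  have surj: "range (act C D B G) = UNIV"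
    using act_inverse[OF sl_pair_sym[OF assms(1)] sl_pair_sym[OF assms(2)]] by (metis surjI)
  have "range (br a (act C D B G x)) = br a (act C D B G x) ` range (act C D B G)"
    by (simp only: surj)
  also have "\<dots> = act C D B G ` range (br a x)"
    by (simp add: image_image act_br[OF assms])
  finally show ?thesis
    using vec.dim_image_eq[OF lin_act[OF assms], of "range (br a x)"] act_inverse[OF assms]
    by (metis injI inj_on_subset subset_UNIV)
qed

end

context wk4
begin

text \<open>The cyclic permutation matrices have determinant 1 and move any row or column to the first place.\<close>

definition cyc :: "'k mat3" where "cyc = Mat3 0 1 0 0 0 1 1 0 0"
definition cyc' :: "'k mat3" where "cyc' = Mat3 0 0 1 1 0 0 0 1 0"

lemma sl_pair_cyc: "sl_pair 1 1" "sl_pair cyc cyc'" "sl_pair cyc' cyc"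
  by (simp_all add: sl_pair_def adj_def cyc_def cyc'_def mat3_defs)

definition mdet :: "'k mat3 \<Rightarrow> 'k" where
  "mdet A = m11 A * (m22 A * m33 A + m23 A * m32 A) + m12 A * (m21 A * m33 A + m23 A * m31 A) +
     m13 A * (m21 A * m32 A + m22 A * m31 A)"

lemma mult_adj: "A * adj A = mscale (mdet A) 1" "adj A * A = mscale (mdet A) 1" "adj (adj A) = mscale (mdet A) A"
  by (simp_all add: mat3_defs adj_def mdet_def algebra_simps)

lemma sl_pair_adj: "mdet A = 1 \<Longrightarrow> sl_pair A (adj A)"
  by (simp add: sl_pair_def mult_adj mscale_simps)

lemma sl_pair_mult: "sl_pair A B \<Longrightarrow> sl_pair C D \<Longrightarrow> sl_pair (A * C) (D * B)"
proof -
  assume 1: "sl_pair A B" and 2: "sl_pair C D"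
  have "adj (X * Y) = adj Y * adj X" for X Y :: "'k mat3"
    by (simp add: mat3_defs adj_def algebra_simps)
  then show ?thesis
    using 1 2 sl_pair_cancel[OF 1] sl_pair_cancel[OF 2] by (simp add: sl_pair_def mult.assoc)
qed

lemma move_corner:
  assumes "Z \<noteq> (0 :: 'k mat3)"
  obtains C D B G where "sl_pair C D" "sl_pair B G" "m11 (C * (Z * G)) \<noteq> 0"
proof -
  have "m11 Z \<noteq> 0 \<or> m12 Z \<noteq> 0 \<or> m13 Z \<noteq> 0 \<or> m21 Z \<noteq> 0 \<or> m22 Z \<noteq> 0 \<or> m23 Z \<noteq> 0 \<or>
    m31 Z \<noteq> 0 \<or> m32 Z \<noteq> 0 \<or> m33 Z \<noteq> 0"
    using assms by (simp add: mat3_eq_iff zero_mat3_def)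
  moreover have "m11 (1 * (Z * 1)) = m11 Z" "m11 (1 * (Z * cyc')) = m12 Z" "m11 (1 * (Z * cyc)) = m13 Z"
    "m11 (cyc * (Z * 1)) = m21 Z" "m11 (cyc * (Z * cyc')) = m22 Z" "m11 (cyc * (Z * cyc)) = m23 Z"
    "m11 (cyc' * (Z * 1)) = m31 Z" "m11 (cyc' * (Z * cyc')) = m32 Z" "m11 (cyc' * (Z * cyc)) = m33 Z"
    by (simp_all add: cyc_def cyc'_def mat3_defs)
  ultimately show ?thesis
    using that sl_pair_cyc by metis
qed

lemma rank_off_diagonal:
  assumes "mX x \<noteq> 0 \<or> mY x \<noteq> 0" shows "14 \<le> vec.dim (range (br a x))"
  using assms
proof
  assume "mX x \<noteq> 0"
  then obtain C D B G where *: "sl_pair C D" "sl_pair B G" "m11 (C * (mX x * G)) \<noteq> 0"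
    by (rule move_corner)
  then have "m11 (mX (act C D B G x)) \<noteq> 0"
    by (simp add: views_act)
  then have "act C D B G x $ (X11, True) \<noteq> 0"
    by (simp add: mX_def)
  from rank_X11[OF this] show ?thesis
    by (simp add: rank_act *)
next
  assume "mY x \<noteq> 0"
  then obtain B G C D where *: "sl_pair B G" "sl_pair C D" "m11 (B * (mY x * D)) \<noteq> 0"
    by (rule move_corner)
  then have "m11 (mY (act C D B G x)) \<noteq> 0"
    by (simp add: views_act)
  then have "act C D B G x $ (X11, False) \<noteq> 0"
    by (simp add: mY_def)
  from rank_Y11[OF this] show ?thesis
    by (simp add: rank_act *)
qed

definition diag011 :: "'k mat3" where "diag011 = Mat3 0 0 0 0 1 0 0 0 1"

text \<open>An idempotent \<open>R\<close> of trace 1 other than the identity has rank 1: its adjugate is a scalar matrix by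
the Cayley-Hamilton theorem, and the scalar vanishes, since otherwise \<open>R\<close> were scalar and hence the identity. If its corner entry is
nonzero, \<open>R\<close> is the product of its first column and its first row, up to this entry, and the matrix
\<open>C\<close> with the first row of \<open>R\<close> and two rows that annihilate the first column conjugates \<open>R\<close>
to the matrix unit in the corner.\<close>

lemma idempotent_corner:
  assumes R: "R * R = R" "mtrace R = 1" "R \<noteq> (1 :: 'k mat3)" "m11 R \<noteq> 0"
  obtains C D where "sl_pair C D" "C * ((1 + R) * D) = diag011"
proof -
  (* the second coefficient of the characteristic polynomial *)
  define e2 where "e2 = m11 R * m22 R + m12 R * m21 R + m11 R * m33 R + m13 R * m31 R + m22 R * m33 R + m23 R * m32 R"
  have "adj R = R * R + mscale (mtrace R) R + mscale e2 1"
    by (simp add: e2_def mat3_defs adj_def algebra_simps)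
  then have adjR: "adj R = mscale e2 1"
    by (simp add: R mscale_simps)
  have "e2 = 0"
  proof (rule ccontr)
    assume e2: "e2 \<noteq> 0"
    have "mscale e2 R = mscale (mdet R) 1"
      using mult_adj(1)[of R] by (simp add: adjR mscale_simps)
    then have "mscale (inverse e2) (mscale e2 R) = mscale (inverse e2) (mscale (mdet R) 1)"
      by simp
    then have Rc: "R = mscale (inverse e2 * mdet R) 1"
      using e2 by (simp add: mscale_simps)
    then have "inverse e2 * mdet R = 1"
      using R(2) by (metis mult.right_neutral mtrace_one mtrace_simps(2))
    then show False
      using Rc R(3) by (simp add: mscale_simps)
  qed
  then have minors: "adj R = 0"
    by (simp add: adjR mscale_simps)
  let ?r = "m11 R"
  define C where "C = Mat3 ?r (m12 R) (m13 R) (m21 R / ?r) 1 0 (m31 R / ?r) 0 1"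
  have mn: "m12 R * m21 R = ?r * m22 R" "m13 R * m31 R = ?r * m33 R" "m13 R * m21 R = ?r * m23 R"
    "m12 R * m31 R = ?r * m32 R"
    using minors by (simp_all add: adj_def zero_mat3_def)
  have "mdet C = ?r + m12 R * m21 R / ?r + m13 R * m31 R / ?r"
    by (simp add: C_def mdet_def)
  also have "\<dots> = mtrace R"
    unfolding mn using R(4) by (simp add: mtrace_def)
  finally have sl: "sl_pair C (adj C)"
    using R(2) by (intro sl_pair_adj) simp
  have R1: "m11 R * m11 R + m12 R * m21 R + m13 R * m31 R = m11 R"
    "m11 R * m12 R + m12 R * m22 R + m13 R * m32 R = m12 R"
    "m11 R * m13 R + m12 R * m23 R + m13 R * m33 R = m13 R"
    using R(1) unfolding mat3_eq_iff by (simp_all add: times_mat3_def)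
  have row: "m21 R / ?r * m11 R = m21 R" "m21 R / ?r * m12 R = m22 R" "m21 R / ?r * m13 R = m23 R"
    "m31 R / ?r * m11 R = m31 R" "m31 R / ?r * m12 R = m32 R" "m31 R / ?r * m13 R = m33 R"
    using mn R(4) by (simp_all add: field_simps)
  have "C * R = (1 + diag011) * C"
    unfolding mat3_eq_iff using R1 row
    by (simp add: C_def diag011_def times_mat3_def plus_mat3_def one_mat3_def)
  then have "C * (1 + R) = diag011 * C"
    by (simp add: distrib_left distrib_right)
  then have "C * ((1 + R) * adj C) = diag011 * (C * adj C)"
    by (simp add: mult.assoc[symmetric])
  then have "C * ((1 + R) * adj C) = diag011"
    using sl by (simp add: sl_pair_def)
  with sl show ?thesis
    using that by blast
qed

lemma idempotent_conj:
  assumes P: "P * P = P" "mtrace P = 0"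
  obtains C D where "sl_pair C D" "C * (P * D) \<in> {0, diag011 :: 'k mat3}"
proof (cases "P = 0")
  case True
  then show ?thesis
    using that[OF sl_pair_cyc(1)] by simp
next
  case False
  note result = that
  define R where "R = 1 + P"
  have PR: "P = 1 + R"
    by (simp add: R_def)
  have R: "R * R = R" "mtrace R = 1" "R \<noteq> 1"
    using P False by (simp_all add: R_def distrib_left distrib_right mtrace_simps mtrace_one)
  have *: ?thesis if sl: "sl_pair A B" and nz: "m11 (A * (R * B)) \<noteq> 0" for A B
  proof -
    have BA: "B * (A * Z) = Z" for Z
      using sl_pair_cancel[OF sl] by simp
    have "(A * (R * B)) * (A * (R * B)) = A * (R * B)"
      using R(1) by (simp add: mult.assoc BA) (simp add: mult.assoc[symmetric])
    moreover have "mtrace (A * (R * B)) = 1"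
      using mtrace_conj[OF sl] R(2) by simp
    moreover have "A * (R * B) \<noteq> 1"
    proof
      assume "A * (R * B) = 1"
      then have "B * ((A * (R * B)) * A) = B * A"
        by simp
      then show False
        using R(3) sl by (simp add: mult.assoc BA sl_pair_def)
    qed
    ultimately obtain C D where CD: "sl_pair C D" "C * ((1 + A * (R * B)) * D) = diag011"
      using idempotent_corner nz by metis
    have "1 + A * (R * B) = A * (P * B)"
      using sl by (simp add: PR distrib_left distrib_right sl_pair_def)
    then have "(C * A) * (P * (B * D)) = diag011"
      using CD(2) by (simp add: mult.assoc)
    then show ?thesis
      using result[OF sl_pair_mult[OF CD(1) sl]] by simp
  qed
  have "m11 R + m22 R + m33 R = 1"
    using R(2) by (simp add: mtrace_def)
  then have "m11 R \<noteq> 0 \<or> m22 R \<noteq> 0 \<or> m33 R \<noteq> 0"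
    by auto
  moreover have "m11 (1 * (R * 1)) = m11 R" "m11 (cyc * (R * cyc')) = m22 R" "m11 (cyc' * (R * cyc)) = m33 R"
    by (simp_all add: cyc_def cyc'_def mat3_defs)
  ultimately show ?thesis
    using * sl_pair_cyc by metis
qed

lemma rank_cartan:
  assumes c: "cartan x" and S: "\<forall>r\<in>S. root_value x r \<noteq> 0"
  shows "2 * card S \<le> vec.dim (range (br a x))"
proof -
  have "card (S \<times> (UNIV :: bool set)) \<le> vec.dim (range (br a x))"
  proof (rule rank_ge_card)
    fix y assume y: "\<And>i. i \<notin> S \<times> (UNIV :: bool set) \<Longrightarrow> y $ i = 0" "br a x y = 0"
    have "y $ i = 0" for i
    proof (cases "fst i \<in> S")
      case True
      have "root_value x (fst i) * y $ i = 0"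
        using arg_cong[OF y(2), of "\<lambda>v. v $ i"] unfolding br_cartan[OF c] by simp
      then show ?thesis
        using S True by auto
    next
      case False
      then show ?thesis
        using y(1)[of i] by (cases i) auto
    qed
    then show "y = 0"
      by (simp add: Finite_Cartesian_Product.vec_eq_iff del: split_paired_All)
  qed
  then show ?thesis
    by (simp add: card_cartesian_product)
qed

lemma rank_diagonal:
  assumes "mP x \<in> {0, diag011}" "mQ x \<in> {0, diag011}" "mX x = 0" "mY x = 0" "x \<noteq> 0"
  shows "16 \<le> vec.dim (range (br a x))"
proof -
  have c: "cartan x"
  proof -
    have "r = HP \<or> r = HQ \<or> x $ (r, True) = 0 \<and> x $ (r, False) = 0" for r
      using assms by (cases r) (auto simp: mP_def mQ_def mX_def mY_def diag011_def zero_mat3_def)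
    then show ?thesis
      unfolding cartan_def by (metis (full_types))
  qed
  have "mP x = diag011 \<and> mQ x = 0 \<or> mP x = 0 \<and> mQ x = diag011 \<or> mP x = diag011 \<and> mQ x = diag011"
    using assms views_eqI[of x 0] by (auto simp: views_linear)
  then consider "mP x = diag011" "mQ x = 0" | "mP x = 0" "mQ x = diag011" | "mP x = diag011" "mQ x = diag011"
    by blast
  then show ?thesis
  proof cases
    case 1
    have "\<forall>r\<in>{A12, A13, X21, X22, X23, X31, X32, X33}. root_value x r \<noteq> 0"
      using 1 by (auto simp: mP_def mQ_def diag011_def zero_mat3_def)
    from rank_cartan[OF c this] show ?thesis by simp
  next
    case 2
    have "\<forall>r\<in>{B12, B13, X12, X22, X32, X13, X23, X33}. root_value x r \<noteq> 0"
      using 2 by (auto simp: mP_def mQ_def diag011_def zero_mat3_def)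
    from rank_cartan[OF c this] show ?thesis by simp
  next
    case 3
    have "\<forall>r\<in>{A12, A13, B12, B13, X12, X13, X21, X31}. root_value x r \<noteq> 0"
      using 3 by (auto simp: mP_def mQ_def diag011_def zero_mat3_def)
    from rank_cartan[OF c this] show ?thesis by simp
  qed
qed

text \<open>If the \<open>X\<close> and \<open>Y\<close> parts vanish, the square of \<open>t\<close> is \<open>(P\<^sup>2, Q\<^sup>2, 0, 0)\<close>, so \<open>P\<close> and \<open>Q\<close> are idempotent.\<close>

lemma rank_toral_el:
  assumes center: "\<And>x. (\<And>y. br a x y = 0) \<Longrightarrow> x = 0" and t: "toral_el t" "t \<noteq> 0"
  shows "16 \<le> vec.dim (range (br a t))"
proof (cases "mX t = 0 \<and> mY t = 0")
  case False
  then have "14 \<le> vec.dim (range (br a t))"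
    using rank_off_diagonal by blast
  moreover obtain k where "vec.dim (range (br a t)) = 4 * k"
    using toral_rank_dvd_4[OF t(1)] by (elim dvdE)
  ultimately show ?thesis
    by simp
next
  case True
  have mtrace_sq: "mtrace (A * A) = mtrace A * mtrace A" for A :: "'k mat3"
    by (simp add: mat3_defs algebra_simps)
  define z where "z = mk (mP t * mP t) (mQ t * mQ t) 0 0"
  have vz: "mP z = mP t * mP t" "mQ z = mQ t * mQ t" "mX z = 0" "mY z = 0"
    unfolding z_def by (rule views_mk; simp add: mtrace_sq)+
  have "br a z y = br a t (br a t y)" for y
    by (rule views_eqI) (simp_all add: br_defs vz True mult.assoc distrib_left distrib_right trfree_simps cross_simps mscale_simps ac_simps)
  then have zt: "br a z y = br a t y" for y
    using t(1) by (simp add: toral_el_def)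
  have "z + t = 0"
    by (rule center) (simp add: br_add_left zt)
  then have "z = t"
    using vec_add_self(2)[of t z] by (simp add: add.commute)
  then have P: "mP t * mP t = mP t" and Q: "mQ t * mQ t = mQ t"
    using vz by simp_all
  obtain C D where CD: "sl_pair C D" "C * (mP t * D) \<in> {0, diag011}"
    using idempotent_conj[OF P] by auto
  obtain B G where BG: "sl_pair B G" "B * (mQ t * G) \<in> {0, diag011}"
    using idempotent_conj[OF Q] by auto
  have "act C D B G t \<noteq> 0"
  proof
    assume "act C D B G t = 0"
    then have "t = act D C G B 0"
      using act_inverse[OF CD(1) BG(1), of t] by simp
    also have "\<dots> = 0"
      by (rule views_eqI) (simp_all add: views_act CD BG sl_pair_sym views_linear)
    finally show False
      using t(2) by simp
  qed
  then have "16 \<le> vec.dim (range (br a (act C D B G t)))"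
    using CD BG True by (intro rank_diagonal) (simp_all add: views_act)
  then show ?thesis
    by (simp add: rank_act CD BG)
qed

end

section \<open>Tori of the model\<close>

locale wk4_two_map = wk4 a for a :: "'k::alg_closed_field" +
  fixes s :: "'k ^ idx \<Rightarrow> 'k ^ idx"
  assumes s_add: "s (x + y) = s x + s y + br a x y"
    and s_scale: "s (c *s x) = c\<^sup>2 *s s x"
    and ad_s: "br a (s x) y = br a x (br a x y)"
    and center: "(\<And>y. br a x y = 0) \<Longrightarrow> x = 0"
begin

definition is_torus :: "('k ^ idx) set \<Rightarrow> bool" where
  "is_torus T \<longleftrightarrow> vec.subspace T \<and> (\<forall>x\<in>T. \<forall>y\<in>T. br a x y \<in> T) \<and> bij_betw s T T"

lemma s_zero [simp]: "s 0 = 0"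
  using s_scale[of 0 0] by simp

lemma toral_fixed: "s t = t \<Longrightarrow> toral_el t"
  unfolding toral_el_def using ad_s[of t] by metis

text \<open>The iterated squares of one element span an abelian subalgebra, on which squaring is therefore additive.\<close>

lemma s_pow_commute: "br a ((s ^^ i) x) ((s ^^ j) x) = 0"
proof -
  have 1: "br a x ((s ^^ j) x) = 0" for j
  proof (induction j)
    case (Suc j)
    have "br a ((s ^^ Suc j) x) x = br a ((s ^^ j) x) (br a ((s ^^ j) x) x)"
      by (simp add: ad_s)
    also have "\<dots> = 0"
      using Suc br_commute by (metis br_zero(2))
    finally show ?case
      by (metis br_commute)
  qed simp
  show ?thesis
  proof (induction i)
    case 0
    show ?case using 1 by simp
  next
    case (Suc i)
    then show ?case by (simp add: ad_s)
  qed
qed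

lemma br_span:
  assumes "\<And>x y. x \<in> A \<Longrightarrow> y \<in> B \<Longrightarrow> br a x y = 0" "x \<in> vec.span A" "y \<in> vec.span B"
  shows "br a x y = 0"
proof -
  have 1: "br a x y = 0" if "x \<in> vec.span A" "y \<in> B" for x y
    using that(1) by (induction rule: vec.span_induct_alt) (simp_all add: br_add_left br_scale_left assms(1) that(2))
  show ?thesis
    using assms(3) by (induction rule: vec.span_induct_alt) (simp_all add: br_add_right br_scale_right 1 assms(2))
qed

lemma s_span:
  assumes "\<And>x y. x \<in> A \<Longrightarrow> y \<in> A \<Longrightarrow> br a x y = 0" "x \<in> vec.span A"
  shows "s x \<in> vec.span (s ` A)"
proof -
  have "x \<in> vec.span A \<and> s x \<in> vec.span (s ` A)"
    using assms(2)
  proof (induction rule: vec.span_induct_alt)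
    case base
    show ?case by (simp add: vec.span_zero)
  next
    case (step c x y)
    have "br a x y = 0"
      using br_span[OF assms(1) vec.span_base[OF step(1)], of A y] step(2) by blast
    then have "s (c *s x + y) = c\<^sup>2 *s s x + s y"
      by (simp add: s_add s_scale br_scale_left)
    moreover have "c\<^sup>2 *s s x + s y \<in> vec.span (s ` A)"
      using step by (intro vec.span_add vec.span_scale vec.span_base[of "s x"]) auto
    moreover have "c *s x + y \<in> vec.span A"
      using step by (intro vec.span_add vec.span_scale vec.span_base[of x]) auto
    ultimately show ?case by simp
  qed
  then show ?thesis ..
qed

text \<open>Both statements come from the abelian subalgebra spanned by the iterated squares of \<open>x\<close>, to which the theorem
on semilinear maps applies. In the second one only proper squares occur, since a toral element is its
own square.\<close>

lemma torus_element_span: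
  assumes T: "is_torus T" and x: "x \<in> T"
  shows "x \<in> vec.span {t \<in> T. s t = t}" and "x \<in> vec.span (range (\<lambda>i. (s ^^ Suc i) x))"
proof -
  define A where "A = range (\<lambda>i. (s ^^ i) x)"
  have subT: "vec.subspace T" and bij: "bij_betw s T T"
    using T by (simp_all add: is_torus_def)
  have powT: "(s ^^ i) x \<in> T" for i
    using x bij by (induction i) (auto simp: bij_betw_def)
  have ST: "vec.span A \<subseteq> T"
    unfolding A_def using powT by (intro vec.span_minimal[OF _ subT]) auto
  have sA: "s ` A = range (\<lambda>i. (s ^^ Suc i) x)"
    unfolding A_def by (simp add: image_image)
  have "s ` A \<subseteq> A"
    unfolding sA unfolding A_def by blast
  have comm: "br a y z = 0" if "y \<in> A" "z \<in> A" for y z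
    using that s_pow_commute unfolding A_def by blast
  have "vec.span {t \<in> vec.span A. s t = t} = vec.span A"
  proof (rule semilinear_fixed_span)
    show "\<exists>x. poly p x = 0" if "degree p > 0" for p :: "'k poly"
      using alg_closed_imp_poly_has_root[OF that] .
    show "vec.subspace (vec.span A)"
      by (rule vec.subspace_span)
    show "s y \<in> vec.span A" if "y \<in> vec.span A" for y
      using s_span[OF comm that] vec.span_mono[OF \<open>s ` A \<subseteq> A\<close>] by blast
    show "s (y + z) = s y + s z" if "y \<in> vec.span A" "z \<in> vec.span A" for y z
      using br_span[OF comm that] by (simp add: s_add)
    show "s (c *s y) = c\<^sup>2 *s s y" for c y
      by (rule s_scale)
    show "y = 0" if "y \<in> vec.span A" "s y = 0" for y
      using bij that ST vec.subspace_0[OF subT] unfolding bij_betw_def inj_on_def by (metis s_zero subsetD)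
  qed
  moreover have xA: "x \<in> vec.span A"
    unfolding A_def by (rule vec.span_base) (metis funpow_0 rangeI)
  ultimately have x': "x \<in> vec.span {t \<in> vec.span A. s t = t}"
    by simp
  have "{t \<in> vec.span A. s t = t} \<subseteq> {t \<in> T. s t = t}"
    using ST by auto
  from vec.span_mono[OF this] x' show "x \<in> vec.span {t \<in> T. s t = t}"
    by blast
  have "{t \<in> vec.span A. s t = t} \<subseteq> vec.span (s ` A)"
    using s_span[OF comm] by force
  from vec.span_minimal[OF this vec.subspace_span] x' show "x \<in> vec.span (range (\<lambda>i. (s ^^ Suc i) x))"
    unfolding sA by blast
qed

text \<open>The element \<open>y = [t, x]\<close> satisfies \<open>[t, y] = y\<close>, so its square commutes with \<open>t\<close>, as \<open>[y, [y, t]] = 0\<close>.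
As \<open>y\<close> is a combination of its iterated squares it commutes with \<open>t\<close> as well, so it is zero.\<close>

lemma torus_toral_central:
  assumes T: "is_torus T" and t: "t \<in> T" "s t = t" and x: "x \<in> T"
  shows "br a t x = 0"
proof -
  define y where "y = br a t x"
  have y: "y \<in> T"
    using T t x by (simp add: is_torus_def y_def)
  have ty: "br a t y = y"
    using ad_s[of t x] t(2) by (simp add: y_def)
  have "br a t ((s ^^ Suc i) y) = 0" for i
  proof (induction i)
    case 0
    have "br a (s y) t = br a y (br a y t)"
      by (rule ad_s)
    then show ?case
      using ty by (simp add: br_commute[of _ t])
  next
    case (Suc i)
    have "br a (s ((s ^^ Suc i) y)) t = br a ((s ^^ Suc i) y) (br a ((s ^^ Suc i) y) t)"
      by (rule ad_s)
    then show ?case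
      using Suc by (simp add: br_commute[of _ t])
  qed
  then have "br a t y = 0"
    using br_span[of "{t}" "range (\<lambda>i. (s ^^ Suc i) y)" t y] torus_element_span(2)[OF T y]
    by (auto simp: vec.span_base)
  with ty show ?thesis
    by (simp add: y_def)
qed

text \<open>With five independent toral elements the averaging identity reads
\<open>2 S + 32 c = 32 \<cdot> 34\<close>, where \<open>S \<ge> 16 \<cdot> 31\<close> and \<open>c \<ge> 5\<close>.\<close>

theorem torus_dim_le:
  assumes T: "is_torus T" shows "vec.dim T \<le> 4"
proof (rule ccontr)
  assume "\<not> vec.dim T \<le> 4"
  then have d: "5 \<le> vec.dim T"
    by simp
  obtain B where B: "B \<subseteq> {t \<in> T. s t = t}" "vec.independent B" "{t \<in> T. s t = t} \<subseteq> vec.span B"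
    using vec.maximal_independent_subset[of "{t \<in> T. s t = t}"] by blast
  have "T \<subseteq> vec.span B"
    using torus_element_span(1)[OF T] vec.span_minimal[OF B(3) vec.subspace_span] by blast
  then have "vec.dim T \<le> card B"
    using vec.dim_le_card vec.finiteI_independent[OF B(2)] by blast
  with d obtain B' where B': "B' \<subseteq> B" "card B' = 5" "finite B'"
    by (meson le_trans obtain_subset_with_card_n)
  obtain ts where ts: "set ts = B'" "distinct ts"
    using finite_distinct_list[OF B'(3)] by blast
  have len: "length ts = 5"
    using ts B'(2) distinct_card by fastforce
  have ind: "vec.independent (set ts)"
    using vec.independent_mono[OF B(2) B'(1)] ts(1) by simp
  have fixed: "t \<in> T" "s t = t" if "t \<in> set ts" for t
    using that ts(1) B'(1) B(1) by auto
  have toral: "\<forall>t\<in>set ts. toral_el t"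
    using fixed toral_fixed by blast
  have comm: "\<forall>t\<in>set ts. \<forall>t'\<in>set ts. br a t t' = 0"
    using fixed torus_toral_central[OF T] by blast
  have "16 * (2 ^ length ts - 1) \<le> (\<Sum>m\<leftarrow>subset_sums ts. vec.dim (range (br a m)))"
    by (rule subset_sums_rank[OF rank_toral_el[OF center] toral comm ind ts(2)])
  moreover have "2 * (\<Sum>m\<leftarrow>subset_sums ts. vec.dim (range (br a m))) +
      2 ^ length ts * vec.dim {u. \<forall>t\<in>set ts. br a t u = 0} = 2 ^ length ts * 34"
  proof -
    have "CARD(root_pair) = 17"
      by (simp add: UNIV_root_pair)
    then have "vec.dim (UNIV :: ('k ^ idx) set) = 34"
      unfolding vec_dim_card by simp
    then show ?thesis
      using plotkin[OF toral comm vec.subspace_UNIV] by simp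
  qed
  moreover have "5 \<le> vec.dim {u. \<forall>t\<in>set ts. br a t u = 0}"
  proof -
    have "set ts \<subseteq> {u. \<forall>t\<in>set ts. br a t u = 0}"
      using comm by blast
    from vec.independent_card_le_dim[OF this ind] show ?thesis
      using B'(2) ts(1) by simp
  qed
  ultimately show False
    by (simp add: len)
qed

end

section \<open>Coordinates on abstract vector spaces\<close>

text \<open>Linear coordinates on a space given as a record translate its subspaces, spans and dimensions into those of
\<open>K\<^sup>n\<close>. The map is only required to be injective, so that surjectivity can be deduced from the dimension.\<close>

locale coordinates = vectorspace class_ring L
  for L :: "('k::field, 'v) module" (structure) +
  fixes psi :: "'v \<Rightarrow> 'k ^ 'n"
  assumes psi_inj: "inj_on psi (carrier L)"
    and psi_add: "x \<in> carrier L \<Longrightarrow> y \<in> carrier L \<Longrightarrow> psi (x \<oplus> y) = psi x + psi y"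
    and psi_smult: "x \<in> carrier L \<Longrightarrow> psi (c \<odot> x) = c *s psi x"
begin

lemma psi_zero [simp]: "psi \<zero> = 0"
proof -
  have "psi (\<zero> \<oplus> \<zero>) = psi \<zero> + psi \<zero>"
    by (rule psi_add) simp_all
  then show ?thesis
    by simp
qed

lemma psi_finsum:
  assumes "finite I" "\<And>i. i \<in> I \<Longrightarrow> f i \<in> carrier L"
  shows "psi (finsum L f I) = (\<Sum>i\<in>I. psi (f i))"
  using assms
proof (induction I)
  case (insert i I)
  then have "f \<in> I \<rightarrow> carrier L"
    by auto
  with insert show ?case
    by (simp add: M.finsum_insert psi_add)
qed simp

lemma submodule_iff: "submodule class_ring W L \<longleftrightarrow> W \<subseteq> carrier L \<and> vec.subspace (psi ` W)"
proof
  assume "submodule class_ring W L"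
  then interpret submodule class_ring W L .
  have "vec.subspace (psi ` W)"
  proof (rule vec.subspaceI)
    show "0 \<in> psi ` W"
      using zero_closed by (metis imageI psi_zero)
    show "y + z \<in> psi ` W" if "y \<in> psi ` W" "z \<in> psi ` W" for y z
    proof -
      obtain u v where "u \<in> W" "v \<in> W" "y = psi u" "z = psi v"
        using \<open>y \<in> psi ` W\<close> \<open>z \<in> psi ` W\<close> by blast
      moreover from this have "psi (u \<oplus> v) = y + z" "u \<oplus> v \<in> W"
        using subset by (auto intro: psi_add)
      ultimately show ?thesis
        by (metis imageI)
    qed
    show "c *s y \<in> psi ` W" if "y \<in> psi ` W" for c y
    proof -
      obtain u where "u \<in> W" "y = psi u"
        using \<open>y \<in> psi ` W\<close> by blast
      moreover from this have "psi (c \<odot> u) = c *s y" "c \<odot> u \<in> W"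
        using subset by (auto intro: psi_smult)
      ultimately show ?thesis
        by (metis imageI)
    qed
  qed
  then show "W \<subseteq> carrier L \<and> vec.subspace (psi ` W)"
    using subset by simp
next
  assume *: "W \<subseteq> carrier L \<and> vec.subspace (psi ` W)"
  have mem: "x \<in> W" if "x \<in> carrier L" "psi x \<in> psi ` W" for x
    using that * psi_inj by (auto dest: inj_onD)
  show "submodule class_ring W L"
  proof (rule submodule.intro)
    show "module class_ring L"
      by (rule module_axioms)
    show "W \<subseteq> carrier L"
      using * by blast
    show "\<zero> \<in> W"
      using mem[of \<zero>] * vec.subspace_0 by fastforce
    show "v \<oplus> w \<in> W" if "v \<in> W" "w \<in> W" for v w
    proof (rule mem)
      have c: "v \<in> carrier L" "w \<in> carrier L"
        using * that by auto
      then show "v \<oplus> w \<in> carrier L"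
        by simp
      show "psi (v \<oplus> w) \<in> psi ` W"
        unfolding psi_add[OF c] using * that by (intro vec.subspace_add) auto
    qed
    show "c \<odot> v \<in> W" if "v \<in> W" for c v
    proof (rule mem)
      have c: "v \<in> carrier L"
        using * that by auto
      then show "c \<odot> v \<in> carrier L"
        by simp
      show "psi (c \<odot> v) \<in> psi ` W"
        unfolding psi_smult[OF c] using * that by (intro vec.subspace_scale) auto
    qed
  qed
qed

lemma vsubspace_iff: "vsubspace L W \<longleftrightarrow> W \<subseteq> carrier L \<and> vec.subspace (psi ` W)"
  using submodule_iff vectorspace_axioms by (simp add: subspace_def)

lemma psi_vspan:
  assumes S: "S \<subseteq> carrier L" shows "psi ` vspan L S = vec.span (psi ` S)"
proof
  show "psi ` vspan L S \<subseteq> vec.span (psi ` S)"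
  proof
    fix y assume "y \<in> psi ` vspan L S"
    then obtain c A where A: "finite A" "A \<subseteq> S" "y = psi (lincomb c A)"
      unfolding span_def by auto
    then have "y = (\<Sum>v\<in>A. c v *s psi v)"
      unfolding lincomb_def using S by (subst (asm) psi_finsum) (auto simp: psi_smult subset_iff intro!: sum.cong)
    moreover have "(\<Sum>v\<in>A. c v *s psi v) \<in> vec.span (psi ` S)"
      using A(2) by (intro vec.span_sum vec.span_scale vec.span_base) blast
    ultimately show "y \<in> vec.span (psi ` S)"
      by simp
  qed
  show "vec.span (psi ` S) \<subseteq> psi ` vspan L S"
    using span_is_submodule[OF S] in_own_span[OF S] unfolding submodule_iff by (intro vec.span_minimal) auto
qed

lemma carrier_submodule: "submodule class_ring (carrier L) L"
  using module_axioms by (intro submodule.intro) (auto simp: class_ring_simps)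

text \<open>The dimension of the record is defined by spanning sets only, so it suffices to compare spans.\<close>

lemma dim_carrier: "dim = vec.dim (psi ` carrier L)"
proof -
  have full: "vec.subspace (psi ` carrier L)"
    using submodule_iff[of "carrier L"] carrier_submodule by simp
  show ?thesis
    unfolding dim_def
  proof (rule Least_equality)
    obtain B where B: "B \<subseteq> psi ` carrier L" "vec.independent B" "psi ` carrier L \<subseteq> vec.span B"
      "card B = vec.dim (psi ` carrier L)"
      using vec.basis_exists by blast
    obtain A where A: "A \<subseteq> carrier L" "B = psi ` A"
      using B(1) by (auto simp: subset_image_iff)
    have inj: "inj_on psi A"
      using psi_inj A(1) inj_on_subset by blast
    have "psi ` vspan L A = psi ` carrier L"
      unfolding psi_vspan[OF A(1)] A(2)[symmetric] using B(1,3) vec.span_minimal[OF B(1) full] by auto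
    then have "vspan L A = carrier L"
      using psi_inj span_is_subset2[OF A(1)] by (simp add: inj_on_image_eq_iff)
    moreover have "finite A" "card A = vec.dim (psi ` carrier L)"
      using B(2,4) vec.finiteI_independent[of B] A(2) inj by (auto simp: finite_image_iff card_image)
    ultimately show "\<exists>A. finite A \<and> card A = vec.dim (psi ` carrier L) \<and> A \<subseteq> carrier L \<and> gen_set A"
      using A(1) by blast
  next
    fix n assume "\<exists>A. finite A \<and> card A = n \<and> A \<subseteq> carrier L \<and> gen_set A"
    then obtain A where A: "finite A" "card A = n" "A \<subseteq> carrier L" "gen_set A"
      by blast
    have "psi ` carrier L = vec.span (psi ` A)"
      using psi_vspan[OF A(3)] A(4) by simp
    then have "vec.dim (psi ` carrier L) \<le> card (psi ` A)"
      using A(1) by (intro vec.dim_le_card) auto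
    also have "\<dots> \<le> n"
      using card_image_le[OF A(1)] A(2) by simp
    finally show "vec.dim (psi ` carrier L) \<le> n" .
  qed
qed

lemma vdim_eq:
  assumes "vsubspace L W" shows "vdim L W = vec.dim (psi ` W)"
proof -
  have W: "W \<subseteq> carrier L"
    using assms vsubspace_iff by blast
  interpret W: coordinates "L\<lparr>carrier := W\<rparr>" psi
  proof (intro coordinates.intro coordinates_axioms.intro)
    show "vectorspace class_ring (L\<lparr>carrier := W\<rparr>)"
      using subspace_is_vs[OF assms] .
  qed (use W psi_inj psi_add psi_smult in \<open>auto simp: subset_iff inj_on_def\<close>)
  show ?thesis
    using W.dim_carrier by simp
qed

lemma vdim_carrier: "vdim L (carrier L) = vec.dim (psi ` carrier L)"
  using vdim_eq[of "carrier L"] carrier_submodule vectorspace_axioms by (simp add: subspace_def)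

end

section \<open>The diagonal torus and its weights\<close>

text \<open>The root of each pair as a vector over the field of two elements, in terms of \<open>\<alpha>, \<beta>, \<gamma>, \<lambda>\<close>. The diagonal
entries of \<open>Q\<close> are \<open>\<alpha>, \<alpha> + \<beta>, \<beta>\<close>, those of \<open>P\<close> are \<open>\<gamma>, \<gamma> + \<lambda>, \<lambda>\<close>.\<close>

fun bits :: "root_pair \<Rightarrow> bool \<times> bool \<times> bool \<times> bool" where
  "bits HP = (False, False, False, False)"
| "bits HQ = (False, False, False, False)"
| "bits A12 = (False, False, False, True)"
| "bits A13 = (False, False, True, True)"
| "bits A23 = (False, False, True, False)"
| "bits B12 = (False, True, False, False)"
| "bits B13 = (True, True, False, False)"
| "bits B23 = (True, False, False, False)"
| "bits X11 = (True, False, True, False)"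
| "bits X12 = (True, True, True, False)"
| "bits X13 = (False, True, True, False)"
| "bits X21 = (True, False, True, True)"
| "bits X22 = (True, True, True, True)"
| "bits X23 = (False, True, True, True)"
| "bits X31 = (True, False, False, True)"
| "bits X32 = (True, True, False, True)"
| "bits X33 = (False, True, False, True)"

abbreviation "no_bits \<equiv> (False, False, False, False)"

fun xor4 :: "bool \<times> bool \<times> bool \<times> bool \<Rightarrow> bool \<times> bool \<times> bool \<times> bool \<Rightarrow> bool \<times> bool \<times> bool \<times> bool" where
  "xor4 (a, b, c, d) (a', b', c', d') = (a \<noteq> a', b \<noteq> b', c \<noteq> c', d \<noteq> d')"

text \<open>The root spaces have dimension 2 because every nonzero vector occurs exactly once among the 15 pairs of
roots.\<close>

lemma card_bits: "b \<noteq> no_bits \<Longrightarrow> card {r. bits r = b} = 1"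
proof -
  assume b: "b \<noteq> no_bits"
  have surj: "b \<in> range bits"
  proof -
    have "\<forall>b0 b1 b2 b3. (b0, b1, b2, b3) \<in> insert no_bits (bits ` UNIV)"
      unfolding all_bool_eq UNIV_root_pair by simp
    moreover obtain b0 b1 b2 b3 where "b = (b0, b1, b2, b3)"
      by (metis surj_pair)
    ultimately have "b \<in> insert no_bits (range bits)"
      by (simp only:)
    with b show ?thesis
      by (simp only: insert_iff simp_thms)
  qed
  have inj: "bits q = bits r \<Longrightarrow> bits r \<noteq> no_bits \<Longrightarrow> q = r" for q r
  proof -
    have "\<forall>q r. bits q = bits r \<longrightarrow> bits r \<noteq> no_bits \<longrightarrow> q = r"
      unfolding all_root_pair by simp
    then show "bits q = bits r \<Longrightarrow> bits r \<noteq> no_bits \<Longrightarrow> q = r"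
      by blast
  qed
  from surj obtain r where r: "bits r = b"
    by (auto simp: image_iff)
  have "bits x = b \<longleftrightarrow> x = r" for x
  proof
    assume "bits x = b"
    then have "bits x = bits r"
      by (simp only: r)
    moreover have "bits r \<noteq> no_bits"
      unfolding r by (rule b)
    ultimately show "x = r"
      by (rule inj)
  qed (simp only: r)
  then have "{r. bits r = b} = {r}"
    by (simp only: singleton_conv)
  then show ?thesis by simp
qed

lemma card_no_bits: "{r. bits r = no_bits} = {HP, HQ}"
proof -
  have "bits r = no_bits \<longleftrightarrow> r \<in> {HP, HQ}" for r
    by (cases r) simp_all
  then show ?thesis by blast
qed

definition weight_space :: "bool \<times> bool \<times> bool \<times> bool \<Rightarrow> ('k::field ^ idx) set" where
  "weight_space b = {y. \<forall>i. i \<notin> {r. bits r = b} \<times> UNIV \<longrightarrow> y $ i = 0}"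

lemma weight_space_iff: "y \<in> weight_space b \<longleftrightarrow> (\<forall>i. bits (fst i) \<noteq> b \<longrightarrow> y $ i = 0)"
  by (auto simp: weight_space_def)

lemma dim_weight_space: "vec.dim (weight_space b :: ('k::field ^ idx) set) = 2 * card {r. bits r = b}"
  unfolding weight_space_def dim_substandard_cart by (simp add: card_cartesian_product)

lemma subspace_weight_space: "vec.subspace (weight_space b)"
  unfolding weight_space_iff[abs_def] vec.subspace_def by (auto simp: weight_space_iff)

context char_two
begin

definition bit_value :: "bool \<times> bool \<times> bool \<times> bool \<Rightarrow> 'k ^ idx \<Rightarrow> 'k" where
  "bit_value b t = (case b of (b0, b1, b2, b3) \<Rightarrow>
    (if b0 then t $ (HQ, True) else 0) + (if b1 then t $ (HQ, True) + t $ (HQ, False) else 0) +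
    (if b2 then t $ (HP, True) else 0) + (if b3 then t $ (HP, True) + t $ (HP, False) else 0))"

lemma root_value_bit_value: "root_value t r = bit_value (bits r) t"
  by (cases r) (simp_all add: bit_value_def ac_simps)

lemma bit_value_xor: "bit_value b t + bit_value b' t = bit_value (xor4 b b') t"
  by (cases b; cases b') (simp add: bit_value_def ac_simps)

lemma bit_value_linear: "bit_value b (t + u) = bit_value b t + bit_value b u" "bit_value b (c *s t) = c * bit_value b t"
  by (cases b; simp add: bit_value_def algebra_simps)+

lemma cartan_iff: "cartan t \<longleftrightarrow> t \<in> weight_space no_bits"
proof -
  have "bits r \<noteq> no_bits \<longleftrightarrow> r \<noteq> HP \<and> r \<noteq> HQ" for r
    by (cases r) simp_all
  then show ?thesis
    unfolding weight_space_iff cartan_def by (auto simp: split_paired_all)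
qed

text \<open>The images of the toral basis \<open>h\<^sub>1, (h\<^sub>2 + h\<^sub>4)/a, h\<^sub>3, h\<^sub>4\<close>.\<close>

definition torus_vec :: "nat \<Rightarrow> 'k ^ idx" where
  "torus_vec j = (if j = 0 then axis (HQ, True) 1 + axis (HQ, False) 1 else if j = 1 then axis (HQ, False) 1
    else if j = 2 then axis (HP, True) 1 + axis (HP, False) 1 else axis (HP, False) 1)"

lemma cartan_torus_vec: "cartan (torus_vec j)"
  by (simp add: cartan_def torus_vec_def axis_component)

lemma bit_value_torus_vec: "bit_value (b0, b1, b2, b3) (torus_vec 0) = (if b0 then 1 else 0)"
  "bit_value (b0, b1, b2, b3) (torus_vec 1) = (if b1 then 1 else 0)"
  "bit_value (b0, b1, b2, b3) (torus_vec 2) = (if b2 then 1 else 0)"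
  "bit_value (b0, b1, b2, b3) (torus_vec 3) = (if b3 then 1 else 0)"
  by (simp_all add: bit_value_def torus_vec_def axis_component)

lemma bit_value_separates: "(\<And>j. bit_value b (torus_vec j) = bit_value b' (torus_vec j)) \<Longrightarrow> b = b'"
proof -
  assume *: "\<And>j. bit_value b (torus_vec j) = bit_value b' (torus_vec j)"
  obtain b0 b1 b2 b3 c0 c1 c2 c3 where b: "b = (b0, b1, b2, b3)" "b' = (c0, c1, c2, c3)"
    by (metis surj_pair)
  show ?thesis
    using *[of 0] *[of 1] *[of 2] *[of 3] unfolding b bit_value_torus_vec by (auto split: if_splits)
qed

lemma cartan_expand:
  assumes "cartan t"
  shows "t = bit_value (True, False, False, False) t *s torus_vec 0 + bit_value (False, True, False, False) t *s torus_vec 1 +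
    bit_value (False, False, True, False) t *s torus_vec 2 + bit_value (False, False, False, True) t *s torus_vec 3"
  unfolding Finite_Cartesian_Product.vec_eq_iff all_idx all_root_pair using assms
  by (simp add: cartan_def bit_value_def torus_vec_def axis_component)

text \<open>Different roots are separated by the toral basis, on which they take the values 0 and 1 of their bits.\<close>

lemma weight_space_eq: "{y. \<forall>t. cartan t \<longrightarrow> br a t y = bit_value b t *s y} = weight_space b"
proof
  show "weight_space b \<subseteq> {y. \<forall>t. cartan t \<longrightarrow> br a t y = bit_value b t *s y}"
  proof
    fix y :: "'k ^ idx" assume y: "y \<in> weight_space b"
    have "bit_value (bits (fst i)) t * y $ i = bit_value b t * y $ i" for t i
      using y unfolding weight_space_iff by (cases "bits (fst i) = b") (simp_all del: split_paired_All)
    then show "y \<in> {y. \<forall>t. cartan t \<longrightarrow> br a t y = bit_value b t *s y}"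
      by (simp add: br_cartan root_value_bit_value Finite_Cartesian_Product.vec_eq_iff del: split_paired_All)
  qed
  show "{y. \<forall>t. cartan t \<longrightarrow> br a t y = bit_value b t *s y} \<subseteq> weight_space b"
  proof
    fix y assume y: "y \<in> {y. \<forall>t. cartan t \<longrightarrow> br a t y = bit_value b t *s y}"
    have "y $ i = 0" if ne: "bits (fst i) \<noteq> b" for i
    proof -
      obtain j where j: "bit_value (bits (fst i)) (torus_vec j) \<noteq> bit_value b (torus_vec j)"
        using bit_value_separates[of "bits (fst i)" b] ne by blast
      have "br a (torus_vec j) y $ i = (bit_value b (torus_vec j) *s y) $ i"
        using y cartan_torus_vec by simp
      then have "bit_value (bits (fst i)) (torus_vec j) * y $ i = bit_value b (torus_vec j) * y $ i"
        by (simp add: br_cartan[OF cartan_torus_vec] root_value_bit_value)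
      with j show ?thesis
        by simp
    qed
    then show "y \<in> weight_space b"
      by (simp add: weight_space_iff del: split_paired_All)
  qed
qed

lemma br_cartan_cartan: "cartan t \<Longrightarrow> cartan u \<Longrightarrow> br a t u = 0"
  unfolding br_cartan Finite_Cartesian_Product.vec_eq_iff all_idx all_root_pair by (simp add: cartan_def)

end

context wk4_two_map
begin

lemma s_unique: "(\<And>y. br a z y = br a x (br a x y)) \<Longrightarrow> s x = z"
proof -
  assume z: "\<And>y. br a z y = br a x (br a x y)"
  have "s x + z = 0"
    by (rule center) (simp add: br_add_left ad_s z)
  then show ?thesis
    using vec_add_self(2)[of z "s x"] by (simp add: add.commute)
qed

text \<open>Squares are determined by the adjoint action, and the eigenvalues of a diagonal element are additive in
its entries, as is the Frobenius map.\<close>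

lemma s_cartan:
  assumes "cartan x" shows "s x = (\<chi> i. (x $ i)\<^sup>2)"
proof (rule s_unique)
  define z where "z = (\<chi> i. (x $ i)\<^sup>2)"
  have c: "cartan z"
    using assms by (simp add: cartan_def z_def)
  have "root_value z r = root_value x r * root_value x r" for r
    by (cases r) (simp_all add: z_def power2_eq_square algebra_simps)
  then show "br a (\<chi> i. (x $ i)\<^sup>2) y = br a x (br a x y)" for y
    unfolding z_def[symmetric] br_cartan[OF c] br_cartan[OF assms] by (simp add: mult.assoc)
qed

lemma torus_cartan: "is_torus {x. cartan x}"
  unfolding is_torus_def
proof (intro conjI ballI)
  show "vec.subspace {x. cartan x}"
    using subspace_weight_space by (simp add: cartan_iff)
  show "br a x y \<in> {x. cartan x}" if "x \<in> {x. cartan x}" "y \<in> {x. cartan x}" for x y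
    using that by (simp add: br_cartan_cartan) (simp add: cartan_def)
  show "bij_betw s {x. cartan x} {x. cartan x}"
  proof (rule bij_betw_imageI)
    show "inj_on s {x. cartan x}"
    proof (rule inj_onI)
      fix x y assume xy: "x \<in> {x. cartan x}" "y \<in> {x. cartan x}" "s x = s y"
      have "x $ i = y $ i" for i
      proof -
        have "(x $ i)\<^sup>2 = (y $ i)\<^sup>2"
          using arg_cong[OF xy(3), of "\<lambda>v. v $ i"] xy(1,2) by (simp add: s_cartan)
        then have "(x $ i + y $ i)\<^sup>2 = 0"
          by (simp add: frobenius_add)
        then show ?thesis
          by simp
      qed
      then show "x = y"
        by (simp add: Finite_Cartesian_Product.vec_eq_iff del: split_paired_All)
    qed
    show "s ` {x. cartan x} = {x. cartan x}"
    proof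
      show "s ` {x. cartan x} \<subseteq> {x. cartan x}"
        by (auto simp: s_cartan) (simp add: cartan_def)
      show "{x. cartan x} \<subseteq> s ` {x. cartan x}"
      proof
        fix y assume y: "y \<in> {x. cartan x}"
        have "\<exists>c. c\<^sup>2 = y $ i" for i
          using nth_root_exists[of 2 "y $ i"] by simp
        then obtain f where f: "\<And>i. (f i)\<^sup>2 = y $ i"
          by metis
        define x where "x = (\<chi> i. f i)"
        have "cartan x"
          unfolding cartan_def
        proof (intro allI impI)
          fix r b assume "r \<noteq> HP" "r \<noteq> HQ"
          then have "(f (r, b))\<^sup>2 = 0"
            using y f[of "(r, b)"] by (simp add: cartan_def)
          then show "x $ (r, b) = 0"
            by (simp add: x_def)
        qed
        moreover have "s x = y"
          using calculation f by (simp add: s_cartan x_def Finite_Cartesian_Product.vec_eq_iff del: split_paired_All)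
        ultimately show "y \<in> s ` {x. cartan x}"
          by blast
      qed
    qed
  qed
qed

lemma s_torus_vec: "s (torus_vec j) = torus_vec j"
  unfolding s_cartan[OF cartan_torus_vec] Finite_Cartesian_Product.vec_eq_iff
  by (simp add: torus_vec_def axis_component del: split_paired_All)

end

section \<open>Transport to an isomorphic Lie algebra\<close>

text \<open>An isomorphism \<open>psi\<close> from a Lie algebra with a 2-map onto the model.\<close>

locale lie_model = wk4_two_map a s + coordinates L psi
  for a :: "'k::alg_closed_field" and s and L :: "('k, 'v) module" (structure) and psi :: "'v \<Rightarrow> 'k ^ idx" +
  fixes sq :: "'v \<Rightarrow> 'v" and h :: "4 \<Rightarrow> 'v"
  assumes psi_surj: "psi ` carrier L = UNIV"
    and mult_closed: "x \<in> carrier L \<Longrightarrow> y \<in> carrier L \<Longrightarrow> x \<otimes> y \<in> carrier L"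
    and psi_mult: "x \<in> carrier L \<Longrightarrow> y \<in> carrier L \<Longrightarrow> psi (x \<otimes> y) = br a (psi x) (psi y)"
    and sq_closed: "x \<in> carrier L \<Longrightarrow> sq x \<in> carrier L"
    and psi_sq: "x \<in> carrier L \<Longrightarrow> psi (sq x) = s (psi x)"
    and h_closed: "h i \<in> carrier L"
    and psi_h: "psi (h i) = gen a (H i)"
begin

definition iota :: "'k ^ idx \<Rightarrow> 'v" where "iota = inv_into (carrier L) psi"

lemma psi_iota [simp]: "psi (iota y) = y"
  unfolding iota_def by (rule f_inv_into_f) (simp add: psi_surj)

lemma iota_closed [simp]: "iota y \<in> carrier L"
  unfolding iota_def by (rule inv_into_into) (simp add: psi_surj)

lemma psi_eqD: "x \<in> carrier L \<Longrightarrow> y \<in> carrier L \<Longrightarrow> psi x = psi y \<Longrightarrow> x = y"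
  using psi_inj by (rule inj_onD)

definition pull :: "('k ^ idx) set \<Rightarrow> 'v set" where "pull V = {x \<in> carrier L. psi x \<in> V}"

lemma psi_pull [simp]: "psi ` pull V = V"
proof
  show "V \<subseteq> psi ` pull V"
  proof
    fix y assume "y \<in> V"
    then have "iota y \<in> pull V"
      by (simp add: pull_def)
    from imageI[OF this, of psi] show "y \<in> psi ` pull V"
      by simp
  qed
qed (auto simp: pull_def)

lemma pull_carrier: "pull V \<subseteq> carrier L"
  by (auto simp: pull_def)

lemma pull_psi: "W \<subseteq> carrier L \<Longrightarrow> pull (psi ` W) = W"
  unfolding pull_def using psi_eqD by auto

lemma vsubspace_pull: "vec.subspace V \<Longrightarrow> vsubspace L (pull V)"
  by (simp add: vsubspace_iff pull_carrier)

lemma torus_iff: "torus L sq W \<longleftrightarrow> W \<subseteq> carrier L \<and> is_torus (psi ` W)"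
proof (cases "W \<subseteq> carrier L")
  case True
  note inj = inj_on_subset[OF psi_inj True]
  have sqW: "sq ` W \<subseteq> carrier L"
    using True sq_closed by blast
  have mem: "x \<in> W \<longleftrightarrow> psi x \<in> psi ` W" if "x \<in> carrier L" for x
    using inj_on_image_mem_iff[OF psi_inj that True] by simp
  have "(\<forall>x\<in>W. \<forall>y\<in>W. x \<otimes> y \<in> W) \<longleftrightarrow> (\<forall>x\<in>psi ` W. \<forall>y\<in>psi ` W. br a x y \<in> psi ` W)"
  proof -
    have "x \<otimes> y \<in> W \<longleftrightarrow> br a (psi x) (psi y) \<in> psi ` W" if "x \<in> W" "y \<in> W" for x y
    proof -
      have c: "x \<in> carrier L" "y \<in> carrier L"
        using that True by auto
      show ?thesis
        using mem[OF mult_closed[OF c]] by (simp only: psi_mult[OF c])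
    qed
    then show ?thesis
      by (simp only: ball_simps(9) cong: ball_cong)
  qed
  moreover have "inj_on sq W \<longleftrightarrow> inj_on s (psi ` W)"
  proof -
    have "inj_on s (psi ` W) \<longleftrightarrow> inj_on (s \<circ> psi) W"
      by (rule comp_inj_on_iff[OF inj])
    also have "\<dots> \<longleftrightarrow> inj_on (psi \<circ> sq) W"
      using True by (intro inj_on_cong) (auto simp: psi_sq)
    also have "\<dots> \<longleftrightarrow> inj_on sq W"
      using comp_inj_on[of sq W psi] inj_on_imageI2[of psi sq W] inj_on_subset[OF psi_inj sqW] by blast
    finally show ?thesis ..
  qed
  moreover have "sq ` W = W \<longleftrightarrow> s ` psi ` W = psi ` W"
  proof -
    have "s ` psi ` W = psi ` sq ` W"
      unfolding image_image using True by (intro image_cong) (auto simp: psi_sq)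
    then show ?thesis
      using inj_on_image_eq_iff[OF psi_inj sqW True] by simp
  qed
  ultimately show ?thesis
    unfolding torus_def is_torus_def lie_subalgebra_def vsubspace_iff bij_betw_def using True by blast
next
  case False
  then show ?thesis
    by (simp add: torus_def lie_subalgebra_def vsubspace_iff)
qed

lemma vdim_torus: "torus L sq W \<Longrightarrow> vdim L W = vec.dim (psi ` W)"
  by (rule vdim_eq) (simp add: torus_def lie_subalgebra_def)

definition diag_torus :: "'v set" where "diag_torus = pull {y. cartan y}"

lemma mem_diag_torus: "x \<in> diag_torus \<longleftrightarrow> x \<in> carrier L \<and> cartan (psi x)"
  by (simp add: diag_torus_def pull_def)

lemma psi_diag_torus: "psi ` diag_torus = {y. cartan y}"
  by (simp add: diag_torus_def)

definition torus_list :: "'v list" where "torus_list = [h 1, (1 / a) \<odot> (h 2 \<oplus> h 4), h 3, h 4]"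

lemma torus_list_closed: "j < 4 \<Longrightarrow> torus_list ! j \<in> carrier L"
  by (auto simp: torus_list_def h_closed less_Suc_eq numeral_eq_Suc)

lemma psi_torus_list: "j < 4 \<Longrightarrow> psi (torus_list ! j) = torus_vec j"
proof -
  have "psi (h 1) = torus_vec 0" "psi (h 3) = torus_vec 2" "psi (h 4) = torus_vec 3"
    unfolding psi_h gen_H_coords by (simp_all add: torus_vec_def)
  moreover have "psi ((1 / a) \<odot> (h 2 \<oplus> h 4)) = (1 / a) *s (gen a (H 2) + gen a (H 4))"
    using h_closed by (simp add: psi_smult psi_add psi_h del: gen.simps)
  moreover have "(1 / a) *s (gen a (H 2) + gen a (H 4)) = torus_vec 1"
    unfolding gen_H_coords Finite_Cartesian_Product.vec_eq_iff using a_nz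
    by (simp add: torus_vec_def axis_component del: split_paired_All)
  ultimately show "j < 4 \<Longrightarrow> psi (torus_list ! j) = torus_vec j"
    by (auto simp: torus_list_def less_Suc_eq numeral_eq_Suc)
qed

lemma torus_list_diag_torus: "j < 4 \<Longrightarrow> torus_list ! j \<in> diag_torus"
  by (simp add: mem_diag_torus torus_list_closed psi_torus_list cartan_torus_vec)

lemma diag_torus_subspace: "vsubspace L diag_torus"
  unfolding diag_torus_def cartan_iff by (rule vsubspace_pull) (simp add: subspace_weight_space)

lemma torus_diag_torus: "torus L sq diag_torus"
  using torus_cartan by (simp add: torus_iff psi_diag_torus) (simp add: diag_torus_def pull_carrier)

lemma cartan_in_subspace:
  assumes "vec.subspace V" "\<And>j. j < 4 \<Longrightarrow> torus_vec j \<in> V" "cartan y" shows "y \<in> V"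
proof -
  have "bit_value (True, False, False, False) y *s torus_vec 0 + bit_value (False, True, False, False) y *s torus_vec 1 +
    bit_value (False, False, True, False) y *s torus_vec 2 + bit_value (False, False, False, True) y *s torus_vec 3 \<in> V"
    by (intro vec.subspace_add[OF assms(1)] vec.subspace_scale[OF assms(1)] assms(2)) simp_all
  then show ?thesis
    by (simp only: cartan_expand[OF assms(3), symmetric])
qed

lemma vspan_h: "vspan L {h 1, h 2, h 3, h 4} = diag_torus"
proof -
  let ?S = "{h 1, h 2, h 3, h 4}"
  have S: "?S \<subseteq> carrier L"
    using h_closed by auto
  have sub: "vspan L ?S \<subseteq> carrier L"
    using span_is_subset2[OF S] .
  have "cartan (gen a (H i))" for i
  proof -
    have "\<forall>i. cartan (gen a (H i))"
      unfolding all_4 gen_H_coords by (simp add: cartan_def axis_component)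
    then show ?thesis by blast
  qed
  then have hT: "psi (h i) \<in> {y. cartan y}" for i
    unfolding psi_h by blast
  have subc: "vec.subspace {y. cartan y}"
    using subspace_weight_space by (simp add: cartan_iff)
  have "vec.span (psi ` ?S) = {y. cartan y}"
  proof
    show "vec.span (psi ` ?S) \<subseteq> {y. cartan y}"
      by (rule vec.span_minimal[OF _ subc]) (use hT in blast)
    have hs: "psi (h i) \<in> vec.span (psi ` ?S)" if "i \<in> {1, 2, 3, 4}" for i
      using that by (intro vec.span_base) auto
    have "psi (torus_list ! j) \<in> vec.span (psi ` ?S)" if "j < 4" for j
      using that h_closed hs
      by (auto simp: torus_list_def less_Suc_eq numeral_eq_Suc psi_smult psi_add intro!: vec.span_scale vec.span_add)
    then show "{y. cartan y} \<subseteq> vec.span (psi ` ?S)"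
      using cartan_in_subspace[OF vec.subspace_span[of "psi ` ?S"]] psi_torus_list by auto
  qed
  then have "psi ` vspan L ?S = psi ` diag_torus"
    unfolding psi_vspan[OF S] psi_diag_torus .
  moreover have "diag_torus \<subseteq> carrier L"
    by (simp add: diag_torus_def pull_carrier)
  ultimately show ?thesis
    using inj_on_image_eq_iff[OF psi_inj sub] by blast
qed

text \<open>The toral basis lies in every torus that contains the toral diagonal elements, hence so does its span;
and the span is itself a torus.\<close>

lemma toral_part_diag_torus: "toral_part L sq diag_torus = diag_torus"
proof
  show "toral_part L sq diag_torus \<subseteq> diag_torus"
    unfolding toral_part_def torus_generated_def using torus_diag_torus by blast
  have "diag_torus \<subseteq> W" if W: "torus L sq W" "{t \<in> diag_torus. toral L sq t} \<subseteq> W" for W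
  proof -
    have sub: "vec.subspace (psi ` W)" "W \<subseteq> carrier L"
      using W(1) by (auto simp: torus_iff is_torus_def)
    have "torus_vec j \<in> psi ` W" if j: "j < 4" for j
    proof -
      have "sq (torus_list ! j) = torus_list ! j"
        using j by (intro psi_eqD sq_closed torus_list_closed) (simp_all add: psi_sq torus_list_closed psi_torus_list s_torus_vec)
      then have "torus_list ! j \<in> W"
        using W(2) torus_list_diag_torus[OF j] torus_list_closed[OF j] by (auto simp: toral_def)
      then show ?thesis
        using psi_torus_list[OF j] by (metis imageI)
    qed
    then have "{y. cartan y} \<subseteq> psi ` W"
      using cartan_in_subspace[OF sub(1)] by blast
    then show "diag_torus \<subseteq> W"
      using pull_psi[OF sub(2)] unfolding diag_torus_def pull_def by blast
  qed
  then show "diag_torus \<subseteq> toral_part L sq diag_torus"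
    unfolding toral_part_def torus_generated_def by blast
qed

lemma vdim_diag_torus: "vdim L diag_torus = 4"
proof -
  have "{y. cartan y} = (weight_space no_bits :: ('k ^ idx) set)"
    by (simp add: cartan_iff)
  then show ?thesis
    unfolding vdim_eq[OF diag_torus_subspace] psi_diag_torus by (simp add: dim_weight_space card_no_bits)
qed

lemma toral_rank_eq: "toral_rank L sq = 4"
  unfolding toral_rank_def
proof (rule Max_eqI)
  have le: "vdim L W \<le> 4" if "torus L sq W" for W
    using vdim_torus[OF that] torus_dim_le[of "psi ` W"] that by (simp add: torus_iff)
  then show "y \<le> 4" if "y \<in> {vdim L T |T. torus L sq T}" for y
    using that by blast
  then show "finite {vdim L T |T. torus L sq T}"
    by (meson finite_nat_set_iff_bounded_le)
  show "4 \<in> {vdim L T |T. torus L sq T}"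
  proof -
    have "vdim L diag_torus \<in> {vdim L T |T. torus L sq T}"
      using torus_diag_torus by blast
    then show ?thesis
      by (simp only: vdim_diag_torus)
  qed
qed

definition root_fun :: "bool \<times> bool \<times> bool \<times> bool \<Rightarrow> 'v \<Rightarrow> 'k" where
  "root_fun b = restrict (\<lambda>t. bit_value b (psi t)) diag_torus"

definition "dual_group = add_monoid (dual_space L diag_torus)"

lemma bit_value_no_bits: "bit_value no_bits t = 0"
  by (simp add: bit_value_def)

lemma dual_group_mult: "f \<otimes>\<^bsub>dual_group\<^esub> g = restrict (\<lambda>t. f t + g t) diag_torus"
  by (simp add: dual_group_def dual_space_def class_ring.func_space_def)

lemma dual_group_one: "\<one>\<^bsub>dual_group\<^esub> = root_fun no_bits"
  by (simp add: dual_group_def dual_space_def class_ring.func_space_def root_fun_def bit_value_def)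

lemma dual_group_carrier: "f \<in> carrier dual_group \<longleftrightarrow> f \<in> carrier (dual_space L diag_torus)"
  by (simp add: dual_group_def)

lemma diag_torus_closed: "x \<in> diag_torus \<Longrightarrow> y \<in> diag_torus \<Longrightarrow> x \<oplus> y \<in> diag_torus" "x \<in> diag_torus \<Longrightarrow> c \<odot> x \<in> diag_torus"
  using diag_torus_subspace LinearCombinations.submodule.m_closed[of class_ring diag_torus L x y]
    LinearCombinations.submodule.smult_closed[of class_ring diag_torus L c x]
  by (simp_all add: subspace_def class_ring_simps)

lemma diag_torus_carrier: "x \<in> diag_torus \<Longrightarrow> x \<in> carrier L"
  by (simp add: mem_diag_torus)

lemma root_fun_carrier: "root_fun b \<in> carrier (dual_space L diag_torus)"
  by (auto simp: dual_space_def root_fun_def diag_torus_closed psi_add psi_smult diag_torus_carrier bit_value_linear)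

lemma root_fun_torus_list: "j < 4 \<Longrightarrow> root_fun b (torus_list ! j) = bit_value b (torus_vec j)"
  by (simp add: root_fun_def torus_list_diag_torus psi_torus_list)

lemma root_fun_inj: "inj root_fun"
proof (rule injI)
  fix b c assume e: "root_fun b = root_fun c"
  have "bit_value b (torus_vec j) = bit_value c (torus_vec j)" if "j < 4" for j
    using root_fun_torus_list[OF that, of b] root_fun_torus_list[OF that, of c] e by simp
  moreover have "torus_vec j = torus_vec 3" if "\<not> j < 4" for j
    using that by (simp add: torus_vec_def)
  ultimately have "bit_value b (torus_vec j) = bit_value c (torus_vec j)" for j
    by (cases "j < 4") auto
  then show "b = c"
    by (rule bit_value_separates)
qed

lemma root_fun_mult: "root_fun b \<otimes>\<^bsub>dual_group\<^esub> root_fun c = root_fun (xor4 b c)"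
  unfolding dual_group_mult by (auto simp: root_fun_def bit_value_xor)

definition unit4 :: "nat \<Rightarrow> bool \<times> bool \<times> bool \<times> bool" where
  "unit4 j = (j = 0, j = 1, j = 2, j = 3)"

lemma bit_value_unit4: "i < 4 \<Longrightarrow> j < 4 \<Longrightarrow> bit_value (unit4 i) (torus_vec j) = (if j = i then 1 else 0)"
proof -
  assume ij: "i < 4" "j < 4"
  then consider "j = 0" | "j = 1" | "j = 2" | "j = 3"
    by linarith
  then show ?thesis
    using ij by cases (simp_all only: unit4_def bit_value_torus_vec, auto)
qed

text \<open>The dual basis is unique because the list is a basis.\<close>

lemma dual_vec_eq:
  assumes i: "i < 4" shows "dual_vec L diag_torus torus_list i = root_fun (unit4 i)"
  unfolding dual_vec_def
proof (rule the_equality)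
  have len: "length torus_list = 4"
    by (simp add: torus_list_def)
  show "root_fun (unit4 i) \<in> carrier (dual_space L diag_torus) \<and>
      (\<forall>j<length torus_list. root_fun (unit4 i) (torus_list ! j) = (if j = i then 1 else 0))"
    using i by (simp add: root_fun_carrier len root_fun_torus_list bit_value_unit4)
  fix \<xi> assume x: "\<xi> \<in> carrier (dual_space L diag_torus) \<and> (\<forall>j<length torus_list. \<xi> (torus_list ! j) = (if j = i then 1 else 0))"
  have add: "\<xi> (x \<oplus> y) = \<xi> x + \<xi> y" and smult: "\<xi> (c \<odot> x) = c * \<xi> x" if "x \<in> diag_torus" "y \<in> diag_torus" for x y c
    using x that by (auto simp: dual_space_def)
  have ext_xi: "\<xi> \<in> diag_torus \<rightarrow>\<^sub>E UNIV"
    using x by (simp add: dual_space_def)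
  have "\<xi> t = bit_value (unit4 i) (psi t)" if t: "t \<in> diag_torus" for t
  proof -
    define c where "c j = bit_value (unit4 j) (psi t)" for j
    have b: "torus_list ! 0 \<in> diag_torus" "torus_list ! 1 \<in> diag_torus" "torus_list ! 2 \<in> diag_torus" "torus_list ! 3 \<in> diag_torus"
      by (simp_all add: torus_list_diag_torus)
    have "t = c 0 \<odot> torus_list ! 0 \<oplus> c 1 \<odot> torus_list ! 1 \<oplus> c 2 \<odot> torus_list ! 2 \<oplus> c 3 \<odot> torus_list ! 3"
    proof (rule psi_eqD)
      have "psi t = c 0 *s torus_vec 0 + c 1 *s torus_vec 1 + c 2 *s torus_vec 2 + c 3 *s torus_vec 3"
        using cartan_expand[of "psi t"] t unfolding c_def unit4_def by (simp add: mem_diag_torus)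
      then show "psi t = psi (c 0 \<odot> torus_list ! 0 \<oplus> c 1 \<odot> torus_list ! 1 \<oplus> c 2 \<odot> torus_list ! 2 \<oplus> c 3 \<odot> torus_list ! 3)"
        using torus_list_closed[of 0] torus_list_closed[of 1] torus_list_closed[of 2] torus_list_closed[of 3]
          psi_torus_list[of 0] psi_torus_list[of 1] psi_torus_list[of 2] psi_torus_list[of 3]
        by (simp add: psi_add psi_smult class_ring_simps)
    qed (use t diag_torus_closed b diag_torus_carrier in auto)
    also have "\<xi> \<dots> = c 0 * \<xi> (torus_list ! 0) + c 1 * \<xi> (torus_list ! 1) + c 2 * \<xi> (torus_list ! 2) + c 3 * \<xi> (torus_list ! 3)"
      using b by (simp add: add smult diag_torus_closed)
    also have "\<dots> = c i"
    proof -
      have v: "\<xi> (torus_list ! 0) = (if 0 = i then 1 else 0)" "\<xi> (torus_list ! 1) = (if 1 = i then 1 else 0)"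
        "\<xi> (torus_list ! 2) = (if 2 = i then 1 else 0)" "\<xi> (torus_list ! 3) = (if 3 = i then 1 else 0)"
        using x by (simp_all add: len)
      have "i = 0 \<or> i = 1 \<or> i = 2 \<or> i = 3"
        using i by linarith
      then show ?thesis
        unfolding v by auto
    qed
    finally show ?thesis
      by (simp add: c_def)
  qed
  then show "\<xi> = root_fun (unit4 i)"
    using ext_xi by (intro ext) (auto simp: root_fun_def PiE_def extensional_def)
qed

definition "root_group = generate dual_group {dual_vec L diag_torus torus_list 0, dual_vec L diag_torus torus_list 1, dual_vec L diag_torus torus_list 2, dual_vec L diag_torus torus_list 3}"

lemma xor4_simps: "xor4 no_bits b = b" "xor4 b b = no_bits" "xor4 b c = xor4 c b" "xor4 (xor4 b c) d = xor4 b (xor4 c d)"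
  by (cases b; cases c; cases d; auto)+

text \<open>The inverse in the dual space is a definite description; it has to be evaluated since
generated subgroups contain inverses of generators.\<close>

lemma inv_root_fun: "inv\<^bsub>dual_group\<^esub> root_fun b = root_fun b"
  unfolding m_inv_def
proof (rule the_equality)
  show "root_fun b \<in> carrier dual_group \<and> root_fun b \<otimes>\<^bsub>dual_group\<^esub> root_fun b = \<one>\<^bsub>dual_group\<^esub> \<and> root_fun b \<otimes>\<^bsub>dual_group\<^esub> root_fun b = \<one>\<^bsub>dual_group\<^esub>"
    by (simp add: dual_group_carrier root_fun_carrier root_fun_mult xor4_simps dual_group_one)
  fix y assume y: "y \<in> carrier dual_group \<and> root_fun b \<otimes>\<^bsub>dual_group\<^esub> y = \<one>\<^bsub>dual_group\<^esub> \<and> y \<otimes>\<^bsub>dual_group\<^esub> root_fun b = \<one>\<^bsub>dual_group\<^esub>"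
  have "y \<in> diag_torus \<rightarrow>\<^sub>E UNIV"
    using y by (simp add: dual_group_carrier dual_space_def)
  moreover have "y t = root_fun b t" if "t \<in> diag_torus" for t
  proof -
    have "root_fun b t + y t = 0"
    proof -
      have "(root_fun b \<otimes>\<^bsub>dual_group\<^esub> y) t = root_fun no_bits t"
        using y by (simp add: dual_group_one)
      then show ?thesis
        using that by (simp add: dual_group_mult root_fun_def bit_value_no_bits)
    qed
    then show ?thesis
      by simp
  qed
  ultimately show "y = root_fun b"
    by (intro ext) (auto simp: root_fun_def PiE_def extensional_def)
qed

lemma root_group_eq: "root_group = range root_fun"
proof
  have gens: "{dual_vec L diag_torus torus_list 0, dual_vec L diag_torus torus_list 1, dual_vec L diag_torus torus_list 2, dual_vec L diag_torus torus_list 3} =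
      {root_fun (unit4 0), root_fun (unit4 1), root_fun (unit4 2), root_fun (unit4 3)}"
    by (simp add: dual_vec_eq)
  show "root_group \<subseteq> range root_fun"
  proof
    fix x assume "x \<in> root_group"
    then show "x \<in> range root_fun"
      unfolding root_group_def gens
      by (induction rule: generate.induct) (auto simp: dual_group_one inv_root_fun root_fun_mult)
  qed
  have one: "root_fun no_bits \<in> root_group"
    unfolding root_group_def dual_group_one[symmetric] by (rule generate.one)
  have unit: "root_fun (unit4 j) \<in> root_group" if "j < 4" for j
  proof -
    have "j = 0 \<or> j = 1 \<or> j = 2 \<or> j = 3"
      using that by linarith
    then show ?thesis
      unfolding root_group_def gens by (intro generate.incl) auto
  qed
  have mult: "root_fun (xor4 b c) \<in> root_group" if "root_fun b \<in> root_group" "root_fun c \<in> root_group" for b c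
    using that generate.eng[of _ dual_group] unfolding root_group_def root_fun_mult[symmetric] by blast
  show "range root_fun \<subseteq> root_group"
  proof
    fix x assume "x \<in> range root_fun"
    then obtain b0 b1 b2 b3 where x: "x = root_fun (b0, b1, b2, b3)"
      by (metis rangeE surj_pair)
    have *: "root_fun (if c then unit4 j else no_bits) \<in> root_group" if "j < 4" for c j
      using one unit[OF that] by simp
    have "(b0, b1, b2, b3) = xor4 (if b0 then unit4 0 else no_bits) (xor4 (if b1 then unit4 1 else no_bits)
        (xor4 (if b2 then unit4 2 else no_bits) (if b3 then unit4 3 else no_bits)))"
      by (simp add: unit4_def)
    then show "x \<in> root_group"
      unfolding x using * mult by simp
  qed
qed

lemma card_root_group: "card root_group = 16"
proof -
  have "card (UNIV :: (bool \<times> bool \<times> bool \<times> bool) set) = 16"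
    by (simp add: card_cartesian_product flip: UNIV_Times_UNIV)
  then show ?thesis
    unfolding root_group_eq using card_image[OF root_fun_inj] by simp
qed

lemma elementary_abelian_root_group: "elementary_abelian 2 (dual_group\<lparr>carrier := root_group\<rparr>)" (is "elementary_abelian 2 ?A")
  unfolding elementary_abelian_def
proof (intro conjI ballI)
  show "prime (2::nat)"
    by (rule two_is_prime_nat)
  show "comm_group ?A"
  proof (rule comm_groupI)
    fix x y z assume "x \<in> carrier ?A" "y \<in> carrier ?A" "z \<in> carrier ?A"
    then obtain b c d where "x = root_fun b" "y = root_fun c" "z = root_fun d"
      by (simp add: root_group_eq) (elim imageE, blast)
    then show "x \<otimes>\<^bsub>?A\<^esub> y \<otimes>\<^bsub>?A\<^esub> z = x \<otimes>\<^bsub>?A\<^esub> (y \<otimes>\<^bsub>?A\<^esub> z)"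
      by (simp add: root_fun_mult xor4_simps(4))
  next
    fix x y assume "x \<in> carrier ?A" "y \<in> carrier ?A"
    then obtain b c where "x = root_fun b" "y = root_fun c"
      by (simp add: root_group_eq) (elim imageE, blast)
    then show "x \<otimes>\<^bsub>?A\<^esub> y = y \<otimes>\<^bsub>?A\<^esub> x"
      "x \<otimes>\<^bsub>?A\<^esub> y \<in> carrier ?A"
      by (simp_all add: root_fun_mult root_group_eq xor4_simps(3)[of b c])
  next
    fix x assume "x \<in> carrier ?A"
    then obtain b where b: "x = root_fun b"
      by (simp add: root_group_eq) (elim imageE, blast)
    then show "\<one>\<^bsub>?A\<^esub> \<otimes>\<^bsub>?A\<^esub> x = x"
      by (simp add: root_fun_mult dual_group_one xor4_simps(1))
    show "\<exists>y\<in>carrier ?A. y \<otimes>\<^bsub>?A\<^esub> x = \<one>\<^bsub>?A\<^esub>"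
      by (rule bexI[of _ x]) (simp_all add: b root_fun_mult dual_group_one xor4_simps(2) root_group_eq)
  qed (simp add: root_group_eq dual_group_one)
  show "x [^]\<^bsub>?A\<^esub> (2::nat) = \<one>\<^bsub>?A\<^esub>" if xin: "x \<in> carrier ?A" for x
  proof -
    obtain b where "x = root_fun b"
      using xin by (simp add: root_group_eq) (elim imageE, blast)
    then show ?thesis
      by (simp add: dual_group_one root_fun_mult xor4_simps(1,2) nat_pow_def numeral_2_eq_2)
  qed
qed

lemma root_space_eq: "root_space L diag_torus (root_fun b) = pull (weight_space b)"
proof -
  have "(\<forall>t\<in>diag_torus. t \<otimes> x = root_fun b t \<odot> x) \<longleftrightarrow> psi x \<in> weight_space b" if x: "x \<in> carrier L" for x
  proof -
    have "(\<forall>t\<in>diag_torus. t \<otimes> x = root_fun b t \<odot> x) \<longleftrightarrow> (\<forall>t\<in>diag_torus. br a (psi t) (psi x) = bit_value b (psi t) *s psi x)"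
    proof (rule ball_cong[OF refl])
      fix t assume t: "t \<in> diag_torus"
      have "t \<otimes> x = root_fun b t \<odot> x \<longleftrightarrow> psi (t \<otimes> x) = psi (root_fun b t \<odot> x)"
        using psi_eqD[of "t \<otimes> x" "root_fun b t \<odot> x"] t x by (auto simp: mult_closed diag_torus_carrier)
      then show "t \<otimes> x = root_fun b t \<odot> x \<longleftrightarrow> br a (psi t) (psi x) = bit_value b (psi t) *s psi x"
        using t x by (simp add: psi_mult psi_smult diag_torus_carrier root_fun_def)
    qed
    also have "\<dots> \<longleftrightarrow> (\<forall>t\<in>psi ` diag_torus. br a t (psi x) = bit_value b t *s psi x)"
      by (simp only: ball_simps(9))
    also have "\<dots> \<longleftrightarrow> (\<forall>t. cartan t \<longrightarrow> br a t (psi x) = bit_value b t *s psi x)"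
      unfolding psi_diag_torus by simp
    finally show ?thesis
      using weight_space_eq[of b] by blast
  qed
  then show ?thesis
    unfolding root_space_def pull_def by blast
qed

lemma root_component:
  "(if root_fun b = \<one>\<^bsub>dual_group\<^esub> then diag_torus else root_space L diag_torus (root_fun b)) = pull (weight_space b)"
proof (cases "root_fun b = \<one>\<^bsub>dual_group\<^esub>")
  case True
  then have "b = no_bits"
    unfolding dual_group_one using injD[OF root_fun_inj] by blast
  with True show ?thesis
    by (simp add: diag_torus_def cartan_iff)
qed (simp add: root_space_eq)

definition proj :: "bool \<times> bool \<times> bool \<times> bool \<Rightarrow> 'k ^ idx \<Rightarrow> 'k ^ idx" where
  "proj b y = (\<chi> i. if bits (fst i) = b then y $ i else 0)"

lemma proj_weight: "proj b y \<in> weight_space b"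
  by (simp add: weight_space_iff proj_def del: split_paired_All)

lemma sum_proj: "(\<Sum>b\<in>UNIV. proj b y) = y"
  by (simp add: Finite_Cartesian_Product.vec_eq_iff sum_component proj_def del: split_paired_All)

lemma proj_sum:
  assumes "\<And>b. f b \<in> weight_space b" shows "proj c (\<Sum>b\<in>UNIV. f b) = f c"
proof -
  have f: "f b $ i = (if bits (fst i) = b then f b $ i else 0)" for b i
    using assms[of b] unfolding weight_space_iff by (cases "bits (fst i) = b") (simp_all del: split_paired_All)
  have "(\<Sum>b\<in>UNIV. f b $ i) = (\<Sum>b\<in>UNIV. if bits (fst i) = b then f b $ i else 0)" for i
    by (intro sum.cong refl f)
  then have "(\<Sum>b\<in>UNIV. f b $ i) = f (bits (fst i)) $ i" for i
    by simp
  then have "proj c (\<Sum>b\<in>UNIV. f b) $ i = f c $ i" for i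
    using f[of c i] by (cases "bits (fst i) = c") (simp_all add: proj_def sum_component)
  then show ?thesis
    by (simp add: Finite_Cartesian_Product.vec_eq_iff del: split_paired_All)
qed

lemma direct_sum: "internal_direct_sum L root_group (\<lambda>\<xi>. if \<xi> = \<one>\<^bsub>dual_group\<^esub> then diag_torus else root_space L diag_torus \<xi>)"
  (is "internal_direct_sum L root_group ?W")
  unfolding internal_direct_sum_def
proof (intro conjI ballI)
  show fin: "finite root_group"
    by (simp add: root_group_eq)
  show "vsubspace L (?W \<xi>)" if "\<xi> \<in> root_group" for \<xi>
    using that by (auto simp only: root_group_eq root_component vsubspace_pull subspace_weight_space)
  have W: "?W (root_fun b) = pull (weight_space b)" for b
    by (rule root_component)
  have psi_sum: "psi (\<Oplus>\<xi>\<in>root_group. c \<xi>) = (\<Sum>b\<in>UNIV. psi (c (root_fun b)))" if "c \<in> (\<Pi>\<^sub>E \<xi>\<in>root_group. ?W \<xi>)" for c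
  proof -
    have "c \<xi> \<in> carrier L" if xi: "\<xi> \<in> root_group" for \<xi>
    proof -
      obtain b where "\<xi> = root_fun b"
        using xi unfolding root_group_eq by (elim imageE)
      with PiE_mem[OF \<open>c \<in> _\<close> xi] W[of b] show ?thesis
        using pull_carrier by blast
    qed
    then have "psi (\<Oplus>\<xi>\<in>root_group. c \<xi>) = (\<Sum>\<xi>\<in>root_group. psi (c \<xi>))"
      by (rule psi_finsum[OF fin])
    then show ?thesis
      by (simp add: root_group_eq sum.reindex[OF root_fun_inj])
  qed
  fix x assume x: "x \<in> carrier L"
  define c where "c = restrict (\<lambda>\<xi>. iota (proj (inv_into UNIV root_fun \<xi>) (psi x))) root_group"
  have c_root_fun: "c (root_fun b) = iota (proj b (psi x))" for b
    by (simp add: c_def root_group_eq inv_f_f[OF root_fun_inj])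
  show "\<exists>!c. c \<in> (\<Pi>\<^sub>E \<xi>\<in>root_group. ?W \<xi>) \<and> x = (\<Oplus>\<xi>\<in>root_group. c \<xi>)"
  proof (rule ex1I)
    have "c (root_fun b) \<in> ?W (root_fun b)" for b
      unfolding W c_root_fun by (simp add: pull_def proj_weight)
    then have "c \<xi> \<in> ?W \<xi>" if "\<xi> \<in> root_group" for \<xi>
      using that unfolding root_group_eq by blast
    then have cW: "c \<in> (\<Pi>\<^sub>E \<xi>\<in>root_group. ?W \<xi>)"
      unfolding c_def by (intro restrict_PiE_iff[THEN iffD2]) (simp add: c_def)
    have "(\<Oplus>\<xi>\<in>root_group. c \<xi>) \<in> carrier L"
      using PiE_mem[OF cW] W pull_carrier by (intro M.finsum_closed) (fastforce simp: root_group_eq)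
    moreover have "psi (\<Oplus>\<xi>\<in>root_group. c \<xi>) = psi x"
      using psi_sum[OF cW] by (simp add: c_root_fun sum_proj)
    ultimately show "c \<in> (\<Pi>\<^sub>E \<xi>\<in>root_group. ?W \<xi>) \<and> x = (\<Oplus>\<xi>\<in>root_group. c \<xi>)"
      using cW psi_eqD[OF x] by simp
    fix d assume d: "d \<in> (\<Pi>\<^sub>E \<xi>\<in>root_group. ?W \<xi>) \<and> x = (\<Oplus>\<xi>\<in>root_group. d \<xi>)"
    have dW: "d (root_fun b) \<in> pull (weight_space b)" for b
      using PiE_mem[of d root_group ?W "root_fun b"] d W by (simp add: root_group_eq)
    then have "psi (d (root_fun b)) \<in> weight_space b" for b
      by (simp add: pull_def)
    from proj_sum[of "\<lambda>b. psi (d (root_fun b))", OF this] have "proj b (psi x) = psi (d (root_fun b))" for b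
      using psi_sum[of d] d by simp
    then have "d (root_fun b) = c (root_fun b)" for b
      using dW[of b] by (intro psi_eqD) (simp_all add: c_root_fun pull_def)
    then show "d = c"
      using d cW by (intro PiE_ext[of d root_group ?W c]) (auto simp: root_group_eq)
  qed
qed

lemma vdim_root_space:
  assumes "\<xi> \<in> root_group - {\<one>\<^bsub>dual_group\<^esub>}" shows "vdim L (root_space L diag_torus \<xi>) = 2"
proof -
  obtain b where b: "\<xi> = root_fun b"
    using assms by (auto simp: root_group_eq)
  then have "b \<noteq> no_bits"
    using assms by (auto simp: dual_group_one)
  then show ?thesis
    unfolding b root_space_eq vdim_eq[OF vsubspace_pull[OF subspace_weight_space]]
    by (simp add: dim_weight_space card_bits)
qed

end

theorem theorem2:
  fixes a :: "'k::alg_closed_field"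
    and sq :: "(4 cgen magma \<Rightarrow>\<^sub>0 'k) set set \<Rightarrow> (4 cgen magma \<Rightarrow>\<^sub>0 'k) set set"
  assumes char2: "CHAR('k) = 2"
    and a: "a \<notin> {0, 1}"
    and L: "L = contragredient (cartan_F4 a)"
    and two_map: "lie_2_algebra L sq"
    and simple: "lie_simple L"
    and dim: "vectorspace.fin_dim class_ring L" "vdim L (carrier L) = 34"
    and h: "\<And>i. h i = contragredient_gen (cartan_F4 a) (H i)"
    and \<hh>: "\<hh> = vspan L {h 1, h 2, h 3, h 4}"
    and T: "T = toral_part L sq \<hh>"
    and bs: "bs = [h 1, (1 / a) \<odot>\<^bsub>L\<^esub> (h 2 \<oplus>\<^bsub>L\<^esub> h 4), h 3, h 4]"
    and D: "D = add_monoid (dual_space L T)"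
    and dual_basis: "\<alpha> = dual_vec L T bs 0" "\<beta> = dual_vec L T bs 1"
      "\<gamma> = dual_vec L T bs 2" "lam = dual_vec L T bs 3"
    and G: "G = generate D {\<alpha>, \<beta>, \<gamma>, lam}"
  shows "toral_rank L sq = 4 \<and>
    torus L sq T \<and> vdim L T = 4 \<and>
    internal_direct_sum L G (\<lambda>\<xi>. if \<xi> = \<one>\<^bsub>D\<^esub> then T else root_space L T \<xi>) \<and>
    elementary_abelian 2 (D\<lparr>carrier := G\<rparr>) \<and> card G = 16 \<and>
    (\<forall>\<xi>\<in>G - {\<one>\<^bsub>D\<^esub>}. vdim L (root_space L T \<xi>) = 2)"
proof -
  interpret W: wk4 a
    using char2 a by unfold_locales auto
  interpret P: presentation L W.contra_proj
    unfolding L by (rule W.presentation_contragredient)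
  interpret A: lie_2_algebra L sq
    by (rule two_map)
  (* all representatives of a coset have the same value *)
  define psi where "psi z = eval_free a (SOME p. W.contra_proj p = z)" for z
  have psi_contra_proj: "psi (W.contra_proj p) = eval_free a p" for p
  proof -
    have "W.contra_proj (SOME q. W.contra_proj q = W.contra_proj p) = W.contra_proj p"
      by (rule someI[of _ p]) (rule refl)
    then show ?thesis
      unfolding psi_def by (simp only: W.contra_proj_eq_iff)
  qed
  have ex: "\<exists>p. x = W.contra_proj p" if "x \<in> carrier L" for x
    using that unfolding P.carrier_eq by (elim rangeE) (rule exI)
  interpret C: coordinates L psi
  proof
    show "inj_on psi (carrier L)"
    proof (rule inj_onI)
      fix x y assume xy: "x \<in> carrier L" "y \<in> carrier L" "psi x = psi y"
      then obtain p q where "x = W.contra_proj p" "y = W.contra_proj q"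
        using ex by metis
      with xy(3) show "x = y"
        by (simp only: psi_contra_proj W.contra_proj_eq_iff)
    qed
    show "psi (x \<oplus>\<^bsub>L\<^esub> y) = psi x + psi y" if "x \<in> carrier L" "y \<in> carrier L" for x y
      using ex[OF that(1)] ex[OF that(2)] by (auto simp: P.h_add psi_contra_proj eval_free_add)
    show "psi (c \<odot>\<^bsub>L\<^esub> x) = c *s psi x" if "x \<in> carrier L" for x c
      using ex[OF that] by (auto simp: P.h_smult psi_contra_proj eval_free_sm)
  qed
  have psi_mult: "psi (x \<otimes>\<^bsub>L\<^esub> y) = br a (psi x) (psi y)" if "x \<in> carrier L" "y \<in> carrier L" for x y
    using ex[OF that(1)] ex[OF that(2)] by (auto simp: P.h_mult psi_contra_proj W.eval_free_fm)
  have surj: "psi ` carrier L = UNIV"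
  proof -
    have sub: "vec.subspace (psi ` carrier L)"
      using C.submodule_iff C.carrier_submodule by blast
    have "CARD(root_pair) = 17"
      by (simp add: UNIV_root_pair)
    then have "vec.dim (UNIV :: ('k ^ idx) set) = 34"
      unfolding vec_dim_card by simp
    then have "vec.dim (psi ` carrier L) = vec.dim (UNIV :: ('k ^ idx) set)"
      using dim(2) unfolding C.vdim_carrier by simp
    then show ?thesis
      using vec.subspace_dim_equal[OF sub vec.subspace_UNIV] by simp
  qed
  define iota where "iota = inv_into (carrier L) psi"
  have psi_iota: "psi (iota y) = y" and iota: "iota y \<in> carrier L" for y
    unfolding iota_def using surj by (auto intro: f_inv_into_f inv_into_into)
  have iota_psi: "iota (psi x) = x" if "x \<in> carrier L" for x
    unfolding iota_def using C.psi_inj that by (rule inv_into_f_f)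
  define s where "s y = psi (sq (iota y))" for y
  have center: "x = 0" if x: "\<And>y. br a x y = 0" for x
  proof -
    (* the center is an ideal, so it vanishes by simplicity *)
    define Z where "Z = {z \<in> carrier L. \<forall>y\<in>carrier L. z \<otimes>\<^bsub>L\<^esub> y = \<zero>\<^bsub>L\<^esub>}"
    have mult0: "z \<otimes>\<^bsub>L\<^esub> y = \<zero>\<^bsub>L\<^esub> \<longleftrightarrow> br a (psi z) (psi y) = 0" if "z \<in> carrier L" "y \<in> carrier L" for z y
    proof -
      have "z \<otimes>\<^bsub>L\<^esub> y = \<zero>\<^bsub>L\<^esub> \<longleftrightarrow> psi (z \<otimes>\<^bsub>L\<^esub> y) = psi \<zero>\<^bsub>L\<^esub>"
        using inj_on_eq_iff[OF C.psi_inj A.bracket_closed[OF that] A.M.zero_closed] by simp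
      then show ?thesis
        by (simp add: psi_mult that)
    qed
    have Z: "Z = {z \<in> carrier L. \<forall>y. br a (psi z) y = 0}"
    proof -
      have "(\<forall>y\<in>carrier L. z \<otimes>\<^bsub>L\<^esub> y = \<zero>\<^bsub>L\<^esub>) \<longleftrightarrow> (\<forall>y. br a (psi z) y = 0)" if z: "z \<in> carrier L" for z
      proof
        assume *: "\<forall>y\<in>carrier L. z \<otimes>\<^bsub>L\<^esub> y = \<zero>\<^bsub>L\<^esub>"
        show "\<forall>y. br a (psi z) y = 0"
        proof
          fix y
          show "br a (psi z) y = 0"
            using * mult0[OF z iota[of y]] iota[of y] by (simp add: psi_iota)
        qed
      next
        assume "\<forall>y. br a (psi z) y = 0"
        then show "\<forall>y\<in>carrier L. z \<otimes>\<^bsub>L\<^esub> y = \<zero>\<^bsub>L\<^esub>"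
          using mult0[OF z] by simp
      qed
      then show ?thesis
        unfolding Z_def by blast
    qed
    have "lie_ideal L Z"
      unfolding lie_ideal_def
    proof (intro conjI ballI)
      have "psi ` Z = {u. \<forall>y. br a u y = 0}"
      proof
        show "{u. \<forall>y. br a u y = 0} \<subseteq> psi ` Z"
        proof
          fix u assume "u \<in> {u. \<forall>y. br a u y = 0}"
          then have "iota u \<in> Z"
            unfolding Z by (simp add: iota psi_iota)
          from imageI[OF this, of psi] show "u \<in> psi ` Z"
            by (simp add: psi_iota)
        qed
      qed (auto simp: Z)
      moreover have "vec.subspace {u. \<forall>y. br a u y = 0}"
        by (auto simp: vec.subspace_def W.br_add_left W.br_scale_left)
      ultimately show "vsubspace L Z"
        unfolding C.vsubspace_iff by (auto simp: Z)
      fix x y assume xy: "x \<in> carrier L" "y \<in> Z"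
      have "br a (psi y) u = 0" for u
        using xy(2) unfolding Z by blast
      moreover have "y \<in> carrier L"
        using xy(2) unfolding Z by blast
      ultimately have "psi (x \<otimes>\<^bsub>L\<^esub> y) = 0" "psi (y \<otimes>\<^bsub>L\<^esub> x) = 0"
        using W.br_commute[of "psi x" "psi y"] by (simp_all add: psi_mult xy(1))
      then show "x \<otimes>\<^bsub>L\<^esub> y \<in> Z" "y \<otimes>\<^bsub>L\<^esub> x \<in> Z"
        unfolding Z using xy(1) \<open>y \<in> carrier L\<close> by (simp_all add: A.bracket_closed)
    qed
    then have "Z = {\<zero>\<^bsub>L\<^esub>} \<or> Z = carrier L"
      using simple unfolding lie_simple_def by blast
    moreover have "Z \<noteq> carrier L"
      using simple unfolding lie_simple_def Z_def by blast
    ultimately have "Z = {\<zero>\<^bsub>L\<^esub>}"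
      by blast
    moreover have "iota x \<in> Z"
      unfolding Z using x by (simp add: iota psi_iota)
    ultimately have "psi (iota x) = psi \<zero>\<^bsub>L\<^esub>"
      by simp
    then show "x = 0"
      by (simp add: psi_iota)
  qed
  have psi_h: "psi (h i) = gen a (H i)" and h_closed: "h i \<in> carrier L" for i
    unfolding h W.contra_proj_gen psi_contra_proj P.carrier_eq by (simp_all del: gen.simps)
  interpret M: lie_model a s L psi sq h
  proof
    show "s (x + y) = s x + s y + br a x y" for x y
    proof -
      have "iota (x + y) = iota x \<oplus>\<^bsub>L\<^esub> iota y"
        using iota_psi[of "iota x \<oplus>\<^bsub>L\<^esub> iota y"] by (simp add: C.psi_add iota psi_iota)
      then show ?thesis
        by (simp add: s_def A.sq_add C.psi_add psi_mult iota psi_iota A.sq_closed A.bracket_closed)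
    qed
    show "s (c *s x) = c\<^sup>2 *s s x" for c x
    proof -
      have "iota (c *s x) = c \<odot>\<^bsub>L\<^esub> iota x"
        using iota_psi[of "c \<odot>\<^bsub>L\<^esub> iota x"] by (simp add: C.psi_smult iota psi_iota class_ring_simps)
      then show ?thesis
        by (simp add: s_def A.sq_smult C.psi_smult iota A.sq_closed)
    qed
    show "br a (s x) y = br a x (br a x y)" for x y
    proof -
      have "psi (sq (iota x) \<otimes>\<^bsub>L\<^esub> iota y) = psi (iota x \<otimes>\<^bsub>L\<^esub> (iota x \<otimes>\<^bsub>L\<^esub> iota y))"
        using A.ad_sq[OF iota iota] by simp
      then show ?thesis
        by (simp add: psi_mult iota psi_iota A.sq_closed A.bracket_closed s_def)
    qed
    show "x = 0" if "\<And>y. br a x y = 0" for x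
      by (rule center[OF that])
    show "psi (sq x) = s (psi x)" if "x \<in> carrier L" for x
      by (simp add: s_def iota_psi[OF that])
  qed (simp_all add: surj A.bracket_closed psi_mult A.sq_closed h_closed psi_h del: gen.simps)
  have T_eq: "T = M.diag_torus"
    unfolding T \<hh> M.vspan_h by (rule M.toral_part_diag_torus)
  have bs_eq: "bs = M.torus_list"
    unfolding bs M.torus_list_def ..
  have D_eq: "D = M.dual_group"
    unfolding D M.dual_group_def T_eq ..
  have G_eq: "G = M.root_group"
    unfolding G M.root_group_def D_eq dual_basis T_eq bs_eq ..
  show ?thesis
    unfolding T_eq G_eq D_eq
    using M.toral_rank_eq M.torus_diag_torus M.vdim_diag_torus M.direct_sum M.elementary_abelian_root_group M.card_root_group M.vdim_root_space
    by blast
qed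

end
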